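(* Let $(R,\mathfrak{m},k)$ be a one-dimensional analytically unramified Noetherian local domain with infinite residue field and canonical module $\omega_R$, and assume that $R$ is not Gorenstein. Then $R$ is almost Gorenstein if and only if $$\mathrm{h}(\omega_R)=e(J;R)-\mu(\omega_R)+1$$ for every partial trace ideal $J$ of $\omega_R$.
   Context: $R$ is analytically unramified if its $\mathfrak{m}$-adic completion is reduced; then a canonical module $\omega_R$ exists and is isomorphic to an ideal of $R$. $Q$ is the fraction field of $R$, $\overline{R}$ is the integral closure of $R$ in $Q$, and $\mathfrak{C}=R:_Q\overline{R}$ is the conductor ideal. $\mu(\cdot)$ denotes the minimal number of generators and $\lambda(\cdot)$ denotes length as an $R$-module. $R$ is almost Gorenstein if $\lambda(\overline{R}/R)=\lambda(R/\mathfrak{C})+\mu(\omega_R)-1$. For an $\mathfrak{m}$-primary ideal $I$, $e(I;R)$ is the Hilbert-Samuel multiplicity of $R$ with respect to $I$. For a finitely generated $R$-module $M$, $$\mathrm{h}(M):=\min\{\lambda(R/J)\mid J\subseteq R \text{ an ideal such that there is a surjection } M\to J\}.$$ An ideal $J$ of $R$ is a partial trace ideal of $M$ if there is a surjective $R$-linear map $M\to J$ and $\lambda(R/J)=\mathrm{h}(M)$. *)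

theory Defs
  imports
    Complex_Main
    "HOL-Library.Function_Algebras"
    "HOL-Library.Extended_Real"
    "HOL-Computational_Algebra.Polynomial_Factorial"
begin

text \<open>
  The ring \<open>R\<close> is a whole type \<open>'a\<close>, its fraction field \<open>Q\<close> is \<open>'a fract\<close>.  An \<open>R\<close>-module is a type
  with a scalar multiplication \<open>s\<close> satisfying the library locale \<open>module\<close>; submodules, spans and
  linear maps are those of that locale.  The modules \<open>R\<close>, \<open>Q\<close> and \<open>M\<^sup>n\<close> have the scalar
  multiplications \<open>(*)\<close>, \<open>fract_scale\<close> and \<open>vec_scale s\<close>.
\<close>

definition fract_scale :: "'a::idom \<Rightarrow> 'a fract \<Rightarrow> 'a fract" where
  "fract_scale r q = to_fract r * q"

definition vec_scale :: "('a \<Rightarrow> 'b \<Rightarrow> 'b) \<Rightarrow> 'a \<Rightarrow> (nat \<Rightarrow> 'b) \<Rightarrow> (nat \<Rightarrow> 'b)" where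
  "vec_scale s r x = (\<lambda>j. s r (x j))"

lemma module_times: "module ((*) :: 'a::comm_ring_1 \<Rightarrow> 'a \<Rightarrow> 'a)"
  by unfold_locales (auto simp: algebra_simps)

lemma module_fract_scale: "module (fract_scale :: 'a::idom \<Rightarrow> 'a fract \<Rightarrow> 'a fract)"
  by unfold_locales (auto simp: fract_scale_def algebra_simps)

lemma module_vec_scale:
  fixes s :: "'a::comm_ring_1 \<Rightarrow> 'b::ab_group_add \<Rightarrow> 'b"
  assumes "module s"
  shows "module (vec_scale s)"
proof -
  interpret module s by fact
  show ?thesis
    by unfold_locales
      (auto simp: vec_scale_def fun_eq_iff scale_left_distrib scale_right_distrib)
qed

definition fin_gen :: "('a::comm_ring_1 \<Rightarrow> 'b::ab_group_add \<Rightarrow> 'b) \<Rightarrow> 'b set \<Rightarrow> bool" where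
  "fin_gen s N \<longleftrightarrow> (\<exists>S. finite S \<and> module.span s S = N)"

definition min_gens :: "('a::comm_ring_1 \<Rightarrow> 'b::ab_group_add \<Rightarrow> 'b) \<Rightarrow> nat" where
  "min_gens s = (LEAST n. \<exists>S. finite S \<and> card S = n \<and> module.span s S = UNIV)"

text \<open>
  The length of \<open>M / N\<close> for submodules \<open>N \<subseteq> M\<close>: submodules of \<open>M / N\<close> are given as submodules of \<open>M\<close>
  containing \<open>N\<close>.
\<close>

definition quot_length ::
  "('a::comm_ring_1 \<Rightarrow> 'b::ab_group_add \<Rightarrow> 'b) \<Rightarrow> 'b set \<Rightarrow> 'b set \<Rightarrow> enat" where
  "quot_length s M N = Sup {enat n | n. \<exists>c :: nat \<Rightarrow> 'b set.
     (\<forall>i\<le>n. module.subspace s (c i) \<and> N \<subseteq> c i \<and> c i \<subseteq> M) \<and> (\<forall>i<n. c i \<subset> c (Suc i))}"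

abbreviation is_ideal :: "'a::comm_ring_1 set \<Rightarrow> bool" where
  "is_ideal I \<equiv> module.subspace (*) I"

definition colength :: "'a::comm_ring_1 set \<Rightarrow> enat" where
  "colength I = quot_length (*) UNIV I"

definition ideal_mult :: "'a::comm_ring_1 set \<Rightarrow> 'a set \<Rightarrow> 'a set" where
  "ideal_mult I J = module.span (*) {a * b | a b. a \<in> I \<and> b \<in> J}"

primrec ideal_power :: "'a::comm_ring_1 set \<Rightarrow> nat \<Rightarrow> 'a set" where
  "ideal_power I 0 = UNIV"
| "ideal_power I (Suc n) = ideal_mult I (ideal_power I n)"

definition prime_ideal :: "'a::comm_ring_1 set \<Rightarrow> bool" where
  "prime_ideal P \<longleftrightarrow> is_ideal P \<and> P \<noteq> UNIV \<and> (\<forall>a b. a * b \<in> P \<longrightarrow> a \<in> P \<or> b \<in> P)"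

definition maximal_ideal :: "'a::comm_ring_1 set \<Rightarrow> bool" where
  "maximal_ideal M \<longleftrightarrow> is_ideal M \<and> M \<noteq> UNIV \<and>
     (\<forall>I. is_ideal I \<and> M \<subseteq> I \<longrightarrow> I = M \<or> I = UNIV)"

definition local_ring :: "'a::comm_ring_1 set \<Rightarrow> bool" where
  "local_ring m \<longleftrightarrow> {M. maximal_ideal M} = {m}"

definition noetherian_ring :: "'a::comm_ring_1 itself \<Rightarrow> bool" where
  "noetherian_ring _ \<longleftrightarrow> (\<forall>I :: 'a set. is_ideal I \<longrightarrow> fin_gen (*) I)"

definition krull_dim :: "'a::comm_ring_1 itself \<Rightarrow> enat" where
  "krull_dim _ = Sup {enat n | n. \<exists>P :: nat \<Rightarrow> 'a set.
     (\<forall>i\<le>n. prime_ideal (P i)) \<and> (\<forall>i<n. P i \<subset> P (Suc i))}"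

definition coset :: "'a::comm_ring_1 set \<Rightarrow> 'a \<Rightarrow> 'a set" where
  "coset I a = (+) a ` I"

definition residue_ring :: "'a::comm_ring_1 set \<Rightarrow> 'a set set" where
  "residue_ring I = range (coset I)"

text \<open>
  The \<open>m\<close>-adic completion is the inverse limit of the rings \<open>R / m\<^sup>n\<close>; for residue classes the
  transition maps are inclusions.
\<close>

definition completion :: "'a::comm_ring_1 set \<Rightarrow> (nat \<Rightarrow> 'a set) set" where
  "completion m = {x. (\<forall>n. x n \<in> residue_ring (ideal_power m n)) \<and> (\<forall>n. x (Suc n) \<subseteq> x n)}"

definition compl_zero :: "'a::comm_ring_1 set \<Rightarrow> nat \<Rightarrow> 'a set" where
  "compl_zero m n = coset (ideal_power m n) 0"

definition compl_one :: "'a::comm_ring_1 set \<Rightarrow> nat \<Rightarrow> 'a set" where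
  "compl_one m n = coset (ideal_power m n) 1"

definition compl_mult ::
  "'a::comm_ring_1 set \<Rightarrow> (nat \<Rightarrow> 'a set) \<Rightarrow> (nat \<Rightarrow> 'a set) \<Rightarrow> (nat \<Rightarrow> 'a set)" where
  "compl_mult m x y n = (\<Union>a\<in>x n. \<Union>b\<in>y n. coset (ideal_power m n) (a * b))"

primrec compl_power :: "'a::comm_ring_1 set \<Rightarrow> (nat \<Rightarrow> 'a set) \<Rightarrow> nat \<Rightarrow> (nat \<Rightarrow> 'a set)" where
  "compl_power m x 0 = compl_one m"
| "compl_power m x (Suc k) = compl_mult m x (compl_power m x k)"

definition analytically_unramified :: "'a::comm_ring_1 set \<Rightarrow> bool" where
  "analytically_unramified m \<longleftrightarrow>
     (\<forall>x\<in>completion m. \<forall>k. compl_power m x k = compl_zero m \<longrightarrow> x = compl_zero m)"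

text \<open>
  \<open>vecs n\<close> is the direct sum of \<open>n\<close> copies of a module, and \<open>mat_map s A p q\<close> is multiplication by
  the \<open>p \<times> q\<close> matrix \<open>A\<close> over \<open>R\<close>, from \<open>M\<^sup>q\<close> to \<open>M\<^sup>p\<close>.
\<close>

definition vecs :: "nat \<Rightarrow> (nat \<Rightarrow> 'b::zero) set" where
  "vecs n = {v. \<forall>j\<ge>n. v j = 0}"

definition mat_map :: "('a \<Rightarrow> 'b::comm_monoid_add \<Rightarrow> 'b) \<Rightarrow> (nat \<Rightarrow> nat \<Rightarrow> 'a) \<Rightarrow> nat \<Rightarrow> nat \<Rightarrow>
    (nat \<Rightarrow> 'b) \<Rightarrow> (nat \<Rightarrow> 'b)" where
  "mat_map s A p q x = (\<lambda>j. if j < p then \<Sum>l<q. s (A j l) (x l) else 0)"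

text \<open>
  A resolution of \<open>R / I\<close> by free modules \<open>F\<^sub>i = R\<^sup>r\<^sup>(\<^sup>i\<^sup>)\<close>, with differentials \<open>F\<^sub>i\<^sub>+\<^sub>1 \<rightarrow> F\<^sub>i\<close> given by the
  matrices \<open>d i\<close> and augmentation \<open>F\<^sub>0 \<rightarrow> R / I\<close> sending the \<open>j\<close>-th basis vector to the class of \<open>w j\<close>.
\<close>

definition free_resolution ::
  "'a::comm_ring_1 set \<Rightarrow> (nat \<Rightarrow> nat) \<Rightarrow> (nat \<Rightarrow> 'a) \<Rightarrow> (nat \<Rightarrow> nat \<Rightarrow> nat \<Rightarrow> 'a) \<Rightarrow> bool" where
  "free_resolution I r w d \<longleftrightarrow>
     (\<forall>a. \<exists>v\<in>vecs (r 0). (\<Sum>j<r 0. v j * w j) - a \<in> I) \<and>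
     (\<forall>v\<in>vecs (r 0). (\<Sum>j<r 0. v j * w j) \<in> I \<longleftrightarrow>
        v \<in> mat_map (*) (d 0) (r 0) (r 1) ` vecs (r 1)) \<and>
     (\<forall>i. \<forall>v\<in>vecs (r (Suc i)). mat_map (*) (d i) (r i) (r (Suc i)) v = 0 \<longleftrightarrow>
        v \<in> mat_map (*) (d (Suc i)) (r (Suc i)) (r (Suc (Suc i))) ` vecs (r (Suc (Suc i))))"

text \<open>
  With \<open>Hom(R\<^sup>n, M) = M\<^sup>n\<close>, the complex \<open>Hom(F, M)\<close> has the transposed matrices as differentials, and
  \<open>Ext\<^sup>i(R / I, M)\<close> is its cohomology.
\<close>

definition hom_diff :: "('a::comm_ring_1 \<Rightarrow> 'b::ab_group_add \<Rightarrow> 'b) \<Rightarrow> (nat \<Rightarrow> nat) \<Rightarrow>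
    (nat \<Rightarrow> nat \<Rightarrow> nat \<Rightarrow> 'a) \<Rightarrow> nat \<Rightarrow> (nat \<Rightarrow> 'b) \<Rightarrow> (nat \<Rightarrow> 'b)" where
  "hom_diff s r d i = mat_map s (\<lambda>l j. d i j l) (r (Suc i)) (r i)"

definition cocycles :: "('a::comm_ring_1 \<Rightarrow> 'b::ab_group_add \<Rightarrow> 'b) \<Rightarrow> (nat \<Rightarrow> nat) \<Rightarrow>
    (nat \<Rightarrow> nat \<Rightarrow> nat \<Rightarrow> 'a) \<Rightarrow> nat \<Rightarrow> (nat \<Rightarrow> 'b) set" where
  "cocycles s r d i = {x \<in> vecs (r i). hom_diff s r d i x = 0}"

definition coboundaries :: "('a::comm_ring_1 \<Rightarrow> 'b::ab_group_add \<Rightarrow> 'b) \<Rightarrow> (nat \<Rightarrow> nat) \<Rightarrow>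
    (nat \<Rightarrow> nat \<Rightarrow> nat \<Rightarrow> 'a) \<Rightarrow> nat \<Rightarrow> (nat \<Rightarrow> 'b) set" where
  "coboundaries s r d i =
     (case i of 0 \<Rightarrow> {0} | Suc i' \<Rightarrow> hom_diff s r d i' ` vecs (r i'))"

definition ext_length :: "('a::comm_ring_1 \<Rightarrow> 'b::ab_group_add \<Rightarrow> 'b) \<Rightarrow> (nat \<Rightarrow> nat) \<Rightarrow>
    (nat \<Rightarrow> nat \<Rightarrow> nat \<Rightarrow> 'a) \<Rightarrow> nat \<Rightarrow> enat" where
  "ext_length s r d i = quot_length (vec_scale s) (cocycles s r d i) (coboundaries s r d i)"

text \<open>
  A canonical module of \<open>(R, m, k)\<close> is a finitely generated module \<open>M\<close> such that
  \<open>dim\<^sub>k Ext\<^sup>i(k, M)\<close> is \<open>1\<close> for \<open>i = dim R\<close> and \<open>0\<close> otherwise, i.e. a maximal Cohen-Macaulay module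
  of type \<open>1\<close> and finite injective dimension (Bruns and Herzog, Section 3.3).  As \<open>m\<close> annihilates
  \<open>Ext\<^sup>i(k, M)\<close>, its \<open>k\<close>-dimension is its length, which does not depend on the resolution.
\<close>

definition canonical_module ::
  "'a::comm_ring_1 set \<Rightarrow> ('a \<Rightarrow> 'b::ab_group_add \<Rightarrow> 'b) \<Rightarrow> bool" where
  "canonical_module m s \<longleftrightarrow> module s \<and> fin_gen s UNIV \<and>
     (\<exists>r w d. free_resolution m r w d \<and>
        (\<forall>i. ext_length s r d i = (if enat i = krull_dim TYPE('a) then 1 else 0)))"

text \<open>
  \<open>R\<close> is Gorenstein if it is a canonical module of itself; unfolded, this is the condition
  \<open>Ext\<^sup>i(k, R) = 0\<close> for \<open>i \<noteq> dim R\<close> and \<open>Ext\<^sup>i(k, R) \<cong> k\<close> for \<open>i = dim R\<close>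
  (Matsumura, Commutative Ring Theory, Theorem 18.1).
\<close>

definition gorenstein :: "'a::comm_ring_1 set \<Rightarrow> bool" where
  "gorenstein m \<longleftrightarrow> canonical_module m ((*) :: 'a \<Rightarrow> 'a \<Rightarrow> 'a)"

definition integral_closure :: "'a::idom fract set" where
  "integral_closure =
     {q. \<exists>p :: 'a poly. lead_coeff p = 1 \<and> poly (map_poly to_fract p) q = 0}"

definition conductor :: "'a::idom fract set" where
  "conductor = {q. \<forall>b\<in>integral_closure. q * b \<in> range to_fract}"

text \<open>
  The argument is a canonical module of \<open>R\<close>; it enters through its number of generators only.
\<close>

definition almost_gorenstein :: "('a::idom \<Rightarrow> 'b::ab_group_add \<Rightarrow> 'b) \<Rightarrow> bool" where
  "almost_gorenstein s \<longleftrightarrow>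
     quot_length fract_scale (integral_closure :: 'a fract set) (range to_fract) =
     quot_length fract_scale (range to_fract) (conductor :: 'a fract set) + enat (min_gens s) - 1"

text \<open>
  The value \<open>\<infinity>\<close> of \<open>colength\<close> is allowed here; infima in \<^typ>\<open>enat\<close> of nonempty sets are minima.
\<close>

definition h_inv :: "('a::comm_ring_1 \<Rightarrow> 'b::ab_group_add \<Rightarrow> 'b) \<Rightarrow> enat" where
  "h_inv s = Inf {colength J | J. is_ideal J \<and> (\<exists>f. module_hom s (*) f \<and> range f = J)}"

definition partial_trace_ideal ::
  "('a::comm_ring_1 \<Rightarrow> 'b::ab_group_add \<Rightarrow> 'b) \<Rightarrow> 'a set \<Rightarrow> bool" where
  "partial_trace_ideal s J \<longleftrightarrow>
     is_ideal J \<and> (\<exists>f. module_hom s (*) f \<and> range f = J) \<and> colength J = h_inv s"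

text \<open>
  The Hilbert-Samuel multiplicity \<open>e(I; R) = lim d! \<lambda>(R / I\<^sup>n) / n\<^sup>d\<close>, where \<open>d = dim R\<close>, of an
  \<open>m\<close>-primary ideal \<open>I\<close>; for such an ideal the lengths and \<open>d\<close> are finite and the limit exists.
\<close>

definition hs_mult :: "'a::comm_ring_1 set \<Rightarrow> real" where
  "hs_mult I = (let d = the_enat (krull_dim TYPE('a)) in
     lim (\<lambda>n. fact d * real (the_enat (colength (ideal_power I n))) / real n ^ d))"

end

theory Submission
  imports Defs "HOL-Library.Set_Algebras"
begin

text \<open>
  Let \<open>B\<close> be the integral closure of \<open>R\<close>, \<open>C\<close> the conductor, \<open>\<omega>\<close> the canonical module, and \<open>\<lambda>\<close> the
  length. Both conditions say that a certain fractional ideal \<open>K\<close> isomorphic to \<open>\<omega>\<close>, with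
  \<open>R \<subseteq> K \<subseteq> B\<close>, satisfies \<open>\<lambda>(K / R) = \<mu>(\<omega>) - 1\<close>.

  A partial trace ideal \<open>J\<close> has finite colength and is therefore nonzero. A nonzero homomorphism from
  \<open>\<omega>\<close> to \<open>R\<close> is injective (\<open>nonzero_functional_inj\<close>), so \<open>J\<close> is isomorphic to \<open>\<omega>\<close>. As the residue field
  is infinite, there is \<open>x\<close> in \<open>J\<close> with \<open>J \<subseteq> x B\<close> (\<open>ex_principal_reduction\<close>), and one takes
  \<open>K = J / x\<close>. The powers of \<open>J\<close> stay within bounded distance of those of \<open>x R\<close>, so that
  \<open>e(J) = \<lambda>(R / x R)\<close> (\<open>hs_mult_eq_principal_colength\<close>), and
  \<open>h(\<omega>) = \<lambda>(R / J) = \<lambda>(R / x R) - \<lambda>(J / x R) = e(J) - \<lambda>(K / R)\<close>. On the other hand, canonical duality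
  gives \<open>\<lambda>(B / R) = \<lambda>(K / (K : B))\<close> with \<open>K : B = C\<close>, and so \<open>\<lambda>(B / R) = \<lambda>(K / R) + \<lambda>(R / C)\<close>
  (\<open>integral_closure_length\<close>). The two conditions are thus equivalent for each single \<open>J\<close>, and a
  partial trace ideal exists.

  Duality is obtained by counting. That \<open>Ext\<^sup>1(k, \<omega>)\<close> is simple means that the socle of \<open>\<omega> / x \<omega>\<close> has
  length at most one, which gives \<open>\<lambda>((K : I') / (K : I)) \<le> \<lambda>(I / I')\<close> by induction on the length of
  \<open>I / I'\<close> (\<open>pairing_length_le\<close>). For principal ideals the two sides agree, because
  \<open>\<lambda>(K / d K) = \<lambda>(R / d R)\<close> for every nonzero fractional ideal \<open>K\<close> (\<open>fract_length_times_self\<close>). As lengths add up,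
  they agree for everything between two principal ideals (\<open>fract_length_colon\<close>). The same count
  applied to \<open>\<omega> / x \<omega>\<close> shows that \<open>\<omega>\<close> has rank one.

  All lengths are finite because \<open>B\<close> has a common denominator
  (\<open>fractional_integral_closure\<close>). Otherwise the ideals \<open>x\<^sup>n B \<inter> R\<close> would not shrink into \<open>x R\<close>, and would
  contain the terms of a sequence with a nonzero limit in the completion. This limit is nilpotent,
  since the elements of \<open>B\<close> satisfy monic equations of bounded degree.
\<close>

section \<open>Length\<close>

definition chain_between ::
  "('a::comm_ring_1 \<Rightarrow> 'b::ab_group_add \<Rightarrow> 'b) \<Rightarrow> 'b set \<Rightarrow> 'b set \<Rightarrow> nat \<Rightarrow> (nat \<Rightarrow> 'b set) \<Rightarrow> bool"
  where "chain_between s N L n c \<longleftrightarrow>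
     (\<forall>i\<le>n. module.subspace s (c i) \<and> N \<subseteq> c i \<and> c i \<subseteq> L) \<and> (\<forall>i<n. c i \<subset> c (Suc i))"

context module
begin

lemma len_eq_Sup_chains: "quot_length scale L N = Sup {enat n | n. \<exists>c. chain_between scale N L n c}"
  by (simp add: quot_length_def chain_between_def)

lemma chain_le_len: "chain_between scale N L n c \<Longrightarrow> enat n \<le> quot_length scale L N"
  unfolding len_eq_Sup_chains by (rule Sup_upper) blast

lemma len_leI: "(\<And>n c. chain_between scale N L n c \<Longrightarrow> enat n \<le> b) \<Longrightarrow> quot_length scale L N \<le> b"
  unfolding len_eq_Sup_chains by (rule Sup_least) blast

lemma enat_le_len_iff:
  assumes "subspace N" "N \<subseteq> L"
  shows "enat n \<le> quot_length scale L N \<longleftrightarrow> (\<exists>c. chain_between scale N L n c)"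
proof
  assume le: "enat n \<le> quot_length scale L N"
  show "\<exists>c. chain_between scale N L n c"
  proof (cases n)
    case 0
    then show ?thesis
      using assms by (intro exI[of _ "\<lambda>_. N"]) (auto simp: chain_between_def)
  next
    case (Suc k)
    show ?thesis
    proof (rule ccontr)
      assume no: "\<nexists>c. chain_between scale N L n c"
      have "quot_length scale L N \<le> enat k"
      proof (rule len_leI)
        fix p c assume c: "chain_between scale N L p c"
        have "\<not> n \<le> p"
        proof
          assume "n \<le> p"
          then have "chain_between scale N L n c"
            using c by (auto simp: chain_between_def)
          with no show False by blast
        qed
        then show "enat p \<le> enat k" using Suc by simp
      qed
      with le Suc show False
        by (metis Suc_n_not_le_n enat_ord_simps(1) order_trans)
    qed
  qed
next
  assume "\<exists>c. chain_between scale N L n c"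
  then show "enat n \<le> quot_length scale L N" using chain_le_len by blast
qed

lemma weak_chain_thin:
  assumes "\<forall>i\<le>n. subspace (c i) \<and> N \<subseteq> c i \<and> c i \<subseteq> L" "\<forall>i<n. c i \<subseteq> c (Suc i)"
  shows "\<exists>c'. chain_between scale N L (card {i. i < n \<and> c i \<noteq> c (Suc i)}) c'
    \<and> c' (card {i. i < n \<and> c i \<noteq> c (Suc i)}) = c n"
  using assms
proof (induction n)
  case 0
  then show ?case by (intro exI[of _ c]) (auto simp: chain_between_def)
next
  case (Suc n)
  let ?S = "\<lambda>n. {i. i < n \<and> c i \<noteq> c (Suc i)}"
  obtain c' where c': "chain_between scale N L (card (?S n)) c'" "c' (card (?S n)) = c n"
    using Suc by force
  show ?case
  proof (cases "c n = c (Suc n)")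
    case True
    then have "?S (Suc n) = ?S n" by (auto simp: less_Suc_eq)
    with c' True show ?thesis by auto
  next
    case False
    then have "?S (Suc n) = insert n (?S n)" by (auto simp: less_Suc_eq)
    then have k: "card (?S (Suc n)) = Suc (card (?S n))" by simp
    define p where "p = card (?S n)"
    let ?c = "\<lambda>i. if i \<le> p then c' i else c (Suc n)"
    have last: "subspace (c (Suc n))" "N \<subseteq> c (Suc n)" "c (Suc n) \<subseteq> L" "c n \<subset> c (Suc n)"
      using Suc.prems False by auto
    have c'p: "chain_between scale N L p c'" "c' p = c n" using c' unfolding p_def by auto
    have "chain_between scale N L (Suc p) ?c"
      unfolding chain_between_def
    proof (intro conjI allI impI)
      fix i assume "i < Suc p"
      then consider "i < p" | "i = p" by linarith
      then show "?c i \<subset> ?c (Suc i)"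
        by cases (use c'p last in \<open>auto simp: chain_between_def\<close>)
    qed (use c'p last in \<open>auto simp: chain_between_def\<close>)
    moreover have "?c (Suc p) = c (Suc n)" by simp
    ultimately show ?thesis unfolding k p_def[symmetric] by blast
  qed
qed

lemma weak_chain_le_len:
  assumes "\<forall>i\<le>n. subspace (c i) \<and> N \<subseteq> c i \<and> c i \<subseteq> L" "\<forall>i<n. c i \<subseteq> c (Suc i)"
  shows "enat (card {i. i < n \<and> c i \<noteq> c (Suc i)}) \<le> quot_length scale L N"
  using weak_chain_thin[OF assms] chain_le_len by blast

lemma subspace_set_plus: "subspace A \<Longrightarrow> subspace B \<Longrightarrow> subspace (A + B)"
proof (rule subspaceI)
  assume s: "subspace A" "subspace B"
  show "0 \<in> A + B" using set_plus_intro[of 0 A 0 B] s subspace_0 by simp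
  fix x y assume "x \<in> A + B" "y \<in> A + B"
  then obtain a b a' b' where "x = a + b" "y = a' + b'" "a \<in> A" "a' \<in> A" "b \<in> B" "b' \<in> B"
    by (auto elim!: set_plus_elim)
  then show "x + y \<in> A + B"
    using set_plus_intro[of "a + a'" A "b + b'" B] s by (simp add: subspace_add algebra_simps)
next
  assume s: "subspace A" "subspace B"
  fix c x assume "x \<in> A + B"
  then obtain a b where "x = a + b" "a \<in> A" "b \<in> B" by (auto elim!: set_plus_elim)
  then show "c *s x \<in> A + B"
    using set_plus_intro[of "c *s a" A "c *s b" B] s by (simp add: subspace_scale scale_right_distrib)
qed

lemma subset_set_plus1: "0 \<in> B \<Longrightarrow> A \<subseteq> A + B" for A B :: "'b set"
  by (rule subsetI) (use set_plus_intro[of _ A 0 B] in simp)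

lemma subset_set_plus2: "0 \<in> A \<Longrightarrow> B \<subseteq> A + B" for A B :: "'b set"
  by (rule subsetI) (use set_plus_intro[of 0 A _ B] in simp)

lemma set_plus_subset: "subspace L \<Longrightarrow> A \<subseteq> L \<Longrightarrow> B \<subseteq> L \<Longrightarrow> A + B \<subseteq> L"
  by (auto simp: set_plus_def intro: subspace_add)

text \<open>The modular law.\<close>

lemma modular_eq:
  assumes "subspace A" "subspace B" "subspace M" "A \<subseteq> B" "A \<inter> M = B \<inter> M" "A + M = B + M"
  shows "A = B"
proof
  show "B \<subseteq> A"
  proof
    fix b assume b: "b \<in> B"
    then have "b \<in> A + M" using assms(3,6) subset_set_plus1 subspace_0 by blast
    then obtain a y where y: "b = a + y" "a \<in> A" "y \<in> M" by (rule set_plus_elim)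
    then have "y = b - a" by simp
    then have "y \<in> B" using y b assms(2,4) subspace_diff by blast
    then have "y \<in> A" using y assms(5) by blast
    then show "b \<in> A" using y assms(1) subspace_add by blast
  qed
qed fact

end

lemma enat_add_eq_1D: "a + b = 1 \<Longrightarrow> 1 \<le> b \<Longrightarrow> a = 0" for a b :: enat
  by (cases a; cases b) (auto simp: one_enat_def enat_0_iff)

lemma enat_plus_leI:
  assumes "\<And>p q. enat p \<le> a \<Longrightarrow> enat q \<le> b \<Longrightarrow> enat (p + q) \<le> c"
  shows "a + b \<le> c"
proof (cases c)
  case (enat k)
  have *: "\<exists>n. x = enat n" if "\<And>p. enat p \<le> x \<Longrightarrow> p \<le> k" for x
    using that[of "Suc k"] by (cases x) auto
  obtain a' where "a = enat a'" using *[of a] assms[of _ 0] enat by (auto simp: zero_enat_def[symmetric])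
  moreover obtain b' where "b = enat b'" using *[of b] assms[of 0] enat by (auto simp: zero_enat_def[symmetric])
  ultimately show ?thesis using assms[of a' b'] by simp
qed simp

context module
begin

text \<open>A chain between \<open>N\<close> and \<open>L\<close> is cut with \<open>M\<close> and added to \<open>M\<close>; by the modular law each of its steps
  survives in one of the two chains. Conversely, a chain below \<open>M\<close> and a chain above \<open>M\<close> are
  concatenated.\<close>

theorem len_additive:
  assumes s: "subspace N" "subspace M" "subspace L" and sub: "N \<subseteq> M" "M \<subseteq> L"
  shows "quot_length scale L N = quot_length scale L M + quot_length scale M N"
proof (rule antisym)
  show "quot_length scale L N \<le> quot_length scale L M + quot_length scale M N"
  proof (rule len_leI)
    fix n c assume c: "chain_between scale N L n c"
    let ?A = "\<lambda>i. c i \<inter> M" and ?B = "\<lambda>i. c i + M"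
    let ?S = "\<lambda>d. {i. i < n \<and> d i \<noteq> d (Suc i)}"
    have 1: "enat (card (?S ?A)) \<le> quot_length scale M N"
      by (rule weak_chain_le_len) (use c sub s in \<open>auto simp: chain_between_def subspace_inter\<close>)
    have 2: "enat (card (?S ?B)) \<le> quot_length scale L M"
    proof (rule weak_chain_le_len)
      show "\<forall>i\<le>n. subspace (c i + M) \<and> M \<subseteq> c i + M \<and> c i + M \<subseteq> L"
      proof (intro allI impI)
        fix i assume "i \<le> n"
        then have "subspace (c i)" "c i \<subseteq> L" using c by (auto simp: chain_between_def)
        then show "subspace (c i + M) \<and> M \<subseteq> c i + M \<and> c i + M \<subseteq> L"
          using s sub subspace_set_plus subset_set_plus2 set_plus_subset subspace_0 by meson
      qed
      show "\<forall>i<n. c i + M \<subseteq> c (Suc i) + M"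
        using c by (meson chain_between_def order.refl psubset_imp_subset set_plus_mono2)
    qed
    have "{..<n} \<subseteq> ?S ?A \<union> ?S ?B"
    proof
      fix i assume i: "i \<in> {..<n}"
      then have ss: "c i \<subset> c (Suc i)" and "subspace (c i)" "subspace (c (Suc i))"
        using c by (auto simp: chain_between_def)
      then have "\<not> (?A i = ?A (Suc i) \<and> ?B i = ?B (Suc i))"
        using modular_eq[of "c i" "c (Suc i)" M] s by blast
      then show "i \<in> ?S ?A \<union> ?S ?B" using i by auto
    qed
    then have "n \<le> card (?S ?A \<union> ?S ?B)"
      using card_mono[of "?S ?A \<union> ?S ?B" "{..<n}"] by simp
    also have "\<dots> \<le> card (?S ?A) + card (?S ?B)" by (rule card_Un_le)
    finally have "enat n \<le> enat (card (?S ?B)) + enat (card (?S ?A))" by simp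
    also have "\<dots> \<le> quot_length scale L M + quot_length scale M N" using 1 2 by (rule add_mono[rotated])
    finally show "enat n \<le> quot_length scale L M + quot_length scale M N" .
  qed
  show "quot_length scale L M + quot_length scale M N \<le> quot_length scale L N"
  proof (rule enat_plus_leI)
    fix p q assume "enat p \<le> quot_length scale L M" "enat q \<le> quot_length scale M N"
    then obtain c d where "chain_between scale M L p c" "chain_between scale N M q d"
      using enat_le_len_iff[of M L p] enat_le_len_iff[of N M q] s sub by auto
    then have c0: "\<And>i. i \<le> p \<Longrightarrow> subspace (c i) \<and> M \<subseteq> c i \<and> c i \<subseteq> L"
      and c1: "\<And>i. i < p \<Longrightarrow> c i \<subset> c (Suc i)"
      and d0: "\<And>i. i \<le> q \<Longrightarrow> subspace (d i) \<and> N \<subseteq> d i \<and> d i \<subseteq> M"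
      and d1: "\<And>i. i < q \<Longrightarrow> d i \<subset> d (Suc i)"
      by (simp_all add: chain_between_def)
    let ?e = "\<lambda>i. if i \<le> q then d i else c (i - q)"
    have "chain_between scale N L (p + q) ?e"
      unfolding chain_between_def
    proof (intro conjI allI impI)
      fix i assume "i \<le> p + q"
      then have "subspace (?e i) \<and> N \<subseteq> ?e i \<and> ?e i \<subseteq> L"
      proof (cases "i \<le> q")
        case True
        then show ?thesis using d0[OF True] sub by auto
      next
        case False
        then have "i - q \<le> p" using \<open>i \<le> p + q\<close> by simp
        then show ?thesis using False c0[of "i - q"] sub by auto
      qed
      then show "subspace (?e i)" "N \<subseteq> ?e i" "?e i \<subseteq> L" by auto
    next
      fix i assume i: "i < p + q"
      consider "i < q" | "i = q" | "i > q" by linarith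
      then show "?e i \<subset> ?e (Suc i)"
      proof cases
        case 1
        then show ?thesis using d1 by simp
      next
        case 2
        then show ?thesis using d0[of q] c0[of 0] c1[of 0] i by auto
      next
        case 3
        then have "Suc (i - q) = Suc i - q" "i - q < p" using i by auto
        then show ?thesis using 3 c1[of "i - q"] by simp
      qed
    qed
    then show "enat (p + q) \<le> quot_length scale L N" by (rule chain_le_len)
  qed
qed

lemma len_mono:
  assumes "N \<subseteq> N'" "L' \<subseteq> L"
  shows "quot_length scale L' N' \<le> quot_length scale L N"
proof (rule len_leI, rule chain_le_len)
  fix n c assume "chain_between scale N' L' n c"
  then show "chain_between scale N L n c"
    using assms unfolding chain_between_def by (meson order_trans)
qed

lemma len_self [simp]: "quot_length scale N N = 0"
proof -
  have "quot_length scale N N \<le> 0"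
  proof (rule len_leI)
    fix n c assume c: "chain_between scale N N n c"
    show "enat n \<le> 0"
    proof (cases n)
      case (Suc k)
      then have "c 0 = N" "c (Suc 0) = N" "c 0 \<subset> c (Suc 0)"
        using c by (auto simp: chain_between_def)
      then show ?thesis by blast
    qed (simp add: zero_enat_def)
  qed
  then show ?thesis by simp
qed

lemma len_proper:
  assumes "subspace N" "subspace L" "N \<subset> L"
  shows "1 \<le> quot_length scale L N"
proof -
  have "chain_between scale N L 1 (\<lambda>i. if i = 0 then N else L)"
    using assms by (auto simp: chain_between_def)
  then show ?thesis using chain_le_len one_enat_def by metis
qed

lemma len_eq_0_iff:
  assumes "subspace N" "subspace L" "N \<subseteq> L"
  shows "quot_length scale L N = 0 \<longleftrightarrow> L = N"
proof
  show "L = N" if "quot_length scale L N = 0"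
  proof (rule ccontr)
    assume "L \<noteq> N"
    then have "1 \<le> quot_length scale L N" using assms by (intro len_proper) auto
    with that show False by simp
  qed
qed (simp add: len_self)

text \<open>A module of finite length is the last term of a maximal chain; its first step gives a simple
  submodule and its last step a simple quotient.\<close>

lemma ex_simple_sub_and_quotient:
  assumes s: "subspace N" "subspace L" and "N \<subset> L" and fin: "quot_length scale L N = enat n"
  shows "\<exists>M. subspace M \<and> N \<subset> M \<and> M \<subseteq> L \<and> quot_length scale M N = 1"
    and "\<exists>M. subspace M \<and> N \<subseteq> M \<and> M \<subset> L \<and> quot_length scale L M = 1"
proof -
  obtain c where c: "chain_between scale N L n c"
    using fin enat_le_len_iff[of N L n] s assms(3) by auto
  obtain k where k: "n = Suc k"
    using len_proper[OF s assms(3)] fin by (cases n) (auto simp: zero_enat_def[symmetric])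
  have ss: "subspace (c i)" "N \<subseteq> c i" "c i \<subseteq> L" if "i \<le> n" for i
    using that c by (auto simp: chain_between_def)
  have step_lt: "c i \<subset> c (Suc i)" if "i < n" for i
    using that c by (auto simp: chain_between_def)
  have "chain_between scale (c 1) L k (\<lambda>i. c (Suc i))"
    unfolding chain_between_def
  proof (intro conjI allI impI)
    fix i assume "i \<le> k"
    then show "subspace (c (Suc i))" "c (Suc i) \<subseteq> L" using ss k by auto
    show "c 1 \<subseteq> c (Suc i)" using \<open>i \<le> k\<close>
    proof (induction i)
      case (Suc i)
      then show ?case using step_lt[of "Suc i"] k by auto
    qed simp
  qed (use step_lt k in auto)
  then have up: "enat k \<le> quot_length scale L (c 1)" by (rule chain_le_len)
  have "quot_length scale L N = quot_length scale L (c 1) + quot_length scale (c 1) N"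
    using len_additive[of N "c 1" L] s ss[of 1] k by simp
  then have "enat k + quot_length scale (c 1) N \<le> enat (Suc k)" using up fin k by (metis add_right_mono)
  then have "quot_length scale (c 1) N \<le> 1" by (cases "quot_length scale (c 1) N") (auto simp: one_enat_def)
  moreover have "N \<subset> c 1" using ss[of 0] step_lt[of 0] k by auto
  ultimately have "quot_length scale (c 1) N = 1" using len_proper[OF s(1)] ss[of 1] k by (simp add: antisym)
  then show "\<exists>M. subspace M \<and> N \<subset> M \<and> M \<subseteq> L \<and> quot_length scale M N = 1"
    using \<open>N \<subset> c 1\<close> ss[of 1] k by auto
  have "chain_between scale N (c k) k c"
    unfolding chain_between_def
  proof (intro conjI allI impI)
    fix i assume "i \<le> k"
    then show "subspace (c i)" "N \<subseteq> c i" using ss k by auto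
    have "c i \<subseteq> c j" if "i \<le> j" "j \<le> k" for j
      using that
    proof (induction j rule: dec_induct)
      case (step j)
      then show ?case using step_lt[of j] k by auto
    qed simp
    then show "c i \<subseteq> c k" using \<open>i \<le> k\<close> by simp
  qed (use step_lt k in auto)
  then have up: "enat k \<le> quot_length scale (c k) N" by (rule chain_le_len)
  have "quot_length scale L N = quot_length scale L (c k) + quot_length scale (c k) N"
    using len_additive[of N "c k" L] s ss[of k] k by simp
  then have "quot_length scale L (c k) + enat k \<le> enat (Suc k)" using up fin k by (metis add_left_mono)
  then have "quot_length scale L (c k) \<le> 1" by (cases "quot_length scale L (c k)") (auto simp: one_enat_def)
  moreover have "c k \<subset> L" using ss[of n] step_lt[of k] k by auto
  ultimately have "quot_length scale L (c k) = 1" using len_proper[OF _ s(2)] ss[of k] k by (simp add: antisym)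
  then show "\<exists>M. subspace M \<and> N \<subseteq> M \<and> M \<subset> L \<and> quot_length scale L M = 1"
    using \<open>c k \<subset> L\<close> ss[of k] k by auto
qed

lemma len_1_generated:
  assumes "subspace N" "subspace L" "N \<subseteq> L" "quot_length scale L N = 1" "a \<in> L" "a \<notin> N"
  shows "L = {n + r *s a | n r. n \<in> N}"
proof -
  let ?M = "{n + r *s a | n r. n \<in> N}"
  have M: "?M = N + span {a}" by (auto simp: set_plus_def span_singleton)
  then have sM: "subspace ?M" using assms(1) subspace_set_plus by simp
  have "a \<in> ?M" using subspace_0[OF assms(1)] by (auto intro!: exI[of _ 0] exI[of _ 1])
  moreover have NM: "N \<subseteq> ?M" unfolding M by (simp add: subset_set_plus1 span_zero)
  ultimately have "N \<subset> ?M" using assms(6) by blast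
  have "?M \<subseteq> L" using assms by (auto intro!: subspace_add subspace_scale)
  then have tot: "1 = quot_length scale L ?M + quot_length scale ?M N"
    using len_additive[OF assms(1) sM assms(2) NM] assms(4) by simp
  have "quot_length scale L ?M = 0"
    using enat_add_eq_1D[OF tot[symmetric] len_proper[OF assms(1) sM \<open>N \<subset> ?M\<close>]] .
  then show ?thesis using len_eq_0_iff[OF sM assms(2) \<open>?M \<subseteq> L\<close>] by simp
qed

text \<open>The lengths of the quotients \<open>L / c i\<close> are bounded, and where they are maximal nothing decreases
  any further.\<close>

lemma decreasing_stabilizes:
  assumes "subspace N" "subspace L" and "quot_length scale L N \<noteq> \<infinity>"
    and c: "\<And>i. subspace (c i)" "\<And>i. N \<subseteq> c i" "\<And>i. c i \<subseteq> L" "\<And>i. c (Suc i) \<subseteq> c i"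
  shows "\<exists>n. \<forall>k\<ge>n. c k = c n"
proof -
  have anti: "c j \<subseteq> c i" if "i \<le> j" for i j
    using that by (rule lift_Suc_antimono_le[of c, rotated]) (rule c(4))
  obtain B where B: "quot_length scale L N = enat B" using assms(3) by auto
  have l: "quot_length scale L (c i) \<le> enat B" for i
    using len_mono[of N "c i" L L] c(2) B by simp
  let ?f = "\<lambda>i. the_enat (quot_length scale L (c i))"
  have f: "quot_length scale L (c i) = enat (?f i)" for i
    using l[of i] by (metis enat_ile the_enat.simps)
  have "finite (range ?f)"
    by (rule finite_subset[of _ "{..B}"]) (use l f in \<open>auto, metis enat_ord_simps(1)\<close>)
  then have "Max (range ?f) \<in> range ?f" by (intro Max_in) auto
  then obtain n where n: "Max (range ?f) = ?f n" by auto
  have "c k = c n" if "k \<ge> n" for k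
  proof -
    have "?f k \<le> ?f n" using n \<open>finite (range ?f)\<close> by (metis Max_ge rangeI)
    have "quot_length scale L (c k) = quot_length scale L (c n) + quot_length scale (c n) (c k)"
      using len_additive[of "c k" "c n" L] c assms(2) anti[OF that] by blast
    then have "enat (?f k) = enat (?f n) + quot_length scale (c n) (c k)"
      using f[of k] f[of n] by metis
    then have "quot_length scale (c n) (c k) = 0" using \<open>?f k \<le> ?f n\<close>
      by (cases "quot_length scale (c n) (c k)") (auto simp: enat_0_iff)
    then show ?thesis using len_eq_0_iff[OF c(1) c(1) anti[OF that]] by simp
  qed
  then show ?thesis by blast
qed

end

text \<open>Here \<open>f\<close> induces an embedding of \<open>L / N\<close> into \<open>L' / N'\<close>, and in the next lemma a surjection from
  \<open>L / N\<close> onto \<open>L' / N'\<close>.\<close>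

lemma (in module_hom) len_le_of_inj:
  assumes s: "m2.subspace N'" "m2.subspace L'" and sub: "f ` L \<subseteq> L'" "N' \<subseteq> L'"
    and inj: "\<And>v. v \<in> L \<Longrightarrow> f v \<in> N' \<Longrightarrow> v \<in> N"
  shows "quot_length s1 L N \<le> quot_length s2 L' N'"
proof (rule m1.len_leI, rule m2.chain_le_len)
  fix n c assume c: "chain_between s1 N L n c"
  show "chain_between s2 N' L' n (\<lambda>i. f ` c i + N')"
    unfolding chain_between_def
  proof (intro conjI allI impI)
    fix i assume "i \<le> n"
    then have ci: "m1.subspace (c i)" "c i \<subseteq> L" using c by (auto simp: chain_between_def)
    show "m2.subspace (f ` c i + N')" using ci s by (simp add: m2.subspace_set_plus subspace_image)
    have "0 \<in> f ` c i" using m1.subspace_0[OF ci(1)] zero by (metis image_eqI)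
    then show "N' \<subseteq> f ` c i + N'" by (rule m2.subset_set_plus2)
    show "f ` c i + N' \<subseteq> L'" by (rule m2.set_plus_subset) (use ci s sub in auto)
  next
    fix i assume "i < n"
    then have ci: "m1.subspace (c i)" "N \<subseteq> c i" "c i \<subset> c (Suc i)" "c (Suc i) \<subseteq> L"
      and cs: "m1.subspace (c (Suc i))"
      using c by (auto simp: chain_between_def)
    then obtain v where v: "v \<in> c (Suc i)" "v \<notin> c i" by blast
    have "f v \<notin> f ` c i + N'"
    proof
      assume "f v \<in> f ` c i + N'"
      then obtain w y where w: "f v = f w + y" "w \<in> c i" "y \<in> N'" by (auto elim!: set_plus_elim)
      then have "f (v - w) \<in> N'" by (simp add: diff)
      moreover have "v - w \<in> L" using v w ci cs m1.subspace_diff by blast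
      ultimately have "v - w \<in> c i" using inj ci by blast
      then have "v - w + w \<in> c i" using ci w m1.subspace_add by blast
      with v show False by simp
    qed
    moreover have "f v \<in> f ` c (Suc i) + N'"
      using v m2.subset_set_plus1[OF m2.subspace_0[OF s(1)]] by blast
    moreover have "f ` c i + N' \<subseteq> f ` c (Suc i) + N'" by (rule set_plus_mono2) (use ci in auto)
    ultimately show "f ` c i + N' \<subset> f ` c (Suc i) + N'" by blast
  qed
qed

lemma (in module_hom) len_le_of_surj:
  assumes s: "m1.subspace L" and "N \<subseteq> L" "f ` N \<subseteq> N'"
    and surj: "L' \<subseteq> f ` L + N'"
  shows "quot_length s2 L' N' \<le> quot_length s1 L N"
proof (rule m2.len_leI, rule m1.chain_le_len)
  fix n c assume c: "chain_between s2 N' L' n c"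
  show "chain_between s1 N L n (\<lambda>i. {v \<in> L. f v \<in> c i})"
    unfolding chain_between_def
  proof (intro conjI allI impI)
    fix i assume "i \<le> n"
    then have ci: "m2.subspace (c i)" "N' \<subseteq> c i" using c by (auto simp: chain_between_def)
    have "{v \<in> L. f v \<in> c i} = L \<inter> f -` c i" by auto
    then show "m1.subspace {v \<in> L. f v \<in> c i}" using ci s
      by (simp add: m1.subspace_inter subspace_vimage)
    show "N \<subseteq> {v \<in> L. f v \<in> c i}" using \<open>N \<subseteq> L\<close> \<open>f ` N \<subseteq> N'\<close> ci(2) by blast
    show "{v \<in> L. f v \<in> c i} \<subseteq> L" by auto
  next
    fix i assume "i < n"
    then have ci: "N' \<subseteq> c i" "c i \<subset> c (Suc i)" "c (Suc i) \<subseteq> L'" "m2.subspace (c (Suc i))"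
      "m2.subspace (c i)"
      using c by (auto simp: chain_between_def)
    then obtain w where w: "w \<in> c (Suc i)" "w \<notin> c i" by blast
    then have "w \<in> f ` L + N'" using surj ci by blast
    then obtain v y where v: "w = f v + y" "v \<in> L" "y \<in> N'" by (auto elim!: set_plus_elim)
    have "f v = w - y" using v by simp
    then have "f v \<in> c (Suc i)" using m2.subspace_diff[OF ci(4) w(1)] v(3) ci(1,2) by auto
    moreover have "f v \<notin> c i" using m2.subspace_add[OF ci(5), of "f v" y] w(2) v(1,3) ci(1) by auto
    ultimately show "{v \<in> L. f v \<in> c i} \<subset> {v \<in> L. f v \<in> c (Suc i)}" using ci v by blast
  qed
qed

lemma (in module_hom) len_eq_of_iso:
  assumes s: "m1.subspace L" "m1.subspace N" "N \<subseteq> L" and inj: "inj_on f L"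
  shows "quot_length s2 (f ` L) (f ` N) = quot_length s1 L N"
proof (rule antisym)
  show "quot_length s2 (f ` L) (f ` N) \<le> quot_length s1 L N"
  proof (rule len_le_of_surj)
    have "0 \<in> f ` N" using s m1.subspace_0 by force
    then show "f ` L \<subseteq> f ` L + f ` N" by (rule m2.subset_set_plus1)
  qed (use s in auto)
  show "quot_length s1 L N \<le> quot_length s2 (f ` L) (f ` N)"
    by (rule len_le_of_inj) (use s inj in \<open>auto simp: subspace_image dest: inj_onD\<close>)
qed

section \<open>One-dimensional local Noetherian domains\<close>

lemmas ideal_subspaceI = module.subspaceI[OF module_times]
lemmas ideal_0 = module.subspace_0[OF module_times]
lemmas ideal_add = module.subspace_add[OF module_times]
lemmas ideal_diff = module.subspace_diff[OF module_times]
lemmas ideal_scale = module.subspace_scale[OF module_times]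

lemma ideal_scale_right: "is_ideal I \<Longrightarrow> x \<in> I \<Longrightarrow> x * c \<in> I"
  by (metis ideal_scale mult.commute)

lemma ideal_UNIV: "is_ideal (UNIV :: 'a::comm_ring_1 set)"
  by (rule module.subspace_UNIV[OF module_times])

lemma ideal_eq_UNIV: "is_ideal I \<Longrightarrow> 1 \<in> I \<Longrightarrow> I = UNIV"
  using ideal_scale by (metis UNIV_eq_I mult.right_neutral)

lemma principal_ideal: "is_ideal (range ((*) x))" for x :: "'a::comm_ring_1"
proof (rule ideal_subspaceI)
  show "0 \<in> range ((*) x)" by (rule range_eqI[of _ _ 0]) simp
  fix a b assume "a \<in> range ((*) x)" "b \<in> range ((*) x)"
  then obtain c d where "a = x * c" "b = x * d" by auto
  then have "a + b = x * (c + d)" by (simp add: distrib_left)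
  then show "a + b \<in> range ((*) x)" by blast
next
  fix c a assume "a \<in> range ((*) x)"
  then obtain b where "a = x * b" by auto
  then have "c * a = x * (c * b)" by (simp add: mult.left_commute)
  then show "c * a \<in> range ((*) x)" by blast
qed

lemma principal_subset_ideal: "is_ideal I \<Longrightarrow> x \<in> I \<Longrightarrow> range ((*) x) \<subseteq> I"
  using ideal_scale_right by blast

text \<open>Zorn's lemma applies because the union of a chain of ideals is finitely generated and hence already
  a member of the chain.\<close>

lemma noetherian_maximal_element:
  fixes A :: "'a::comm_ring_1 set set"
  assumes noeth: "noetherian_ring TYPE('a)" and "A \<noteq> {}" and A: "\<And>I. I \<in> A \<Longrightarrow> is_ideal I"
  shows "\<exists>I. I \<in> A \<and> (\<forall>J. J \<in> A \<longrightarrow> I \<subseteq> J \<longrightarrow> J = I)"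
proof -
  have "\<exists>M\<in>A. \<forall>X\<in>A. M \<subseteq> X \<longrightarrow> X = M"
  proof (rule subset_Zorn_nonempty[OF \<open>A \<noteq> {}\<close>])
    fix C assume C: "C \<noteq> {}" "subset.chain A C"
    have CA: "C \<subseteq> A" using C(2) by (simp add: subset_chain_def)
    have "is_ideal (\<Union>C)"
    proof (rule ideal_subspaceI)
      obtain X where "X \<in> C" using C(1) by blast
      then show "0 \<in> \<Union>C" using A CA ideal_0 by blast
    next
      fix x y assume "x \<in> \<Union>C" "y \<in> \<Union>C"
      then obtain X Y where X: "X \<in> C" "x \<in> X" and Y: "Y \<in> C" "y \<in> Y" by blast
      then have "X \<subseteq> Y \<or> Y \<subseteq> X" using C(2) by (simp add: subset_chain_def)
      then obtain Z where Z: "Z \<in> C" "x \<in> Z" "y \<in> Z" using X Y by blast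
      then have "x + y \<in> Z" using A CA ideal_add by blast
      then show "x + y \<in> \<Union>C" using Z(1) by blast
    next
      fix c x assume "x \<in> \<Union>C"
      then show "c * x \<in> \<Union>C" using A CA ideal_scale by blast
    qed
    then obtain S where S: "finite S" "module.span (*) S = \<Union>C"
      using noeth unfolding noetherian_ring_def fin_gen_def by blast
    have "S \<subseteq> \<Union>C" using S(2) module.span_superset[OF module_times] by metis
    then obtain X where X: "X \<in> C" "S \<subseteq> X"
      using finite_subset_Union_chain[OF S(1) _ C] by metis
    have "is_ideal X" using X(1) A CA by blast
    then have "\<Union>C \<subseteq> X" using module.span_minimal[OF module_times X(2)] S(2) by simp
    then have "\<Union>C = X" using X(1) by blast
    then show "\<Union>C \<in> A" using X(1) CA by blast
  qed
  then show ?thesis by (simp add: Bex_def Ball_def)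
qed

locale one_dim_local_domain =
  fixes m :: "'a::idom set"
  assumes noetherian: "noetherian_ring TYPE('a)"
    and local: "local_ring m"
    and dim_1: "krull_dim TYPE('a) = 1"
begin

lemma maximal: "maximal_ideal m"
  using local unfolding local_ring_def by blast

lemma ideal_m: "is_ideal m" and m_proper: "m \<noteq> UNIV"
  using maximal unfolding maximal_ideal_def by blast+

lemma one_notin_m: "1 \<notin> m"
  using ideal_eq_UNIV ideal_m m_proper by blast

lemma proper_ideal_subset_m:
  assumes I: "is_ideal I" "I \<noteq> UNIV"
  shows "I \<subseteq> m"
proof -
  let ?A = "{J. is_ideal J \<and> I \<subseteq> J \<and> J \<noteq> UNIV}"
  have "I \<in> ?A" using I by simp
  then have "?A \<noteq> {}" by (metis empty_iff)
  then have "\<exists>I. I \<in> ?A \<and> (\<forall>J. J \<in> ?A \<longrightarrow> I \<subseteq> J \<longrightarrow> J = I)"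
    by (rule noetherian_maximal_element[OF noetherian]) simp
  then obtain M where M: "M \<in> ?A" and Mmax: "\<And>J. J \<in> ?A \<Longrightarrow> M \<subseteq> J \<Longrightarrow> J = M"
    by (elim exE conjE) simp
  then have "maximal_ideal M" unfolding maximal_ideal_def using Mmax by auto
  then have "M = m" using local unfolding local_ring_def by blast
  then show ?thesis using M(1) by blast
qed

lemma unit_if_notin_m: "a \<notin> m \<Longrightarrow> \<exists>b. b * a = 1"
  using proper_ideal_subset_m[OF principal_ideal[of a]]
  by (metis UNIV_I image_iff mult.commute mult.right_neutral rangeI subsetD)

lemma one_minus_notin_m: "a \<in> m \<Longrightarrow> 1 - a \<notin> m"
  using ideal_add[OF ideal_m, of "1 - a" a] one_notin_m by auto

lemma mult_notin_m: "a \<notin> m \<Longrightarrow> b \<notin> m \<Longrightarrow> a * b \<notin> m"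
  using unit_if_notin_m ideal_scale[OF ideal_m] by (metis mult.assoc mult_1)

lemma unit_cancel_in_subspace:
  assumes "module s" "module.subspace s N" "a \<notin> m" "s a v \<in> N"
  shows "v \<in> N"
proof -
  obtain b where "b * a = 1" using unit_if_notin_m assms(3) by blast
  then have "s b (s a v) = v" using module.scale_scale[OF assms(1)] module.scale_one[OF assms(1)] by metis
  then show ?thesis using module.subspace_scale[OF assms(1,2,4), of b] by simp
qed

lemma prime_ideal_0: "prime_ideal {0::'a}"
  unfolding prime_ideal_def using module.subspace_single_0[OF module_times]
  by (auto simp: set_eq_iff intro!: exI[of _ 1])

lemma prime_ideal_m: "prime_ideal m"
  unfolding prime_ideal_def using ideal_m m_proper mult_notin_m by blast

lemma prime_chain_le_1:
  fixes P :: "nat \<Rightarrow> 'a set"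
  assumes "\<forall>i\<le>n. prime_ideal (P i)" "\<forall>i<n. P i \<subset> P (Suc i)"
  shows "n \<le> 1"
proof -
  have "enat n \<le> krull_dim TYPE('a)"
    unfolding krull_dim_def by (rule Sup_upper) (use assms in blast)
  then show ?thesis using dim_1 by (simp add: one_enat_def)
qed

lemma nonzero_prime_eq_m:
  assumes "prime_ideal P" "P \<noteq> {0}"
  shows "P = m"
proof (rule ccontr)
  assume "P \<noteq> m"
  have "P \<subseteq> m" "{0} \<subseteq> P"
    using proper_ideal_subset_m assms(1) ideal_0 unfolding prime_ideal_def by auto
  then have "{0} \<subset> P" "P \<subset> m" using assms(2) \<open>P \<noteq> m\<close> by auto
  define c where "c = (\<lambda>i::nat. if i = 0 then {0} else if i = 1 then P else m)"
  have "\<forall>i\<le>2. prime_ideal (c i)"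
    using prime_ideal_0 prime_ideal_m assms(1) by (simp add: c_def)
  moreover have "\<forall>i<2. c i \<subset> c (Suc i)"
  proof (intro allI impI)
    fix i :: nat assume "i < 2"
    then have "i = 0 \<or> i = 1" by auto
    then show "c i \<subset> c (Suc i)" using \<open>{0} \<subset> P\<close> \<open>P \<subset> m\<close> by (auto simp: c_def)
  qed
  ultimately have "2 \<le> (1::nat)" by (rule prime_chain_le_1)
  then show False by simp
qed

lemma ex_nonzero_in_m: "\<exists>x\<in>m. x \<noteq> 0"
proof (rule ccontr)
  assume "\<not> (\<exists>x\<in>m. x \<noteq> 0)"
  then have m0: "m = {0}" using ideal_0[OF ideal_m] by blast
  have "krull_dim TYPE('a) \<le> 0"
    unfolding krull_dim_def
  proof (rule Sup_least)
    fix k assume "k \<in> {enat n |n. \<exists>P :: nat \<Rightarrow> 'a set. (\<forall>i\<le>n. prime_ideal (P i)) \<and> (\<forall>i<n. P i \<subset> P (Suc i))}"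
    then obtain n and P :: "nat \<Rightarrow> 'a set" where k: "k = enat n"
      and P: "\<forall>i\<le>n. prime_ideal (P i)" "\<forall>i<n. P i \<subset> P (Suc i)" by blast
    show "k \<le> 0"
    proof (cases n)
      case 0
      then show ?thesis using k by (simp add: enat_0)
    next
      case (Suc n')
      then have p: "prime_ideal (P 0)" "prime_ideal (P 1)" "P 0 \<subset> P 1" using P by auto
      then have "P 1 \<subseteq> {0}" "0 \<in> P 0"
        using proper_ideal_subset_m m0 ideal_0 unfolding prime_ideal_def by auto
      then have "P 1 \<subseteq> P 0" by auto
      then show ?thesis using p(3) by auto
    qed
  qed
  then show False using dim_1 by simp
qed

lemma colength_m_le_1: "colength m \<le> 1"
  unfolding colength_def
proof (rule module.len_leI[OF module_times])
  fix n c assume c: "chain_between (*) m UNIV n c"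
  show "enat n \<le> 1"
  proof (rule ccontr)
    assume "\<not> enat n \<le> 1"
    then have n: "n \<ge> 2" by (simp add: one_enat_def)
    have "is_ideal (c 1)" "m \<subseteq> c 0" "c 0 \<subset> c 1" "c 1 \<subset> c (Suc 1)"
      using c n unfolding chain_between_def by auto
    then have "c 1 = UNIV" using maximal unfolding maximal_ideal_def by blast
    then show False using \<open>c 1 \<subset> c (Suc 1)\<close> by blast
  qed
qed

text \<open>An ideal maximal among the nonzero ideals of infinite colength would be prime: if \<open>a b\<close> lies in
  it and neither factor does, then \<open>P + a R\<close> and \<open>P : a\<close> are larger, and their colengths add up to
  that of \<open>P\<close>. In dimension one only the maximal ideal is left, and it has colength one.\<close>

theorem colength_finite:
  fixes I :: "'a set"
  assumes "is_ideal I" "I \<noteq> {0}"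
  shows "colength I \<noteq> \<infinity>"
proof
  assume inf: "colength I = \<infinity>"
  let ?A = "{J :: 'a set. is_ideal J \<and> J \<noteq> {0} \<and> colength J = \<infinity>}"
  have "I \<in> ?A" using assms inf by simp
  then have "?A \<noteq> {}" by (metis empty_iff)
  then have "\<exists>I. I \<in> ?A \<and> (\<forall>J. J \<in> ?A \<longrightarrow> I \<subseteq> J \<longrightarrow> J = I)"
    by (rule noetherian_maximal_element[OF noetherian]) simp
  then obtain P where P: "P \<in> ?A" and Pmax: "\<And>J. J \<in> ?A \<Longrightarrow> P \<subseteq> J \<Longrightarrow> J = P"
    by (elim exE conjE) simp
  have iP: "is_ideal P" and "P \<noteq> {0}" and Pinf: "colength P = \<infinity>" using P by auto
  have larger: "colength J \<noteq> \<infinity>" if "is_ideal J" "P \<subset> J" for J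
  proof
    assume "colength J = \<infinity>"
    moreover have "J \<noteq> {0}" using that(2) ideal_0[OF iP] by blast
    ultimately have "J = P" using Pmax[of J] that by simp
    then show False using that(2) by simp
  qed
  have "prime_ideal P"
    unfolding prime_ideal_def
  proof (intro conjI allI impI)
    show "P \<noteq> UNIV"
    proof
      assume "P = UNIV"
      then show False using Pinf by (simp add: colength_def module.len_self[OF module_times])
    qed
    fix a b assume ab: "a * b \<in> P"
    show "a \<in> P \<or> b \<in> P"
    proof (rule ccontr)
      assume "\<not> (a \<in> P \<or> b \<in> P)"
      then have a: "a \<notin> P" and b: "b \<notin> P" by auto
      let ?J = "P + range ((*) a)" and ?B = "(\<lambda>r. a * r) -` P"
      interpret h: module_hom "(*)" "(*)" "\<lambda>r. a * r"
        by (simp add: module_hom_iff module_times algebra_simps)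
      have iJ: "is_ideal ?J" using iP principal_ideal by (rule module.subspace_set_plus[OF module_times])
      have iB: "is_ideal ?B" using iP by (rule h.subspace_vimage)
      have PJ: "P \<subseteq> ?J"
        by (rule module.subset_set_plus1[OF module_times]) (simp add: ideal_0[OF principal_ideal])
      have "range ((*) a) \<subseteq> ?J"
        by (rule module.subset_set_plus2[OF module_times]) (simp add: ideal_0[OF iP])
      then have "a \<in> ?J" by (metis mult.right_neutral rangeI subsetD)
      then have 1: "colength ?J \<noteq> \<infinity>" using larger[OF iJ] PJ a by blast
      have "P \<subseteq> ?B" using ideal_scale[OF iP] by auto
      moreover have "b \<in> ?B" using ab by simp
      ultimately have 2: "colength ?B \<noteq> \<infinity>" using larger[OF iB] b by blast
      have "quot_length (*) ?J P \<le> quot_length (*) UNIV ?B"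
      proof (rule h.len_le_of_surj)
        show "?J \<subseteq> range ((*) a) + P" by (simp add: add.commute)
      qed (auto simp: ideal_UNIV)
      then have "quot_length (*) ?J P \<noteq> \<infinity>" using 2 unfolding colength_def by (metis enat_ord_simps(5))
      moreover have "colength P = colength ?J + quot_length (*) ?J P"
        unfolding colength_def
        by (rule module.len_additive[OF module_times iP iJ ideal_UNIV PJ]) simp
      ultimately show False using 1 Pinf by (metis plus_eq_infty_iff_enat)
    qed
  qed (rule iP)
  then have "P = m" using \<open>P \<noteq> {0}\<close> by (rule nonzero_prime_eq_m)
  then show False using Pinf colength_m_le_1 by simp
qed

text \<open>If \<open>r v\<close> were not in \<open>N\<close>, it would generate \<open>L\<close> modulo \<open>N\<close>. So \<open>v = t r v\<close> modulo \<open>N\<close>, and \<open>1 - t r\<close>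
  is a unit.\<close>

lemma m_mult_simple:
  assumes mod: "module s" and sub: "module.subspace s N" "module.subspace s L" "N \<subseteq> L"
    and len: "quot_length s L N = 1" and "r \<in> m" "v \<in> L"
  shows "s r v \<in> N"
proof (rule ccontr)
  interpret module s by fact
  assume rv: "s r v \<notin> N"
  have "s r v \<in> L" using sub(2) \<open>v \<in> L\<close> by (rule subspace_scale)
  then have "L = {n + s t (s r v) | n t. n \<in> N}"
    by (rule len_1_generated[OF sub len]) (rule rv)
  then obtain n t where n: "v = n + s t (s r v)" "n \<in> N" using \<open>v \<in> L\<close> by blast
  have "s (1 - t * r) v = v - s t (s r v)" by (simp add: scale_left_diff_distrib)
  also have "\<dots> = n" using n(1) by (metis add_diff_cancel_right')
  finally have "s (1 - t * r) v \<in> N" using n(2) by simp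
  moreover have "1 - t * r \<notin> m" using one_minus_notin_m ideal_scale[OF ideal_m \<open>r \<in> m\<close>] by blast
  ultimately have "v \<in> N" using unit_cancel_in_subspace[OF mod sub(1)] by blast
  then show False using rv subspace_scale[OF sub(1)] by blast
qed

lemma ex_m_socle:
  assumes mod: "module s" and sub: "module.subspace s N" "module.subspace s L" "N \<subset> L"
    and fin: "quot_length s L N \<noteq> \<infinity>"
  shows "\<exists>M. module.subspace s M \<and> N \<subset> M \<and> M \<subseteq> L \<and> quot_length s M N = 1
    \<and> (\<forall>r\<in>m. \<forall>v\<in>M. s r v \<in> N)"
proof -
  interpret module s by fact
  obtain k where "quot_length s L N = enat k" using fin by auto
  then obtain M where M: "subspace M" "N \<subset> M" "M \<subseteq> L" "quot_length s M N = 1"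
    using ex_simple_sub_and_quotient(1)[OF sub] by blast
  then have "\<forall>r\<in>m. \<forall>v\<in>M. s r v \<in> N" using m_mult_simple[OF mod sub(1) M(1) _ M(4)] by blast
  then show ?thesis using M by blast
qed

text \<open>Nakayama's lemma for modules of finite length: a proper submodule \<open>N\<close> of \<open>L\<close> cannot
  satisfy \<open>N + m L = L\<close>.\<close>

lemma ex_m_cosocle:
  assumes mod: "module s" and sub: "module.subspace s N" "module.subspace s L" "N \<subset> L"
    and fin: "quot_length s L N \<noteq> \<infinity>"
  shows "\<exists>M. module.subspace s M \<and> N \<subseteq> M \<and> M \<subset> L \<and> (\<forall>r\<in>m. \<forall>v\<in>L. s r v \<in> M)"
proof -
  interpret module s by fact
  obtain k where "quot_length s L N = enat k" using fin by auto
  then obtain M where M: "subspace M" "N \<subseteq> M" "M \<subset> L" "quot_length s L M = 1"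
    using ex_simple_sub_and_quotient(2)[OF sub] by blast
  then have "\<forall>r\<in>m. \<forall>v\<in>L. s r v \<in> M" using m_mult_simple[OF mod M(1) sub(2) _ M(4)] by blast
  then show ?thesis using M by blast
qed

text \<open>By induction on the colength, since \<open>m\<close> maps a simple submodule of \<open>R / I\<close> to zero.\<close>

lemma ideal_power_subset:
  assumes "is_ideal I" "colength I = enat n"
  shows "ideal_power m n \<subseteq> I"
  using assms
proof (induction n arbitrary: I)
  case 0
  then have "I = UNIV"
    using module.len_eq_0_iff[OF module_times _ ideal_UNIV subset_UNIV, of I] by (simp add: colength_def enat_0)
  then show ?case by simp
next
  case (Suc n)
  have "I \<noteq> UNIV"
    using Suc.prems(2) by (auto simp: colength_def enat_0_iff module.len_self[OF module_times])
  then obtain M where M: "is_ideal M" "I \<subset> M" "quot_length (*) M I = 1" "\<forall>r\<in>m. \<forall>v\<in>M. r * v \<in> I"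
    using ex_m_socle[OF module_times Suc.prems(1) ideal_UNIV] Suc.prems(2) unfolding colength_def by auto
  have "colength I = colength M + quot_length (*) M I"
    unfolding colength_def
    by (rule module.len_additive[OF module_times Suc.prems(1) M(1) ideal_UNIV]) (use M(2) in auto)
  then have "colength M = enat n" using Suc.prems(2) M(3)
    by (cases "colength M") (auto simp: one_enat_def)
  then have "ideal_power m n \<subseteq> M" using Suc.IH M(1) by blast
  then have "{a * b |a b. a \<in> m \<and> b \<in> ideal_power m n} \<subseteq> I" using M(4) by blast
  then show ?case
    using module.span_minimal[OF module_times _ Suc.prems(1)] by (simp add: ideal_mult_def)
qed

lemma power_in_ideal_power: "x \<in> I \<Longrightarrow> x ^ n \<in> ideal_power I n" for x :: 'a
proof (induction n)
  case (Suc n)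
  then have "x * x ^ n \<in> {a * b |a b. a \<in> I \<and> b \<in> ideal_power I n}" by blast
  then have "x * x ^ n \<in> ideal_mult I (ideal_power I n)"
    unfolding ideal_mult_def by (rule module.span_base[OF module_times])
  then show ?case by simp
qed simp

lemma is_ideal_power: "is_ideal (ideal_power I n)" for I :: "'a set"
  by (cases n) (simp_all add: ideal_UNIV ideal_mult_def module.subspace_span[OF module_times])

lemma ideal_power_Suc_subset: "ideal_power I (Suc n) \<subseteq> ideal_power I n" for I :: "'a set"
proof -
  have "{a * b |a b. a \<in> I \<and> b \<in> ideal_power I n} \<subseteq> ideal_power I n"
    using ideal_scale[OF is_ideal_power] by blast
  then show ?thesis
    using module.span_minimal[OF module_times _ is_ideal_power] by (simp add: ideal_mult_def)
qed

text \<open>A special case of Krull's intersection theorem. If \<open>y = x\<^sup>n z\<^sub>n\<close> for all \<open>n\<close>, then the ideals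
  generated by the \<open>z\<^sub>n = x z\<^sub>n\<^sub>+\<^sub>1\<close> increase; where they become stationary, \<open>x\<close> is a unit.\<close>

lemma Inter_principal_powers:
  assumes "x \<in> m" and y: "\<And>n. y \<in> range ((*) (x ^ n))"
  shows "y = 0"
proof (rule ccontr)
  assume "y \<noteq> 0"
  have "\<exists>z. \<forall>n. y = x ^ n * z n" using y by (intro choice) auto
  then obtain z where z: "\<And>n. y = x ^ n * z n" by blast
  have z0: "z n \<noteq> 0" and "x \<noteq> 0" for n using z[of n] z[of 1] \<open>y \<noteq> 0\<close> by auto
  have step: "z n = x * z (Suc n)" for n
  proof -
    have "x ^ n * z n = x ^ n * (x * z (Suc n))" using z[of n] z[of "Suc n"] by (metis mult.assoc power_Suc2)
    then show ?thesis using \<open>x \<noteq> 0\<close> by (metis mult_left_cancel power_not_zero)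
  qed
  let ?A = "range (\<lambda>n. range ((*) (z n)))"
  have "?A \<noteq> {}" by simp
  then have "\<exists>I. I \<in> ?A \<and> (\<forall>J. J \<in> ?A \<longrightarrow> I \<subseteq> J \<longrightarrow> J = I)"
    by (rule noetherian_maximal_element[OF noetherian]) (auto simp: principal_ideal)
  then obtain I where I: "I \<in> ?A" and Imax: "\<And>J. J \<in> ?A \<Longrightarrow> I \<subseteq> J \<Longrightarrow> J = I"
    by (elim exE conjE) simp
  then obtain n where n: "I = range ((*) (z n))" by blast
  have "z n \<in> range ((*) (z (Suc n)))" using step[of n] by (auto simp: mult.commute)
  then have "I \<subseteq> range ((*) (z (Suc n)))"
    using principal_subset_ideal[OF principal_ideal] n by blast
  then have "range ((*) (z (Suc n))) = I" using Imax by blast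
  then have "z (Suc n) \<in> range ((*) (z n))" using n by (metis mult.right_neutral rangeI)
  then obtain t where "z (Suc n) = z n * t" by blast
  then have "z (Suc n) * (x * t) = z (Suc n) * 1" using step[of n] by (simp add: ac_simps)
  then have "x * t = 1" using z0[of "Suc n"] by (metis mult_left_cancel)
  then show False using ideal_scale_right[OF ideal_m \<open>x \<in> m\<close>, of t] one_notin_m by simp
qed

end

section \<open>Fractional ideals\<close>

lemmas fract_0 = module.subspace_0[OF module_fract_scale]
lemmas fract_add = module.subspace_add[OF module_fract_scale]
lemmas fract_diff = module.subspace_diff[OF module_fract_scale]
lemmas fract_sum = module.subspace_sum[OF module_fract_scale]
lemmas fract_len_additive = module.len_additive[OF module_fract_scale]
lemmas fract_len_mono = module.len_mono[OF module_fract_scale]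
lemmas fract_len_eq_0_iff = module.len_eq_0_iff[OF module_fract_scale]
lemmas fract_len_self = module.len_self[OF module_fract_scale]

abbreviation fract_submodule :: "'a::idom fract set \<Rightarrow> bool" where
  "fract_submodule \<equiv> module.subspace fract_scale"

abbreviation fract_length :: "'a::idom fract set \<Rightarrow> 'a fract set \<Rightarrow> enat" where
  "fract_length \<equiv> quot_length fract_scale"

lemma fract_subspaceI:
  "0 \<in> S \<Longrightarrow> (\<And>x y. x \<in> S \<Longrightarrow> y \<in> S \<Longrightarrow> x + y \<in> S) \<Longrightarrow>
    (\<And>c x. x \<in> S \<Longrightarrow> to_fract c * x \<in> S) \<Longrightarrow> fract_submodule S"
  by (rule module.subspaceI[OF module_fract_scale]) (simp_all add: fract_scale_def)

lemma fract_smult: "fract_submodule S \<Longrightarrow> x \<in> S \<Longrightarrow> to_fract c * x \<in> S"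
  using module.subspace_scale[OF module_fract_scale, of S x c] by (simp add: fract_scale_def)

definition fractional :: "'a::idom fract set \<Rightarrow> bool" where
  "fractional L \<longleftrightarrow> (\<exists>d. d \<noteq> 0 \<and> (\<forall>q\<in>L. to_fract d * q \<in> range to_fract))"

lemma fractional_subset: "fractional L \<Longrightarrow> N \<subseteq> L \<Longrightarrow> fractional N"
  unfolding fractional_def by blast

lemma fract_cases:
  fixes q :: "'a::idom fract"
  obtains a b where "b \<noteq> 0" "q = to_fract a / to_fract b"
  by (cases q) (metis Fract_conv_to_fract)

lemma module_hom_fract_times: "module_hom fract_scale fract_scale ((*) c)"
  by (simp add: module_hom_iff module_fract_scale fract_scale_def algebra_simps)

lemma module_hom_to_fract: "module_hom (*) fract_scale to_fract"
  by (simp add: module_hom_iff module_times module_fract_scale fract_scale_def)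

lemma fract_submodule_times: "fract_submodule L \<Longrightarrow> fract_submodule ((*) c ` L)"
  by (rule module_hom.subspace_image[OF module_hom_fract_times])

lemma fract_submodule_range: "fract_submodule (range to_fract)"
  by (rule module_hom.subspace_image[OF module_hom_to_fract module.subspace_UNIV[OF module_times]])

lemma fract_submodule_image: "is_ideal I \<Longrightarrow> fract_submodule (to_fract ` I)"
  by (rule module_hom.subspace_image[OF module_hom_to_fract])

lemma times_image_eq_0D:
  fixes c :: "'a::idom"
  assumes "c \<noteq> 0" "(*) c ` N = {0}"
  shows "N \<subseteq> {0}"
proof
  fix x assume "x \<in> N"
  then have "c * x \<in> {0}" using assms(2) by blast
  then show "x \<in> {0}" using assms(1) by simp
qed

lemma to_fract_times_image: "to_fract ` range ((*) x) = (*) (to_fract x) ` range to_fract"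
  by (simp add: image_image)

lemma times_times_image: "(*) a ` (*) b ` A = (*) (a * b) ` A" for a :: "'a::comm_ring_1"
  by (auto simp: image_image mult.assoc)

lemma fract_length_times:
  assumes "fract_submodule L" "fract_submodule N" "N \<subseteq> L" "c \<noteq> 0"
  shows "fract_length ((*) c ` L) ((*) c ` N) = fract_length L N"
proof (rule module_hom.len_eq_of_iso[OF module_hom_fract_times assms(1-3)])
  show "inj_on ((*) c) L" using assms(4) by (simp add: inj_on_def)
qed

lemma fract_length_to_fract:
  assumes "is_ideal I" "is_ideal J" "J \<subseteq> I"
  shows "fract_length (to_fract ` I) (to_fract ` J) = quot_length (*) I J"
  by (rule module_hom.len_eq_of_iso[OF module_hom_to_fract assms]) (simp add: inj_on_def)

lemma fract_length_range: "is_ideal J \<Longrightarrow> fract_length (range to_fract) (to_fract ` J) = colength J"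
  using fract_length_to_fract[OF ideal_UNIV] by (simp add: colength_def)

lemma fractional_as_ideal:
  assumes L: "fract_submodule L" "fractional L"
  shows "\<exists>d. d \<noteq> 0 \<and>
    (\<forall>N. fract_submodule N \<longrightarrow> N \<subseteq> L \<longrightarrow> (\<exists>I. is_ideal I \<and> (*) (to_fract d) ` N = to_fract ` I))"
proof -
  obtain d where d: "d \<noteq> 0" "\<forall>q\<in>L. to_fract d * q \<in> range to_fract"
    using L(2) unfolding fractional_def by blast
  show ?thesis
  proof (intro exI[of _ d] conjI allI impI)
    show "d \<noteq> 0" by (rule d(1))
    fix N assume N: "fract_submodule N" "N \<subseteq> L"
    let ?I = "to_fract -` ((*) (to_fract d) ` N)"
    have "is_ideal ?I"
      by (rule module_hom.subspace_vimage[OF module_hom_to_fract fract_submodule_times[OF N(1)]])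
    moreover have "(*) (to_fract d) ` N = to_fract ` ?I"
      using d(2) N(2) by (auto simp: image_iff)
    ultimately show "\<exists>I. is_ideal I \<and> (*) (to_fract d) ` N = to_fract ` I" by blast
  qed
qed

context one_dim_local_domain
begin

lemma fract_length_finite:
  fixes L :: "'a fract set"
  assumes L: "fract_submodule L" "fractional L" and N: "fract_submodule N" "N \<subseteq> L" "N \<noteq> {0}"
  shows "fract_length L N \<noteq> \<infinity>"
proof -
  obtain d where d: "d \<noteq> 0" and
    ideal: "\<And>N. fract_submodule N \<Longrightarrow> N \<subseteq> L \<Longrightarrow> \<exists>I. is_ideal I \<and> (*) (to_fract d) ` N = to_fract ` I"
    using fractional_as_ideal[OF L] by (elim exE conjE) simp
  obtain I where I: "is_ideal I" "(*) (to_fract d) ` L = to_fract ` I" using ideal[OF L(1)] by blast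
  obtain J where J: "is_ideal J" "(*) (to_fract d) ` N = to_fract ` J" using ideal[OF N(1,2)] by blast
  have "to_fract ` J \<subseteq> to_fract ` I" using N(2) I(2) J(2) by (metis image_mono)
  then have JI: "J \<subseteq> I" by auto
  have "J \<noteq> {0}"
  proof
    assume "J = {0}"
    then have "(*) (to_fract d) ` N = {0}" using J(2) by simp
    then have "N \<subseteq> {0}" using times_image_eq_0D d by (metis to_fract_eq_0_iff)
    then show False using N(3) fract_0[OF N(1)] by blast
  qed
  have "fract_length L N = fract_length (to_fract ` I) (to_fract ` J)"
    using fract_length_times[OF L(1) N(1,2), of "to_fract d"] d I(2) J(2) by simp
  also have "\<dots> = quot_length (*) I J" by (rule fract_length_to_fract[OF I(1) J(1) JI])
  also have "\<dots> \<le> colength J"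
    unfolding colength_def by (rule module.len_mono[OF module_times]) auto
  finally show ?thesis
    using colength_finite[OF J(1) \<open>J \<noteq> {0}\<close>] by (metis enat_ord_simps(5))
qed

text \<open>For \<open>N \<subseteq> L\<close> both sides are computed from \<open>L \<supseteq> N \<supseteq> x N\<close> and \<open>L \<supseteq> x L \<supseteq> x N\<close>, and \<open>L / N\<close> has
  the same finite length as \<open>x L / x N\<close>.\<close>

lemma fract_length_times_self_eq:
  fixes L :: "'a fract set"
  assumes L: "fract_submodule L" "fractional L" and N: "fract_submodule N" "N \<subseteq> L" "N \<noteq> {0}" and "x \<noteq> 0"
  shows "fract_length L ((*) (to_fract x) ` L) = fract_length N ((*) (to_fract x) ` N)"
proof -
  let ?x = "(*) (to_fract x) :: 'a fract \<Rightarrow> _"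
  have xs: "?x ` A \<subseteq> A" if "fract_submodule A" for A :: "'a fract set"
    using fract_smult[OF that] by auto
  have s: "fract_submodule (?x ` L)" "fract_submodule (?x ` N)"
    using L N fract_submodule_times by auto
  have 1: "fract_length L (?x ` N) = fract_length L N + fract_length N (?x ` N)"
    by (rule fract_len_additive[OF s(2) N(1) L(1) xs[OF N(1)] N(2)])
  have 2: "fract_length L (?x ` N) = fract_length L (?x ` L) + fract_length (?x ` L) (?x ` N)"
    by (rule fract_len_additive[OF s(2) s(1) L(1) image_mono[OF N(2)] xs[OF L(1)]])
  have 3: "fract_length (?x ` L) (?x ` N) = fract_length L N"
    by (rule fract_length_times[OF L(1) N(1,2)]) (use \<open>x \<noteq> 0\<close> in simp)
  have "fract_length L N + fract_length N (?x ` N) = fract_length L N + fract_length L (?x ` L)"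
    using 1 2 3 by (metis add.commute)
  then show ?thesis using fract_length_finite[OF L N] by (metis enat_add_left_cancel)
qed

abbreviation principal_colength :: "'a \<Rightarrow> enat" where
  "principal_colength x \<equiv> colength (range ((*) x))"

lemma fract_length_principal:
  "fract_length (range to_fract) ((*) (to_fract x) ` range to_fract) = principal_colength x" for x :: 'a
  using fract_length_range[OF principal_ideal[of x]] by (simp add: to_fract_times_image)

text \<open>Scaled into \<open>R\<close>, the fractional ideal \<open>L\<close> is compared with \<open>R\<close> itself.\<close>

theorem fract_length_times_self:
  fixes L :: "'a fract set"
  assumes L: "fract_submodule L" "fractional L" "L \<noteq> {0}" and "x \<noteq> 0"
  shows "fract_length L ((*) (to_fract x) ` L) = principal_colength x"
proof -
  obtain d where d: "d \<noteq> 0" and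
    ideal: "\<And>N. fract_submodule N \<Longrightarrow> N \<subseteq> L \<Longrightarrow> \<exists>I. is_ideal I \<and> (*) (to_fract d) ` N = to_fract ` I"
    using fractional_as_ideal[OF L(1,2)] by (elim exE conjE) simp
  obtain I where I: "is_ideal I" "(*) (to_fract d) ` L = to_fract ` I" using ideal[OF L(1)] by blast
  let ?x = "(*) (to_fract x)" and ?I = "to_fract ` I"
  have "?I \<noteq> {0}"
  proof
    assume "?I = {0}"
    then have "L \<subseteq> {0}" using times_image_eq_0D I(2) d by (metis to_fract_eq_0_iff)
    then show False using L(3) fract_0[OF L(1)] by blast
  qed
  have R: "fractional (range (to_fract :: 'a \<Rightarrow> _))" unfolding fractional_def by (rule exI[of _ 1]) simp
  have "fract_length L (?x ` L) = fract_length ((*) (to_fract d) ` L) ((*) (to_fract d) ` ?x ` L)"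
    by (rule fract_length_times[symmetric])
       (use L d fract_smult in \<open>auto simp: fract_submodule_times\<close>)
  also have "\<dots> = fract_length ?I (?x ` ?I)"
    unfolding I(2)[symmetric] times_times_image by (simp add: mult.commute)
  also have "\<dots> = fract_length (range to_fract) (?x ` range to_fract)"
    by (rule fract_length_times_self_eq[symmetric, OF fract_submodule_range R
        fract_submodule_image[OF I(1)] _ \<open>?I \<noteq> {0}\<close> \<open>x \<noteq> 0\<close>]) auto
  finally show ?thesis by (simp only: fract_length_principal)
qed

lemma principal_colength_finite: "x \<noteq> 0 \<Longrightarrow> principal_colength x \<noteq> \<infinity>" for x :: 'a
  by (rule colength_finite[OF principal_ideal]) (metis mult.right_neutral rangeI singletonD)

lemma principal_colength_power:
  fixes x :: 'a
  assumes "x \<noteq> 0" "principal_colength x = enat e"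
  shows "principal_colength (x ^ n) = enat (n * e)"
proof (induction n)
  case 0
  have "range ((*) (1::'a)) = UNIV" by simp
  then show ?case by (simp add: colength_def module.len_self[OF module_times] enat_0)
next
  case (Suc n)
  let ?R = "range to_fract :: 'a fract set"
  let ?y = "to_fract (x ^ n)" and ?x = "to_fract x"
  have sub: "(*) (to_fract z) ` ?R \<subseteq> ?R" for z by (auto simp flip: to_fract_mult)
  have eq: "(*) (to_fract (x ^ Suc n)) ` ?R = (*) ?y ` (*) ?x ` ?R"
    by (simp only: times_times_image power_Suc2 to_fract_mult)
  have "principal_colength (x ^ Suc n) = fract_length ?R ((*) ?y ` (*) ?x ` ?R)"
    by (simp only: fract_length_principal[symmetric] eq)
  also have "\<dots> = fract_length ?R ((*) ?y ` ?R) + fract_length ((*) ?y ` ?R) ((*) ?y ` (*) ?x ` ?R)"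
    by (intro fract_len_additive fract_submodule_times fract_submodule_range sub image_mono)
  also have "fract_length ((*) ?y ` ?R) ((*) ?y ` (*) ?x ` ?R) = fract_length ?R ((*) ?x ` ?R)"
    by (intro fract_length_times fract_submodule_times fract_submodule_range sub) (use assms(1) in simp)
  finally show ?case using Suc.IH assms(2) by (simp add: fract_length_principal)
qed

end

section \<open>Integral closure\<close>

lemma poly_to_fract_altdef:
  fixes p :: "'a::idom poly"
  assumes "degree p \<le> n"
  shows "poly (map_poly to_fract p) q = (\<Sum>i\<le>n. to_fract (coeff p i) * q ^ i)"
proof -
  have "degree (map_poly to_fract p) \<le> n" using assms map_poly_degree_leq[of to_fract p] by linarith
  then have "poly (map_poly to_fract p) q = (\<Sum>i\<le>n. coeff (map_poly to_fract p) i * q ^ i)"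
    unfolding poly_altdef
    by (intro sum.mono_neutral_left) (auto simp: coeff_eq_0)
  then show ?thesis by (simp add: coeff_map_poly)
qed

lemma integral_closure_iff_power:
  fixes q :: "'a::idom fract"
  shows "q \<in> integral_closure \<longleftrightarrow> (\<exists>n c. q ^ n = (\<Sum>i<n. to_fract (c i) * q ^ i))"
proof
  assume "q \<in> integral_closure"
  then obtain p :: "'a poly" where p: "lead_coeff p = 1" "poly (map_poly to_fract p) q = 0"
    unfolding integral_closure_def by blast
  define n where "n = degree p"
  have "0 = (\<Sum>i\<le>n. to_fract (coeff p i) * q ^ i)"
    using p(2) poly_to_fract_altdef[of p n q] n_def by simp
  also have "\<dots> = (\<Sum>i<n. to_fract (coeff p i) * q ^ i) + q ^ n"
    using p(1) by (simp add: n_def lessThan_Suc_atMost[symmetric])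
  finally have "q ^ n = (\<Sum>i<n. to_fract (- coeff p i) * q ^ i)"
    by (simp add: sum_negf eq_neg_iff_add_eq_0 add.commute)
  then show "\<exists>n c. q ^ n = (\<Sum>i<n. to_fract (c i) * q ^ i)"
    by (intro exI[of _ n] exI[of _ "\<lambda>i. - coeff p i"])
next
  assume "\<exists>n c. q ^ n = (\<Sum>i<n. to_fract (c i) * q ^ i)"
  then obtain n and c :: "nat \<Rightarrow> 'a" where c: "q ^ n = (\<Sum>i<n. to_fract (c i) * q ^ i)" by blast
  define p where "p = monom 1 n - (\<Sum>i<n. monom (c i) i)"
  have coeff_p: "coeff p i = (if i = n then 1 else if i < n then - c i else 0)" for i
    by (auto simp: p_def coeff_sum)
  have deg: "degree p \<le> n" by (rule degree_le) (simp add: coeff_p)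
  moreover have "degree p \<ge> n" by (rule le_degree) (simp add: coeff_p)
  ultimately have "lead_coeff p = 1" by (simp add: coeff_p)
  moreover have "poly (map_poly to_fract p) q = 0"
    using c by (simp add: poly_to_fract_altdef[OF deg] coeff_p lessThan_Suc_atMost[symmetric] sum_negf)
  ultimately show "q \<in> integral_closure" unfolding integral_closure_def by blast
qed

lemma power_denominator:
  fixes a b :: "'a::idom"
  assumes "b \<noteq> 0" "i \<le> n"
  shows "to_fract (b ^ n) * (to_fract a / to_fract b) ^ i \<in> range to_fract"
proof -
  have "to_fract (b ^ k) * (to_fract a / to_fract b) ^ k = to_fract (a ^ k)" for k
    by (induction k) (use assms(1) in \<open>auto simp: field_simps\<close>)
  moreover have "b ^ n = b ^ (n - i) * b ^ i" using assms(2) by (simp flip: power_add)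
  ultimately have "to_fract (b ^ n) * (to_fract a / to_fract b) ^ i = to_fract (b ^ (n - i) * a ^ i)"
    by (simp add: mult.assoc)
  then show ?thesis by blast
qed

text \<open>A monic equation of degree \<open>N\<close> expresses all powers of \<open>q = a / b\<close> by those below \<open>q\<^sup>N\<close>, for which
  \<open>b\<^sup>N\<close> is a denominator.\<close>

lemma integral_imp_powers_fractional:
  assumes "q \<in> integral_closure"
  shows "fractional (range (\<lambda>n. q ^ n))"
proof -
  obtain N c where c: "q ^ N = (\<Sum>i<N. to_fract (c i) * q ^ i)"
    using assms integral_closure_iff_power by blast
  obtain a b where b: "b \<noteq> 0" and q: "q = to_fract a / to_fract b" by (rule fract_cases)
  have "to_fract (b ^ N) * q ^ n \<in> range to_fract" for n
  proof (induction n rule: less_induct)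
    case (less n)
    show ?case
    proof (cases "n \<le> N")
      case True
      then show ?thesis unfolding q by (rule power_denominator[OF b])
    next
      case False
      have "q ^ n = q ^ (n - N) * q ^ N" using False by (simp flip: power_add)
      also have "\<dots> = (\<Sum>i<N. to_fract (c i) * q ^ (n - N + i))"
        unfolding c by (simp add: sum_distrib_left power_add ac_simps)
      finally have "to_fract (b ^ N) * q ^ n = (\<Sum>i<N. to_fract (c i) * (to_fract (b ^ N) * q ^ (n - N + i)))"
        by (simp add: sum_distrib_left ac_simps)
      also have "\<dots> \<in> range to_fract"
      proof (rule fract_sum[OF fract_submodule_range])
        fix i assume "i \<in> {..<N}"
        then have "to_fract (b ^ N) * q ^ (n - N + i) \<in> range to_fract" using False by (intro less) simp
        then show "to_fract (c i) * (to_fract (b ^ N) * q ^ (n - N + i)) \<in> range to_fract"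
          by (rule fract_smult[OF fract_submodule_range])
      qed
      finally show ?thesis .
    qed
  qed
  then show ?thesis unfolding fractional_def using b by (intro exI[of _ "b ^ N"]) auto
qed

lemma span_image_lessThan:
  assumes "module s" "v \<in> module.span s (a ` {..<n::nat})"
  shows "\<exists>c. v = (\<Sum>i<n. s (c i) (a i))"
proof -
  interpret module s by fact
  show ?thesis using assms(2)
  proof (induction n arbitrary: v)
    case (Suc n)
    then obtain k where "v - s k (a n) \<in> span (a ` {..<n})"
      by (auto simp: lessThan_Suc span_breakdown_eq)
    then obtain c where c: "v - s k (a n) = (\<Sum>i<n. s (c i) (a i))" using Suc.IH by blast
    have "v = (\<Sum>i<Suc n. s ((c(n := k)) i) (a i))"
      using c by (simp add: algebra_simps)
    then show ?case by blast
  qed simp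
qed

text \<open>Over a Noetherian ring, the submodules generated by \<open>1, q, \<dots>, q\<^sup>n\<close> of a fractional ideal become
  stationary, and then \<open>q\<^sup>n\<close> is a combination of lower powers.\<close>

lemma powers_fractional_imp_integral:
  fixes q :: "'a::idom fract"
  assumes noeth: "noetherian_ring TYPE('a)" and "fractional (range (\<lambda>n. q ^ n))"
  shows "q \<in> integral_closure"
proof -
  obtain d where d: "d \<noteq> 0" "\<And>n. to_fract d * q ^ n \<in> range to_fract"
    using assms(2) unfolding fractional_def by blast
  have "\<exists>a. \<forall>n. to_fract d * q ^ n = to_fract (a n)" using d(2) by (intro choice) blast
  then obtain a where a: "\<And>n. to_fract d * q ^ n = to_fract (a n)" by blast
  let ?A = "range (\<lambda>n. module.span (*) (a ` {..<n}))"
  have "?A \<noteq> {}" by simp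
  then have "\<exists>I. I \<in> ?A \<and> (\<forall>J. J \<in> ?A \<longrightarrow> I \<subseteq> J \<longrightarrow> J = I)"
    by (rule noetherian_maximal_element[OF noeth]) (auto simp: module.subspace_span[OF module_times])
  then obtain I where I: "I \<in> ?A" "\<And>J. J \<in> ?A \<Longrightarrow> I \<subseteq> J \<Longrightarrow> J = I"
    by (elim exE conjE) simp
  then obtain n where "I = module.span (*) (a ` {..<n})" by blast
  then have n: "module.span (*) (a ` {..<k}) = module.span (*) (a ` {..<n})"
    if "module.span (*) (a ` {..<n}) \<subseteq> module.span (*) (a ` {..<k})" for k
    using I(2)[of "module.span (*) (a ` {..<k})"] that by simp
  have "module.span (*) (a ` {..<n}) \<subseteq> module.span (*) (a ` {..<Suc n})"
    by (rule module.span_mono[OF module_times]) auto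
  then have "module.span (*) (a ` {..<Suc n}) = module.span (*) (a ` {..<n})" by (rule n)
  moreover have "a n \<in> module.span (*) (a ` {..<Suc n})"
    by (rule module.span_base[OF module_times]) simp
  ultimately have "a n \<in> module.span (*) (a ` {..<n})" by simp
  then obtain c where "a n = (\<Sum>i<n. c i * a i)" using span_image_lessThan[OF module_times] by blast
  then have "to_fract d * q ^ n = (\<Sum>i<n. to_fract (c i) * (to_fract d * q ^ i))"
    by (simp add: a)
  also have "\<dots> = to_fract d * (\<Sum>i<n. to_fract (c i) * q ^ i)" by (simp add: sum_distrib_left ac_simps)
  finally have "q ^ n = (\<Sum>i<n. to_fract (c i) * q ^ i)" using d(1) by simp
  then show ?thesis using integral_closure_iff_power by blast
qed

lemma powers_fractionalE:
  assumes "fractional (range (\<lambda>n. q ^ n))"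
  obtains d where "d \<noteq> 0" "\<And>n. to_fract d * q ^ n \<in> range to_fract"
  using assms unfolding fractional_def by blast

context one_dim_local_domain
begin

lemma integral_closure_eq: "(integral_closure :: 'a fract set) = {q. fractional (range (\<lambda>n. q ^ n))}"
  using powers_fractional_imp_integral[OF noetherian] integral_imp_powers_fractional by blast

text \<open>With integrality expressed by a common denominator for all powers, closure under products and sums
  is a matter of multiplying denominators.\<close>

lemma integral_closure_mult:
  fixes p q :: "'a fract"
  assumes "p \<in> integral_closure" "q \<in> integral_closure"
  shows "p * q \<in> integral_closure"
proof -
  obtain d where d: "d \<noteq> 0" "\<And>n. to_fract d * p ^ n \<in> range to_fract"
    using assms(1) powers_fractionalE unfolding integral_closure_eq by blast
  obtain e where e: "e \<noteq> 0" "\<And>n. to_fract e * q ^ n \<in> range to_fract"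
    using assms(2) powers_fractionalE unfolding integral_closure_eq by blast
  have "to_fract (d * e) * (p * q) ^ n \<in> range to_fract" for n
  proof -
    have "to_fract (d * e) * (p * q) ^ n = (to_fract d * p ^ n) * (to_fract e * q ^ n)"
      by (simp add: power_mult_distrib)
    also have "\<dots> \<in> range to_fract" using d(2)[of n] e(2)[of n] by (auto simp flip: to_fract_mult)
    finally show ?thesis .
  qed
  then have "fractional (range (\<lambda>n. (p * q) ^ n))"
    unfolding fractional_def using d(1) e(1) by (intro exI[of _ "d * e"]) auto
  then show ?thesis unfolding integral_closure_eq by blast
qed

lemma to_fract_of_nat: "to_fract (of_nat n) = of_nat n"
  by (induction n) simp_all

lemma integral_closure_add:
  fixes p q :: "'a fract"
  assumes "p \<in> integral_closure" "q \<in> integral_closure"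
  shows "p + q \<in> integral_closure"
proof -
  obtain d where d: "d \<noteq> 0" "\<And>n. to_fract d * p ^ n \<in> range to_fract"
    using assms(1) powers_fractionalE unfolding integral_closure_eq by blast
  obtain e where e: "e \<noteq> 0" "\<And>n. to_fract e * q ^ n \<in> range to_fract"
    using assms(2) powers_fractionalE unfolding integral_closure_eq by blast
  have "to_fract (d * e) * (p + q) ^ n \<in> range to_fract" for n
  proof -
    have "to_fract (d * e) * (p + q) ^ n
      = (\<Sum>k\<le>n. to_fract (of_nat (n choose k)) * ((to_fract d * p ^ k) * (to_fract e * q ^ (n - k))))"
      by (simp add: binomial_ring sum_distrib_left ac_simps to_fract_of_nat)
    also have "\<dots> \<in> range to_fract"
    proof (rule fract_sum[OF fract_submodule_range])
      fix k
      have "(to_fract d * p ^ k) * (to_fract e * q ^ (n - k)) \<in> range to_fract"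
        using d(2)[of k] e(2)[of "n - k"] by (auto simp flip: to_fract_mult)
      then show "to_fract (of_nat (n choose k)) * ((to_fract d * p ^ k) * (to_fract e * q ^ (n - k)))
          \<in> range to_fract"
        by (rule fract_smult[OF fract_submodule_range])
    qed
    finally show ?thesis .
  qed
  then have "fractional (range (\<lambda>n. (p + q) ^ n))"
    unfolding fractional_def using d(1) e(1) by (intro exI[of _ "d * e"]) auto
  then show ?thesis unfolding integral_closure_eq by blast
qed

lemma to_fract_integral: "to_fract r \<in> (integral_closure :: 'a fract set)"
  unfolding integral_closure_iff_power by (intro exI[of _ 1] exI[of _ "\<lambda>_. r"]) simp

lemma fract_submodule_integral_closure: "fract_submodule (integral_closure :: 'a fract set)"
  by (rule fract_subspaceI)
     (use to_fract_integral[of 0] in \<open>auto intro: integral_closure_add integral_closure_mult to_fract_integral\<close>)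

end

section \<open>Principal reductions\<close>

lemma coset_eq_iff:
  assumes "is_ideal I"
  shows "coset I a = coset I b \<longleftrightarrow> a - b \<in> I"
proof
  assume "coset I a = coset I b"
  moreover have "a \<in> coset I a" unfolding coset_def using ideal_0[OF assms] by force
  ultimately obtain i where "a = b + i" "i \<in> I" unfolding coset_def by auto
  then show "a - b \<in> I" by simp
next
  have sub: "coset I a \<subseteq> coset I b" if "a - b \<in> I" for a b
  proof
    fix z assume "z \<in> coset I a"
    then obtain i where "z = a + i" "i \<in> I" unfolding coset_def by auto
    then have "z = b + (a - b + i)" "a - b + i \<in> I" using ideal_add[OF assms that] by auto
    then show "z \<in> coset I b" unfolding coset_def by blast
  qed
  assume "a - b \<in> I"
  moreover from this have "b - a \<in> I" using ideal_diff[OF assms ideal_0[OF assms], of "a - b"] by simp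
  ultimately show "coset I a = coset I b" using sub by (intro antisym)
qed

context one_dim_local_domain
begin

text \<open>A nonzero polynomial over the field \<open>R / m\<close> has finitely many roots; the proof divides by \<open>X - t0\<close>
  over \<open>R\<close>, for a root \<open>t0\<close> modulo \<open>m\<close>.\<close>

lemma finite_residue_roots:
  fixes p :: "'a poly"
  assumes "\<exists>i. coeff p i \<notin> m"
  shows "finite (coset m ` {t. poly p t \<in> m})"
  using assms
proof (induction "degree p" arbitrary: p rule: less_induct)
  case less
  show ?case
  proof (cases "{t. poly p t \<in> m} = {}")
    case False
    then obtain t0 where t0: "poly p t0 \<in> m" by blast
    define q where "q = synthetic_div p t0"
    have p: "p = [:- t0, 1:] * q + [:poly p t0:]"
      unfolding q_def by (rule synthetic_div_correct'[symmetric])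
    have "degree p \<noteq> 0"
    proof
      assume "degree p = 0"
      then obtain c where c: "p = [:c:]" by (metis degree_0_id)
      obtain i where "coeff p i \<notin> m" using less.prems by blast
      then have "c \<notin> m" using c ideal_0[OF ideal_m] by (cases i) auto
      then show False using t0 c by simp
    qed
    then have deg: "degree q < degree p" by (simp add: q_def degree_synthetic_div)
    have "\<exists>i. coeff q i \<notin> m"
    proof (rule ccontr)
      assume "\<not> (\<exists>i. coeff q i \<notin> m)"
      then have q: "coeff q i \<in> m" for i by blast
      have "coeff p i \<in> m" for i
      proof -
        have "coeff p i = coeff (pCons 0 q) i - t0 * coeff q i + coeff [:poly p t0:] i"
          by (subst p) (simp add: mult_pCons_left)
        moreover have "coeff (pCons 0 q) i \<in> m" "coeff [:poly p t0:] i \<in> m"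
          using q t0 ideal_0[OF ideal_m] by (auto simp: coeff_pCons split: nat.split)
        ultimately show ?thesis using q ideal_scale[OF ideal_m] ideal_diff[OF ideal_m] ideal_add[OF ideal_m]
          by simp
      qed
      then show False using less.prems by blast
    qed
    then have fin: "finite (coset m ` {t. poly q t \<in> m})" by (rule less.hyps[OF deg])
    have "coset m ` {t. poly p t \<in> m} \<subseteq> insert (coset m t0) (coset m ` {t. poly q t \<in> m})"
    proof
      fix z assume "z \<in> coset m ` {t. poly p t \<in> m}"
      then obtain t where t: "z = coset m t" "poly p t \<in> m" by blast
      have "poly p t = (t - t0) * poly q t + poly p t0" by (subst p) (simp add: algebra_simps)
      then have "(t - t0) * poly q t \<in> m" using t(2) t0 ideal_diff[OF ideal_m] by (metis add_diff_cancel_right')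
      then have "t - t0 \<in> m \<or> poly q t \<in> m" using mult_notin_m by blast
      then show "z \<in> insert (coset m t0) (coset m ` {t. poly q t \<in> m})"
        using t(1) coset_eq_iff[OF ideal_m] by auto
    qed
    then show ?thesis by (rule finite_subset) (simp add: fin)
  qed simp
qed

lemma ex_value_notin_m:
  fixes p :: "'a poly"
  assumes "infinite (residue_ring m)" "coeff p i \<notin> m"
  shows "\<exists>t. poly p t \<notin> m"
proof (rule ccontr)
  assume "\<not> (\<exists>t. poly p t \<notin> m)"
  then have "{t. poly p t \<in> m} = UNIV" by blast
  then have "finite (residue_ring m)"
    using finite_residue_roots[of p] assms(2) unfolding residue_ring_def by auto
  then show False using assms(1) by simp
qed

text \<open>The submodules generated by \<open>N\<close> and \<open>v 0, \<dots>, v i\<close> cannot increase strictly more often than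
  the length of \<open>L / N\<close> allows, and that length is at most the length of \<open>L / x L\<close>, which does not
  depend on \<open>L\<close>.\<close>

lemma ex_redundant_generator:
  fixes L N :: "'a fract set"
  assumes L: "fract_submodule L" "fractional L" "L \<noteq> {0}" and x: "x \<noteq> 0" "principal_colength x = enat e"
    and N: "fract_submodule N" "N \<subseteq> L" "(*) (to_fract x) ` L \<subseteq> N" and v: "\<And>i. v i \<in> L"
  shows "\<exists>j\<le>e. v j \<in> module.span fract_scale (v ` {..<j}) + N"
proof (rule ccontr)
  interpret module "fract_scale :: 'a \<Rightarrow> _" by (rule module_fract_scale)
  assume "\<not> ?thesis"
  then have no: "v j \<notin> span (v ` {..<j}) + N" if "j \<le> e" for j using that by blast
  define c where "c = (\<lambda>j. span (v ` {..<j}) + N)"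
  have "chain_between fract_scale N L (Suc e) c"
    unfolding chain_between_def
  proof (intro conjI allI impI)
    fix i
    show "subspace (c i)" unfolding c_def by (rule subspace_set_plus[OF subspace_span N(1)])
    show "N \<subseteq> c i" unfolding c_def by (rule subset_set_plus2[OF span_zero])
    have "span (v ` {..<i}) \<subseteq> L" by (rule span_minimal[OF _ L(1)]) (use v in blast)
    then show "c i \<subseteq> L" unfolding c_def by (rule set_plus_subset[OF L(1) _ N(2)])
  next
    fix i assume "i < Suc e"
    then have "v i \<notin> c i" using no[of i] by (simp add: c_def)
    moreover have "v i \<in> span (v ` {..<Suc i})" by (rule span_base) simp
    then have "v i \<in> c (Suc i)"
      unfolding c_def using subset_set_plus1[OF subspace_0[OF N(1)]] by blast
    moreover have "c i \<subseteq> c (Suc i)"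
      unfolding c_def by (intro set_plus_mono2 span_mono order.refl) auto
    ultimately show "c i \<subset> c (Suc i)" by blast
  qed
  then have "enat (Suc e) \<le> fract_length L N" by (rule chain_le_len)
  also have "\<dots> \<le> fract_length L ((*) (to_fract x) ` L)" by (rule len_mono[OF N(3)]) simp
  also have "\<dots> = enat e" using fract_length_times_self[OF L x(1)] x(2) by simp
  finally show False by simp
qed

lemma ex_parameter: "\<exists>x e. x \<in> m \<and> x \<noteq> 0 \<and> principal_colength x = enat e"
proof -
  obtain x where x: "x \<in> m" "x \<noteq> 0" using ex_nonzero_in_m by blast
  then obtain e where "principal_colength x = enat e" using principal_colength_finite by (metis not_infinity_eq)
  then show ?thesis using x by blast
qed

lemma fract_submodule_combinations:
  assumes "is_ideal I"
  shows "fract_submodule {\<Sum>i\<le>n. to_fract (c i) * v i | c. \<forall>i. c i \<in> I}" (is "fract_submodule ?S")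
proof (rule fract_subspaceI)
  show "0 \<in> ?S" using ideal_0[OF assms] by (intro CollectI exI[of _ "\<lambda>_. 0"]) simp
  fix p q assume "p \<in> ?S" "q \<in> ?S"
  then obtain c d where "p = (\<Sum>i\<le>n. to_fract (c i) * v i)" "q = (\<Sum>i\<le>n. to_fract (d i) * v i)"
    "\<forall>i. c i \<in> I" "\<forall>i. d i \<in> I" by blast
  then show "p + q \<in> ?S"
    using ideal_add[OF assms] by (intro CollectI exI[of _ "\<lambda>i. c i + d i"]) (simp add: sum.distrib algebra_simps)
next
  fix r p assume "p \<in> ?S"
  then obtain c where "p = (\<Sum>i\<le>n. to_fract (c i) * v i)" "\<forall>i. c i \<in> I" by blast
  then show "to_fract r * p \<in> ?S"
    using ideal_scale[OF assms] by (intro CollectI exI[of _ "\<lambda>i. r * c i"]) (simp add: sum_distrib_left mult.assoc)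
qed

text \<open>Every element of the fraction field is a root of a polynomial that does not vanish modulo the
  maximal ideal: the number of generators of the modules \<open>R + R q + \<dots> + R q\<^sup>n\<close> is bounded.\<close>

lemma ex_primitive_relation:
  fixes q :: "'a fract"
  shows "\<exists>n c. (\<Sum>i\<le>n. to_fract (c i) * q ^ i) = 0 \<and> (\<exists>j\<le>n. c j \<notin> m)"
proof -
  obtain x e where x: "x \<in> m" "x \<noteq> 0" "principal_colength x = enat e" using ex_parameter by blast
  obtain a b where b: "b \<noteq> 0" and q: "q = to_fract a / to_fract b" by (rule fract_cases)
  let ?S = "\<lambda>I. {\<Sum>i\<le>e. to_fract (c i) * q ^ i | c. \<forall>i. c i \<in> I}"
  have pow: "q ^ i \<in> ?S UNIV" if "i \<le> e" for i
    using that by (intro CollectI exI[of _ "\<lambda>k. if k = i then 1 else 0"])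
      (simp add: if_distrib[of to_fract] if_distrib[of "\<lambda>u. u * _"] cong: if_cong)
  \<comment> \<open>The exponent is cut off at \<open>e\<close> so that all terms of the sequence lie in the module.\<close>
  have "\<exists>j\<le>e. q ^ (min j e) \<in> module.span fract_scale ((\<lambda>i. q ^ min i e) ` {..<j}) + ?S m"
  proof (rule ex_redundant_generator[OF _ _ _ x(2,3)])
    show "fract_submodule (?S UNIV)" by (rule fract_submodule_combinations[OF ideal_UNIV])
    show "fract_submodule (?S m)" by (rule fract_submodule_combinations[OF ideal_m])
    show "?S m \<subseteq> ?S UNIV" by blast
    have "1 \<in> ?S UNIV" using pow[of 0] by simp
    then show "?S UNIV \<noteq> {0}" by (metis singletonD zero_neq_one)
    show "q ^ min i e \<in> ?S UNIV" for i by (rule pow) simp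
    show "(*) (to_fract x) ` ?S UNIV \<subseteq> ?S m"
    proof
      fix z assume "z \<in> (*) (to_fract x) ` ?S UNIV"
      then obtain c where "z = to_fract x * (\<Sum>i\<le>e. to_fract (c i) * q ^ i)" by auto
      then have "z = (\<Sum>i\<le>e. to_fract (c i * x) * q ^ i)" by (simp add: sum_distrib_left ac_simps)
      then show "z \<in> ?S m"
        using ideal_scale[OF ideal_m x(1)] by (intro CollectI exI[of _ "\<lambda>i. c i * x"]) simp
    qed
    show "fractional (?S UNIV)"
      unfolding fractional_def
    proof (intro exI[of _ "b ^ e"] conjI ballI)
      show "b ^ e \<noteq> 0" using b by simp
      fix z assume "z \<in> ?S UNIV"
      then obtain c where "z = (\<Sum>i\<le>e. to_fract (c i) * q ^ i)" by blast
      then have "to_fract (b ^ e) * z = (\<Sum>i\<le>e. to_fract (c i) * (to_fract (b ^ e) * q ^ i))"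
        by (simp add: sum_distrib_left mult.left_commute)
      also have "\<dots> \<in> range to_fract"
      proof (rule fract_sum[OF fract_submodule_range], rule fract_smult[OF fract_submodule_range])
        show "to_fract (b ^ e) * q ^ i \<in> range to_fract" if "i \<in> {..e}" for i
          unfolding q using that by (intro power_denominator[OF b]) simp
      qed
      finally show "to_fract (b ^ e) * z \<in> range to_fract" .
    qed
  qed
  then obtain j where j: "j \<le> e" "q ^ j \<in> module.span fract_scale ((\<lambda>i. q ^ min i e) ` {..<j}) + ?S m"
    by (auto simp: min_def)
  have "(\<lambda>i. q ^ min i e) ` {..<j} = (\<lambda>i. q ^ i) ` {..<j}" using j(1) by (intro image_cong) auto
  then obtain u w where uw: "q ^ j = u + w" "u \<in> module.span fract_scale ((\<lambda>i. q ^ i) ` {..<j})" "w \<in> ?S m"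
    using j(2) by (auto elim!: set_plus_elim)
  obtain c where c: "u = (\<Sum>i<j. to_fract (c i) * q ^ i)"
    using span_image_lessThan[OF module_fract_scale uw(2)] by (auto simp: fract_scale_def)
  obtain d where d: "w = (\<Sum>i\<le>e. to_fract (d i) * q ^ i)" "\<forall>i. d i \<in> m" using uw(3) by blast
  \<comment> \<open>The redundancy of \<open>q\<^sup>j\<close> as a relation: its coefficient at \<open>j\<close> is \<open>-1\<close> modulo \<open>m\<close>.\<close>
  define f where "f = (\<lambda>i. (if i < j then c i else 0) + d i - (if i = j then 1 else 0))"
  have "(\<Sum>i\<le>e. to_fract (if i < j then c i else 0) * q ^ i) = u"
    unfolding c using j(1) by (intro sum.mono_neutral_cong_right) auto
  moreover have "(\<Sum>i\<le>e. to_fract (if i = j then 1 else 0) * q ^ i) = q ^ j"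
    using j(1) by (simp add: if_distrib[of to_fract] if_distrib[of "\<lambda>u. u * _"] cong: if_cong)
  ultimately have "(\<Sum>i\<le>e. to_fract (f i) * q ^ i) = 0"
    using uw(1) d(1) by (simp add: f_def distrib_right left_diff_distrib sum.distrib sum_subtractf
        del: to_fract_eq_iff)
  moreover have "f j \<notin> m"
  proof
    assume "f j \<in> m"
    then have "d j - f j \<in> m" using d(2) ideal_diff[OF ideal_m] by blast
    then show False using one_notin_m by (simp add: f_def)
  qed
  ultimately show ?thesis using j(1) by blast
qed

text \<open>Modulo lower powers of \<open>y = 1 / (q + t)\<close> one has \<open>y\<^sup>k q\<^sup>i = (-t)\<^sup>i y\<^sup>k\<close> for \<open>i \<le> k\<close>, so that a
  relation \<open>F(q) = 0\<close> of degree \<open>k\<close> becomes a relation for \<open>y\<close> with leading coefficient \<open>F(-t)\<close>.\<close>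

lemma shifted_power_mod_lower:
  fixes y :: "'a fract" and t :: 'a
  defines "W \<equiv> \<lambda>k. module.span fract_scale ((\<lambda>i. y ^ i) ` {..<k})"
  assumes "i \<le> k"
  shows "y ^ (k - i) * (1 - to_fract t * y) ^ i - to_fract ((- t) ^ i) * y ^ k \<in> W k"
  using assms(2)
proof (induction i arbitrary: k)
  case 0
  then show ?case by (simp add: W_def module.span_zero[OF module_fract_scale])
next
  case (Suc i)
  note sW = module.subspace_span[OF module_fract_scale]
  obtain k' where k: "k = Suc k'" using Suc.prems by (cases k) auto
  define w where "w = y ^ (k' - i) * (1 - to_fract t * y) ^ i - to_fract ((- t) ^ i) * y ^ k'"
  have w: "w \<in> W k'" using Suc k by (simp add: w_def)
  have Wk: "W k' \<subseteq> W k" unfolding W_def k by (rule module.span_mono[OF module_fract_scale]) auto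
  have "W k' \<subseteq> {z. y * z \<in> W k}"
    unfolding W_def
  proof (rule module.span_minimal[OF module_fract_scale])
    show "(\<lambda>i. y ^ i) ` {..<k'} \<subseteq> {z. y * z \<in> module.span fract_scale ((\<lambda>i. y ^ i) ` {..<k})}"
      using module.span_base[OF module_fract_scale, of "y ^ Suc _" "(\<lambda>i. y ^ i) ` {..<k}"] k by fastforce
    show "fract_submodule {z. y * z \<in> module.span fract_scale ((\<lambda>i. y ^ i) ` {..<k})}"
      using fract_0[OF sW] fract_add[OF sW] fract_smult[OF sW]
      by (intro fract_subspaceI) (auto simp: distrib_left mult.left_commute[of y])
  qed
  then have "y * w \<in> W k" using w by blast
  then have "to_fract t * (y * w) \<in> W k" unfolding W_def by (rule fract_smult[OF sW])
  then have 1: "w - to_fract t * (y * w) \<in> W k" using w Wk fract_diff[OF sW] unfolding W_def by blast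
  have "y ^ k' \<in> W k" unfolding W_def k by (rule module.span_base[OF module_fract_scale]) simp
  then have 2: "to_fract ((- t) ^ i) * y ^ k' \<in> W k" unfolding W_def by (rule fract_smult[OF sW])
  have "y ^ (k - Suc i) * (1 - to_fract t * y) ^ Suc i
      = (1 - to_fract t * y) * (w + to_fract ((- t) ^ i) * y ^ k')"
    by (simp add: w_def k)
  also have "\<dots> = (w - to_fract t * (y * w)) + to_fract ((- t) ^ i) * y ^ k' + to_fract ((- t) ^ Suc i) * y ^ k"
    by (simp add: k algebra_simps)
  finally have "y ^ (k - Suc i) * (1 - to_fract t * y) ^ Suc i - to_fract ((- t) ^ Suc i) * y ^ k
      = (w - to_fract t * (y * w)) + to_fract ((- t) ^ i) * y ^ k'" by simp
  then show ?case using fract_add[OF sW] 1 2 unfolding W_def by metis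
qed

lemma inverse_shift_integral:
  fixes q :: "'a fract"
  assumes rel: "(\<Sum>i\<le>n. to_fract (c i) * q ^ i) = 0" and unit: "(\<Sum>i\<le>n. c i * (- t) ^ i) \<notin> m"
  shows "q + to_fract t \<noteq> 0" "1 / (q + to_fract t) \<in> integral_closure"
proof -
  note sW = module.subspace_span[OF module_fract_scale]
  show ne: "q + to_fract t \<noteq> 0"
  proof
    assume "q + to_fract t = 0"
    then have "q = - to_fract t" by (simp add: eq_neg_iff_add_eq_0)
    moreover have "to_fract ((- t) ^ i) = (- to_fract t) ^ i" for i by (induction i) auto
    ultimately have "to_fract (\<Sum>i\<le>n. c i * (- t) ^ i) = 0" using rel by simp
    then have "(\<Sum>i\<le>n. c i * (- t) ^ i) = 0" by (simp only: to_fract_eq_0_iff)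
    then show False using unit ideal_0[OF ideal_m] by simp
  qed
  define y where "y = 1 / (q + to_fract t)"
  define W where "W = module.span fract_scale ((\<lambda>i. y ^ i) ` {..<n})"
  have qy: "q * y = 1 - to_fract t * y" using ne by (simp add: y_def field_simps)
  have "(\<Sum>i\<le>n. to_fract (c i) * (y ^ (n - i) * (1 - to_fract t * y) ^ i))
      = y ^ n * (\<Sum>i\<le>n. to_fract (c i) * q ^ i)"
    unfolding sum_distrib_left qy[symmetric]
  proof (rule sum.cong)
    fix i assume "i \<in> {..n}"
    then have "y ^ n = y ^ (n - i) * y ^ i" by (simp flip: power_add)
    then show "to_fract (c i) * (y ^ (n - i) * (q * y) ^ i) = y ^ n * (to_fract (c i) * q ^ i)"
      by (simp add: power_mult_distrib ac_simps)
  qed simp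
  then have 0: "(\<Sum>i\<le>n. to_fract (c i) * (y ^ (n - i) * (1 - to_fract t * y) ^ i)) = 0" using rel by simp
  have "(\<Sum>i\<le>n. to_fract (c i) * (y ^ (n - i) * (1 - to_fract t * y) ^ i - to_fract ((- t) ^ i) * y ^ n)) \<in> W"
    unfolding W_def
    by (intro fract_sum[OF sW] fract_smult[OF sW] shifted_power_mod_lower) simp
  also have "(\<Sum>i\<le>n. to_fract (c i) * (y ^ (n - i) * (1 - to_fract t * y) ^ i - to_fract ((- t) ^ i) * y ^ n))
      = - (to_fract (\<Sum>i\<le>n. c i * (- t) ^ i) * y ^ n)"
    using 0 by (simp add: right_diff_distrib sum_subtractf sum_distrib_right mult.assoc)
  finally have "fract_scale (\<Sum>i\<le>n. c i * (- t) ^ i) (y ^ n) \<in> W"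
    using module.subspace_neg[OF module_fract_scale sW] unfolding W_def fract_scale_def by fastforce
  then have "y ^ n \<in> W"
    using unit_cancel_in_subspace[OF module_fract_scale sW unit] unfolding W_def by blast
  then obtain d where "y ^ n = (\<Sum>i<n. to_fract (d i) * y ^ i)"
    using span_image_lessThan[OF module_fract_scale] unfolding W_def fract_scale_def by blast
  then show "1 / (q + to_fract t) \<in> integral_closure"
    unfolding integral_closure_iff_power y_def[symmetric] by blast
qed

text \<open>With \<open>q = a / b\<close> and \<open>z = a + t b\<close> one has \<open>b / z = 1 / (q + t)\<close> and \<open>a / z = 1 - t (b / z)\<close>. Since the
  residue field is infinite, \<open>t\<close> can be chosen such that the relation for \<open>q\<close> takes a unit value at \<open>-t\<close>.\<close>

lemma ex_reduction_pair:
  fixes a b :: 'a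
  assumes inf: "infinite (residue_ring m)"
  shows "\<exists>t. \<exists>u\<in>integral_closure. \<exists>v\<in>integral_closure.
    to_fract a = to_fract (a + t * b) * u \<and> to_fract b = to_fract (a + t * b) * v"
proof (cases "b = 0")
  case True
  then show ?thesis using to_fract_integral[of 0] to_fract_integral[of 1] by force
next
  case False
  let ?q = "to_fract a / to_fract b"
  obtain n c where rel: "(\<Sum>i\<le>n. to_fract (c i) * ?q ^ i) = 0" and c: "\<exists>j\<le>n. c j \<notin> m"
    using ex_primitive_relation by blast
  define F where "F = (\<Sum>i\<le>n. monom (c i) i)"
  obtain j where "j \<le> n" "c j \<notin> m" using c by blast
  then have "coeff F j \<notin> m" by (simp add: F_def coeff_sum)
  then obtain t' where "poly F t' \<notin> m" using ex_value_notin_m[OF inf] by blast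
  then have "(\<Sum>i\<le>n. c i * (- (- t')) ^ i) \<notin> m" by (simp add: F_def poly_sum poly_monom)
  note int = inverse_shift_integral[OF rel this]
  define t where "t = - t'"
  define X where "X = ?q + to_fract t"
  define v where "v = 1 / X"
  have "X \<noteq> 0" and v: "v \<in> integral_closure" using int unfolding v_def X_def t_def by simp_all
  have "to_fract (a + t * b) = to_fract b * X" using False by (simp add: X_def field_simps)
  then have b: "to_fract b = to_fract (a + t * b) * v" using \<open>X \<noteq> 0\<close> by (simp add: v_def del: to_fract_add)
  have "to_fract a = to_fract (a + t * b) - to_fract t * to_fract b" by simp
  also have "\<dots> = to_fract (a + t * b) - to_fract t * (to_fract (a + t * b) * v)" using b by simp
  also have "\<dots> = to_fract (a + t * b) * (1 - to_fract t * v)" by (simp only: right_diff_distrib mult_1_right mult.left_commute)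
  finally have a: "to_fract a = to_fract (a + t * b) * (1 - to_fract t * v)" .
  have "1 - to_fract t * v \<in> integral_closure"
    using fract_diff[OF fract_submodule_integral_closure to_fract_integral[of 1]
        fract_smult[OF fract_submodule_integral_closure v]] by simp
  then show ?thesis using a b v by blast
qed

text \<open>The element \<open>x\<close> is a linear combination of generators of \<open>J\<close>, built up from two elements at a time.\<close>

theorem ex_principal_reduction:
  fixes J :: "'a set"
  assumes inf: "infinite (residue_ring m)" and J: "is_ideal J"
  shows "\<exists>x\<in>J. \<forall>y\<in>J. \<exists>w\<in>integral_closure. to_fract y = to_fract x * w"
proof -
  obtain S where S: "finite S" "module.span (*) S = J"
    using noetherian J unfolding noetherian_ring_def fin_gen_def by blast
  have SJ: "S \<subseteq> J" using S(2) module.span_superset[OF module_times] by metis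
  have "\<exists>x\<in>J. \<forall>y\<in>S. \<exists>w\<in>integral_closure. to_fract y = to_fract x * w"
    using S(1) SJ
  proof (induction S)
    case empty
    then show ?case using ideal_0[OF J] by blast
  next
    case (insert b S)
    then obtain a where a: "a \<in> J" "\<forall>y\<in>S. \<exists>w\<in>integral_closure. to_fract y = to_fract a * w" by blast
    obtain t u v where uv: "u \<in> integral_closure" "v \<in> integral_closure"
      "to_fract a = to_fract (a + t * b) * u" "to_fract b = to_fract (a + t * b) * v"
      using ex_reduction_pair[OF inf, of a b] by blast
    have "a + t * b \<in> J" using a(1) insert.prems ideal_add[OF J] ideal_scale[OF J] by blast
    moreover have "\<forall>y\<in>insert b S. \<exists>w\<in>integral_closure. to_fract y = to_fract (a + t * b) * w"
    proof
      fix y assume that: "y \<in> insert b S"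
      show "\<exists>w\<in>integral_closure. to_fract y = to_fract (a + t * b) * w"
    proof (cases "y = b")
      case True
      then show ?thesis using uv by blast
    next
      case False
      then have "y \<in> S" using that by simp
      then obtain w where w: "w \<in> integral_closure" "to_fract y = to_fract a * w" using a(2) by blast
      have "to_fract y = to_fract (a + t * b) * (u * w)" unfolding w(2) mult.assoc[symmetric] using uv(3) by simp
      then show ?thesis using integral_closure_mult[OF uv(1) w(1)] by blast
      qed
    qed
    ultimately show ?case by (rule rev_bexI)
  qed
  then obtain x where x: "x \<in> J" "\<forall>y\<in>S. \<exists>w\<in>integral_closure. to_fract y = to_fract x * w" by blast
  let ?T = "{y. \<exists>w\<in>integral_closure. to_fract y = to_fract x * w}"
  have "?T = to_fract -` ((*) (to_fract x) ` integral_closure)" by auto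
  then have "is_ideal ?T"
    using module_hom.subspace_vimage[OF module_hom_to_fract
        fract_submodule_times[OF fract_submodule_integral_closure]] by simp
  then have "J \<subseteq> ?T" using module.span_minimal[OF module_times, of S ?T] x(2) S(2) by blast
  then show ?thesis using x(1) by blast
qed

end

section \<open>Finiteness of the integral closure\<close>

lemma coset_times:
  assumes "is_ideal I"
  shows "(\<Union>a\<in>coset I u. \<Union>b\<in>coset I v. coset I (a * b)) = coset I (u * v)"
proof -
  have eq: "coset I (a * b) = coset I (u * v)" if ab: "a \<in> coset I u" "b \<in> coset I v" for a b
  proof -
    obtain i j where ij: "a = u + i" "b = v + j" "i \<in> I" "j \<in> I" using ab unfolding coset_def by auto
    then have "a * b - u * v = u * j + b * i" by (simp add: algebra_simps)
    then have "a * b - u * v \<in> I" using ij ideal_add[OF assms] ideal_scale[OF assms] by metis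
    then show ?thesis using coset_eq_iff[OF assms] by blast
  qed
  have mem: "w \<in> coset I w" for w using ideal_0[OF assms] unfolding coset_def by force
  show ?thesis
  proof (intro antisym subsetI)
    fix z assume "z \<in> (\<Union>a\<in>coset I u. \<Union>b\<in>coset I v. coset I (a * b))"
    then obtain a b where "a \<in> coset I u" "b \<in> coset I v" "z \<in> coset I (a * b)" by blast
    then show "z \<in> coset I (u * v)" using eq[of a b] by simp
  next
    fix z assume "z \<in> coset I (u * v)"
    then show "z \<in> (\<Union>a\<in>coset I u. \<Union>b\<in>coset I v. coset I (a * b))"
      by (intro UN_I[OF mem[of u]] UN_I[OF mem[of v]])
  qed
qed

lemma compl_power_coset:
  fixes t :: "nat \<Rightarrow> 'a::idom"
  assumes "\<And>n. is_ideal (ideal_power m n)"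
  shows "compl_power m (\<lambda>n. coset (ideal_power m n) (t n)) k = (\<lambda>n. coset (ideal_power m n) (t n ^ k))"
proof (induction k)
  case (Suc k)
  show ?case
  proof
    fix n
    have "compl_power m (\<lambda>n. coset (ideal_power m n) (t n)) (Suc k) n
      = (\<Union>a\<in>coset (ideal_power m n) (t n). \<Union>b\<in>coset (ideal_power m n) (t n ^ k). coset (ideal_power m n) (a * b))"
      by (simp only: compl_power.simps Suc compl_mult_def)
    also have "\<dots> = coset (ideal_power m n) (t n ^ Suc k)"
      by (simp only: coset_times[OF assms] power_Suc)
    finally show "compl_power m (\<lambda>n. coset (ideal_power m n) (t n)) (Suc k) n
      = coset (ideal_power m n) (t n ^ Suc k)" .
  qed
qed (simp add: compl_one_def)

context one_dim_local_domain
begin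

text \<open>The powers of \<open>b\<close> generate a fractional ideal \<open>L\<close>, and some \<open>b\<^sup>j\<close> is redundant modulo \<open>m L\<close>
  with \<open>j\<close> bounded. Hence the lower powers generate \<open>L\<close> modulo \<open>m L\<close>, and by Nakayama they
  generate \<open>L\<close>.\<close>

lemma bounded_integral_degree:
  "\<exists>e. \<forall>b\<in>(integral_closure :: 'a fract set). \<exists>c. b ^ Suc e = (\<Sum>i<Suc e. to_fract (c i) * b ^ i)"
proof -
  interpret module "fract_scale :: 'a \<Rightarrow> _" by (rule module_fract_scale)
  obtain x e where x: "x \<in> m" "x \<noteq> 0" "principal_colength x = enat e" using ex_parameter by blast
  have "\<exists>c. b ^ Suc e = (\<Sum>i<Suc e. to_fract (c i) * b ^ i)" if b: "b \<in> integral_closure" for b :: "'a fract"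
  proof -
    define L where "L = span (range (\<lambda>i. b ^ i))"
    define N where "N = span {to_fract r * b ^ i | r i. r \<in> m}"
    define C where "C = (\<lambda>j. span ((\<lambda>i. b ^ i) ` {..<j}))"
    note s = subspace_span
    obtain d where d: "d \<noteq> 0" "\<And>n. to_fract d * b ^ n \<in> range to_fract"
      using b powers_fractionalE unfolding integral_closure_eq by blast
    have pow: "b ^ i \<in> L" for i unfolding L_def by (rule span_base) simp
    have "L \<subseteq> (*) (to_fract d) -` range to_fract"
      unfolding L_def
    proof (rule span_minimal)
      show "subspace ((*) (to_fract d) -` range to_fract)"
        by (rule module_hom.subspace_vimage[OF module_hom_fract_times fract_submodule_range])
    qed (use d(2) in auto)
    then have fL: "fractional L" unfolding fractional_def using d(1) by blast
    have NL: "N \<subseteq> L"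
      unfolding N_def
      by (rule span_minimal) (use pow fract_smult in \<open>auto simp: L_def\<close>)
    have "L \<subseteq> (*) (to_fract x) -` N"
      unfolding L_def
    proof (rule span_minimal)
      show "subspace ((*) (to_fract x) -` N)" unfolding N_def
        by (rule module_hom.subspace_vimage[OF module_hom_fract_times s])
      show "range (\<lambda>i. b ^ i) \<subseteq> (*) (to_fract x) -` N"
        unfolding N_def using x(1) by (auto intro!: span_base)
    qed
    then have xL: "(*) (to_fract x) ` L \<subseteq> N" by blast
    have "L \<noteq> {0}" using pow[of 0] by (metis power_0 singletonD zero_neq_one)
    have "fract_submodule L" "fract_submodule N" unfolding L_def N_def by (rule s)+
    then have "\<exists>j\<le>e. b ^ j \<in> C j + N"
      unfolding C_def
      by (intro ex_redundant_generator[OF _ fL \<open>L \<noteq> {0}\<close> x(2,3) _ NL xL pow])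
    then obtain j where j: "j \<le> e" "b ^ j \<in> C j + N" by blast
    \<comment> \<open>Since \<open>b\<^sup>j\<close> is redundant, this module is stable under multiplication by \<open>b\<close>.\<close>
    let ?T = "C j + N"
    have sT: "subspace ?T" unfolding C_def N_def by (intro subspace_set_plus s)
    have NT: "N \<subseteq> ?T" by (rule subset_set_plus2) (simp add: C_def span_zero)
    have CT: "C j \<subseteq> ?T" by (rule subset_set_plus1) (simp add: N_def span_zero)
    have vi: "subspace ((*) b -` ?T)" by (rule module_hom.subspace_vimage[OF module_hom_fract_times sT])
    have "C j \<subseteq> (*) b -` ?T"
      unfolding C_def
    proof (rule span_minimal[OF _ vi[unfolded C_def]])
      show "(\<lambda>i. b ^ i) ` {..<j} \<subseteq> (*) b -` (span ((\<lambda>i. b ^ i) ` {..<j}) + N)"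
      proof
        fix z assume "z \<in> (\<lambda>i. b ^ i) ` {..<j}"
        then obtain i where i: "i < j" "z = b ^ i" by blast
        have "b ^ Suc i \<in> ?T"
        proof (cases "Suc i = j")
          case False
          then have "b ^ Suc i \<in> C j" unfolding C_def using i(1) by (intro span_base imageI) simp
          then show ?thesis using CT by blast
        qed (use j(2) in simp)
        then show "z \<in> (*) b -` (span ((\<lambda>i. b ^ i) ` {..<j}) + N)" using i(2) by (simp add: C_def)
      qed
    qed
    moreover have "N \<subseteq> (*) b -` ?T"
      unfolding N_def
    proof (rule span_minimal[OF _ vi[unfolded N_def]])
      show "{to_fract r * b ^ i |r i. r \<in> m} \<subseteq> (*) b -` (C j + span {to_fract r * b ^ i |r i. r \<in> m})"
      proof
        fix z assume "z \<in> {to_fract r * b ^ i |r i. r \<in> m}"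
        then obtain r i where "r \<in> m" "z = to_fract r * b ^ i" by blast
        then have "b * z = to_fract r * b ^ Suc i" by (simp add: mult.left_commute)
        then have "b * z \<in> N" unfolding N_def using \<open>r \<in> m\<close> by (intro span_base) blast
        then have "b * z \<in> ?T" using NT by blast
        then show "z \<in> (*) b -` (C j + span {to_fract r * b ^ i |r i. r \<in> m})" by (simp add: N_def)
      qed
    qed
    ultimately have "?T \<subseteq> (*) b -` ?T" by (rule set_plus_subset[OF vi])
    then have bT: "b * z \<in> ?T" if "z \<in> ?T" for z using that by blast
    have powT: "b ^ (j + k) \<in> ?T" for k
    proof (induction k)
      case (Suc k)
      then show ?case using bT[OF Suc] by simp
    qed (use j(2) in simp)
    have sC: "subspace (C (Suc e))" unfolding C_def by (rule s)
    have sL: "subspace L" unfolding L_def by (rule s)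
    have CL: "C (Suc e) \<subseteq> L" unfolding C_def L_def by (rule span_mono) auto
    have CC: "C j \<subseteq> C (Suc e)" unfolding C_def using j(1) by (intro span_mono image_mono) auto
    have LM: "L \<subseteq> M" if M: "subspace M" "C (Suc e) \<subseteq> M" "N \<subseteq> M" for M
      unfolding L_def
    proof (rule span_minimal[OF _ M(1)], rule subsetI)
      fix z assume "z \<in> range (\<lambda>i. b ^ i)"
      then obtain i where i: "z = b ^ i" by blast
      show "z \<in> M"
      proof (cases "i \<le> e")
        case True
        then have "b ^ i \<in> C (Suc e)" unfolding C_def by (intro span_base imageI) simp
        then show ?thesis using i M(2) by blast
      next
        case False
        then have "j + (i - j) = i" using j(1) by simp
        then have "b ^ i \<in> ?T" using powT[of "i - j"] by simp
        moreover have "?T \<subseteq> M" by (rule set_plus_subset[OF M(1) order_trans[OF CC M(2)] M(3)])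
        ultimately show ?thesis using i by blast
      qed
    qed
    have "C (Suc e) = L"
    proof (rule ccontr)
      assume "C (Suc e) \<noteq> L"
      then have "C (Suc e) \<subset> L" using CL by blast
      have "1 \<in> C (Suc e)" unfolding C_def by (rule span_base) (auto intro: image_eqI[of _ _ 0])
      then have "C (Suc e) \<noteq> {0}" by auto
      then have "fract_length L (C (Suc e)) \<noteq> \<infinity>" by (rule fract_length_finite[OF sL fL sC CL])
      then obtain M where M: "subspace M" "C (Suc e) \<subseteq> M" "M \<subset> L" "\<forall>r\<in>m. \<forall>v\<in>L. fract_scale r v \<in> M"
        using ex_m_cosocle[OF module_fract_scale sC sL \<open>C (Suc e) \<subset> L\<close>] by blast
      have "N \<subseteq> M" unfolding N_def
        by (rule span_minimal[OF _ M(1)]) (use M(4) pow in \<open>auto simp: fract_scale_def\<close>)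
      then show False using LM[OF M(1,2)] M(3) by blast
    qed
    then have "b ^ Suc e \<in> C (Suc e)" using pow[of "Suc e"] by simp
    then show ?thesis
      using span_image_lessThan[OF module_fract_scale] unfolding C_def fract_scale_def by blast
  qed
  then show ?thesis by blast
qed

text \<open>For \<open>w\<close> in the integral closure \<open>B\<close>, the element \<open>t = y w\<close> is integral over the ideal \<open>y R\<close>:
  the coefficient of \<open>t\<^sup>i\<close> in its equation lies in the matching power of \<open>y R\<close>.\<close>

lemma power_in_principal:
  fixes t y :: 'a
  assumes t: "to_fract t = to_fract y * w" and w: "w ^ Suc e = (\<Sum>i<Suc e. to_fract (c i) * w ^ i)"
  shows "t ^ Suc e \<in> range ((*) y)"
proof -
  have tp: "to_fract (t ^ k) = to_fract (y ^ k) * w ^ k" for k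
    by (induction k) (use t in \<open>auto simp: ac_simps\<close>)
  have "to_fract (t ^ Suc e) = (\<Sum>i<Suc e. to_fract (y ^ Suc e) * (to_fract (c i) * w ^ i))"
    unfolding tp w by (simp only: sum_distrib_left)
  also have "\<dots> = (\<Sum>i<Suc e. to_fract (y * (y ^ (e - i) * c i * t ^ i)))"
  proof (rule sum.cong)
    fix i assume "i \<in> {..<Suc e}"
    then have "y ^ Suc e = y * (y ^ (e - i) * y ^ i)" by (simp flip: power_add)
    then show "to_fract (y ^ Suc e) * (to_fract (c i) * w ^ i) = to_fract (y * (y ^ (e - i) * c i * t ^ i))"
      by (simp only: to_fract_mult tp) (simp add: ac_simps)
  qed simp
  also have "\<dots> = to_fract (y * (\<Sum>i<Suc e. y ^ (e - i) * c i * t ^ i))"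
    by (simp only: to_fract_sum sum_distrib_left)
  finally have "t ^ Suc e = y * (\<Sum>i<Suc e. y ^ (e - i) * c i * t ^ i)" by (simp only: to_fract_eq_iff)
  then show ?thesis by blast
qed

text \<open>The integral closure \<open>y B \<inter> R\<close> of the ideal \<open>y R\<close>.\<close>

definition integral_part :: "'a \<Rightarrow> 'a set" where
  "integral_part y = to_fract -` ((*) (to_fract y) ` integral_closure)"

lemma is_ideal_integral_part: "is_ideal (integral_part y)"
  unfolding integral_part_def
  by (rule module_hom.subspace_vimage[OF module_hom_to_fract
        fract_submodule_times[OF fract_submodule_integral_closure]])

lemma integral_partI: "to_fract r = to_fract y * w \<Longrightarrow> w \<in> integral_closure \<Longrightarrow> r \<in> integral_part y"
  unfolding integral_part_def by blast

lemma integral_partE: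
  assumes "r \<in> integral_part y"
  obtains w where "to_fract r = to_fract y * w" "w \<in> integral_closure"
  using assms unfolding integral_part_def by blast

lemma principal_subset_integral_part: "range ((*) y) \<subseteq> integral_part y"
  by (auto intro!: integral_partI[of _ _ "to_fract _"] to_fract_integral)

lemma integral_part_mult_subset: "integral_part (y * z) \<subseteq> integral_part y"
proof
  fix r assume "r \<in> integral_part (y * z)"
  then obtain w where w: "to_fract r = to_fract (y * z) * w" "w \<in> integral_closure" by (rule integral_partE)
  then have "to_fract r = to_fract y * (to_fract z * w)" by (simp add: mult.assoc)
  then show "r \<in> integral_part y"
    by (rule integral_partI) (rule integral_closure_mult[OF to_fract_integral w(2)])
qed

text \<open>In dimension one, \<open>R[1/x]\<close> is the fraction field, because a power of \<open>x\<close> lies in every nonzero ideal.\<close>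

lemma power_times_in_range:
  fixes q :: "'a fract"
  assumes "x \<in> m"
  shows "\<exists>k. to_fract (x ^ k) * q \<in> range to_fract"
proof -
  obtain a b where b: "b \<noteq> 0" and q: "q = to_fract a / to_fract b" by (rule fract_cases)
  obtain k where k: "principal_colength b = enat k" using principal_colength_finite[OF b] by (metis not_infinity_eq)
  have "x ^ k \<in> range ((*) b)"
    using ideal_power_subset[OF principal_ideal k] power_in_ideal_power[OF assms] by blast
  then obtain r where "x ^ k = b * r" by blast
  then have "to_fract (x ^ k) * q = to_fract (r * a)" using b q by simp
  then show ?thesis by blast
qed

text \<open>The inclusion \<open>x\<^sup>n B \<inter> R \<subseteq> x R\<close> propagates to \<open>x\<^sup>n\<^sup>+\<^sup>k B \<inter> R \<subseteq> x\<^sup>k\<^sup>+\<^sup>1 R\<close>. Since every \<open>b\<close> in \<open>B\<close>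
  has some \<open>x\<^sup>k\<close> as a denominator, it follows that \<open>x\<^sup>n\<close> is a denominator for all of \<open>B\<close>.\<close>

lemma fractional_integral_closure_if:
  assumes x: "x \<in> m" "x \<noteq> 0" and sub: "integral_part (x ^ n) \<subseteq> range ((*) x)"
  shows "fractional (integral_closure :: 'a fract set)"
proof -
  have step: "integral_part (x ^ (n + k)) \<subseteq> range ((*) (x ^ Suc k))" for k
  proof (induction k)
    case (Suc k)
    show ?case
    proof
      fix r assume r: "r \<in> integral_part (x ^ (n + Suc k))"
      then have "r \<in> integral_part (x ^ n)" using integral_part_mult_subset by (metis power_add subsetD)
      then obtain z where z: "r = x * z" using sub by blast
      obtain w where w: "to_fract r = to_fract (x ^ (n + Suc k)) * w" "w \<in> integral_closure"
        using r by (rule integral_partE)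
      then have "to_fract x * to_fract z = to_fract x * (to_fract (x ^ (n + k)) * w)"
        using z by (simp add: mult.assoc)
      then have "to_fract z = to_fract (x ^ (n + k)) * w" using x(2) by simp
      then have "z \<in> range ((*) (x ^ Suc k))" using integral_partI[OF _ w(2)] Suc.IH by blast
      then show "r \<in> range ((*) (x ^ Suc (Suc k)))" using z by (auto simp: mult.assoc)
    qed
  qed (use sub in simp)
  have "to_fract (x ^ n) * b \<in> range to_fract" if b: "b \<in> integral_closure" for b
  proof -
    obtain k where "to_fract (x ^ k) * b \<in> range to_fract" using power_times_in_range[OF x(1)] by blast
    then obtain s where "to_fract (x ^ k) * b = to_fract s" by blast
    then have "to_fract (x ^ n * s) = to_fract (x ^ (n + k)) * b" by (simp add: power_add mult.assoc)
    then have "x ^ n * s \<in> range ((*) (x ^ Suc k))" using integral_partI[OF _ b] step[of k] by blast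
    then obtain u where "x ^ n * s = x ^ Suc k * u" by blast
    then have "to_fract (x ^ (n + k)) * b = to_fract (x ^ Suc k * u)"
      using \<open>to_fract (x ^ n * s) = to_fract (x ^ (n + k)) * b\<close> by simp
    then have "to_fract (x ^ k) * (to_fract (x ^ n) * b) = to_fract (x ^ k) * to_fract (x * u)"
      by (simp add: power_add ac_simps)
    then have "to_fract (x ^ n) * b = to_fract (x * u)" using x(2) by (metis mult_left_cancel power_not_zero to_fract_eq_0_iff)
    then show ?thesis by blast
  qed
  then show ?thesis unfolding fractional_def using x(2) by (intro exI[of _ "x ^ n"]) simp
qed

text \<open>If the integral closure is not finite, then none of the ideals \<open>x\<^sup>n B \<inter> R\<close> is contained in
  \<open>x R\<close>. Modulo each \<open>x\<^sup>k R\<close> they become stationary, so that one can choose a sequence of elements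
  \<open>t n \<in> x\<^sup>n\<^sup>+\<^sup>1 B\<close>, convergent in the completion, whose limit is nonzero modulo \<open>x\<close>. A fixed power of
  \<open>t n\<close> lies in \<open>x\<^sup>n\<^sup>+\<^sup>1 R\<close>, so that the limit is nilpotent.\<close>

theorem fractional_integral_closure:
  assumes unram: "analytically_unramified m"
  shows "fractional (integral_closure :: 'a fract set)"
proof (rule ccontr)
  assume nf: "\<not> fractional (integral_closure :: 'a fract set)"
  obtain x where x: "x \<in> m" "x \<noteq> 0" using ex_nonzero_in_m by blast
  define I where "I = (\<lambda>n. integral_part (x ^ n))"
  define P where "P = (\<lambda>k. range ((*) (x ^ k)))"
  have sI: "is_ideal (I n)" for n unfolding I_def by (rule is_ideal_integral_part)
  have sP: "is_ideal (P k)" for k unfolding P_def by (rule principal_ideal)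
  have I_anti: "I n' \<subseteq> I n" if "n \<le> n'" for n n'
  proof -
    have "x ^ n' = x ^ n * x ^ (n' - n)" using that by (simp flip: power_add)
    then show ?thesis unfolding I_def using integral_part_mult_subset by metis
  qed
  have P_sub: "P k' \<subseteq> P k" if "k \<le> k'" for k k'
  proof -
    have "x ^ k' = x ^ k * x ^ (k' - k)" using that by (simp flip: power_add)
    then show ?thesis unfolding P_def using principal_subset_ideal[OF principal_ideal] by (metis rangeI)
  qed
  note plus = module.subspace_set_plus[OF module_times]
  have "\<exists>\<nu>. \<forall>n\<ge>\<nu>. I n + P k = I \<nu> + P k" for k
  proof (rule module.decreasing_stabilizes[OF module_times sP ideal_UNIV])
    have "x ^ k \<noteq> 0" using x(2) by simp
    then show "quot_length (*) UNIV (P k) \<noteq> \<infinity>"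
      unfolding P_def using principal_colength_finite by (simp add: colength_def)
    show "is_ideal (I i + P k)" for i by (rule plus[OF sI sP])
    show "P k \<subseteq> I i + P k" for i
      by (rule module.subset_set_plus2[OF module_times ideal_0[OF sI]])
    show "I (Suc i) + P k \<subseteq> I i + P k" for i by (rule set_plus_mono2[OF I_anti]) auto
  qed simp
  then obtain \<nu> where \<nu>: "\<And>k n. \<nu> k \<le> n \<Longrightarrow> I n + P k = I (\<nu> k) + P k" by metis
  \<comment> \<open>The stationary value modulo \<open>x\<^sup>k R\<close>; it maps onto the one for any smaller \<open>k\<close>.\<close>
  define K where "K = (\<lambda>k. I (\<nu> k) + P k)"
  have K_sub: "K k \<subseteq> I n + P k" for k n
  proof (cases "\<nu> k \<le> n")
    case True
    then show ?thesis unfolding K_def \<nu>[OF True] by simp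
  next
    case False
    then show ?thesis unfolding K_def by (intro set_plus_mono2[OF I_anti]) auto
  qed
  have K_I: "K k \<subseteq> I k" for k
  proof -
    have "P k \<subseteq> I k" unfolding P_def I_def by (rule principal_subset_integral_part)
    then have "I k + P k \<subseteq> I k" by (intro module.set_plus_subset[OF module_times sI]) auto
    then show ?thesis using K_sub[of k k] by blast
  qed
  have lift: "\<exists>t'. t' \<in> K (Suc k) \<and> t' - t \<in> P k" if "t \<in> K k" for k t
  proof -
    have "t \<in> I (\<nu> (Suc k)) + P k" using that K_sub by blast
    then obtain a p where t: "t = a + p" "a \<in> I (\<nu> (Suc k))" "p \<in> P k" by (rule set_plus_elim)
    have "a \<in> K (Suc k)" unfolding K_def
      using t(2) module.subset_set_plus1[OF module_times ideal_0[OF sP]] by blast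
    moreover have "a - t \<in> P k" using ideal_diff[OF sP ideal_0[OF sP] t(3)] t(1) by simp
    ultimately show ?thesis by blast
  qed
  have "\<not> I (\<nu> 1) \<subseteq> range ((*) x)"
    using fractional_integral_closure_if[OF x] nf unfolding I_def by blast
  then obtain t0 where t0: "t0 \<in> I (\<nu> 1)" "t0 \<notin> range ((*) x)" by blast
  have "t0 \<in> K 1" unfolding K_def
    using t0(1) module.subset_set_plus1[OF module_times ideal_0[OF sP]] by blast
  have "\<exists>t. \<forall>n. (t n \<in> K (Suc n) \<and> (n = 0 \<longrightarrow> t n = t0)) \<and> t (Suc n) - t n \<in> P (Suc n)"
  proof (rule dependent_nat_choice)
    show "\<exists>t. t \<in> K (Suc 0) \<and> (0 = (0::nat) \<longrightarrow> t = t0)" using \<open>t0 \<in> K 1\<close> by simp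
    fix t n assume "t \<in> K (Suc n) \<and> (n = 0 \<longrightarrow> t = t0)"
    then show "\<exists>t'. (t' \<in> K (Suc (Suc n)) \<and> (Suc n = 0 \<longrightarrow> t' = t0)) \<and> t' - t \<in> P (Suc n)"
      using lift[of t "Suc n"] by simp
  qed
  then obtain t where tK: "\<And>n. t n \<in> K (Suc n)" and t_0: "t 0 = t0"
    and t_diff: "\<And>n. t (Suc n) - t n \<in> P (Suc n)" by blast
  let ?X = "\<lambda>n. coset (ideal_power m n) (t n)"
  have P_power: "P n \<subseteq> ideal_power m n" for n
    unfolding P_def by (rule principal_subset_ideal[OF is_ideal_power power_in_ideal_power[OF x(1)]])
  have "?X \<in> completion m"
    unfolding completion_def
  proof (intro CollectI conjI allI)
    fix n
    show "?X n \<in> residue_ring (ideal_power m n)" unfolding residue_ring_def by blast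
    show "?X (Suc n) \<subseteq> ?X n"
    proof
      fix z assume "z \<in> ?X (Suc n)"
      then obtain a where a: "z = t (Suc n) + a" "a \<in> ideal_power m (Suc n)" unfolding coset_def by blast
      have "a \<in> ideal_power m n" using a(2) ideal_power_Suc_subset by blast
      moreover have "t (Suc n) - t n \<in> ideal_power m n"
        using t_diff[of n] P_power[of "Suc n"] ideal_power_Suc_subset by blast
      ultimately have "t (Suc n) - t n + a \<in> ideal_power m n" using ideal_add[OF is_ideal_power] by blast
      moreover have "z = t n + (t (Suc n) - t n + a)" using a(1) by simp
      ultimately show "z \<in> ?X n" unfolding coset_def by blast
    qed
  qed
  moreover obtain e where e: "\<And>b. b \<in> (integral_closure :: 'a fract set) \<Longrightarrow>
      \<exists>c. b ^ Suc e = (\<Sum>i<Suc e. to_fract (c i) * b ^ i)" using bounded_integral_degree by blast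
  have "compl_power m ?X (Suc e) = compl_zero m"
    unfolding compl_power_coset[OF is_ideal_power] compl_zero_def
  proof
    fix n
    have "t n \<in> integral_part (x ^ Suc n)" using tK[of n] K_I[of "Suc n"] unfolding I_def by blast
    then obtain w where w: "to_fract (t n) = to_fract (x ^ Suc n) * w" "w \<in> integral_closure"
      by (rule integral_partE)
    obtain c where "w ^ Suc e = (\<Sum>i<Suc e. to_fract (c i) * w ^ i)" using e[OF w(2)] by blast
    then have "t n ^ Suc e \<in> P (Suc n)" unfolding P_def by (rule power_in_principal[OF w(1)])
    then have "t n ^ Suc e - 0 \<in> ideal_power m n"
      using P_power[of "Suc n"] ideal_power_Suc_subset[of m n] by (simp add: subset_eq)
    then show "coset (ideal_power m n) (t n ^ Suc e) = coset (ideal_power m n) 0"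
      by (simp only: coset_eq_iff[OF is_ideal_power])
  qed
  ultimately have X0: "?X = compl_zero m" using unram unfolding analytically_unramified_def by blast
  have tm: "t n \<in> ideal_power m n" for n
  proof -
    have "coset (ideal_power m n) (t n) = coset (ideal_power m n) 0"
      using fun_cong[OF X0, of n] by (simp add: compl_zero_def)
    then have "t n - 0 \<in> ideal_power m n" by (simp only: coset_eq_iff[OF is_ideal_power])
    then show ?thesis by simp
  qed
  have t_range: "t n - t0 \<in> range ((*) x)" for n
  proof (induction n)
    case 0
    then show ?case using t_0 ideal_0[OF principal_ideal] by simp
  next
    case (Suc n)
    have "t (Suc n) - t n \<in> range ((*) x)" using t_diff[of n] P_sub[of 1 "Suc n"] unfolding P_def by auto
    then have "(t (Suc n) - t n) + (t n - t0) \<in> range ((*) x)" using Suc ideal_add[OF principal_ideal] by blast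
    then show ?case by simp
  qed
  obtain k where k: "principal_colength x = enat k" using principal_colength_finite[OF x(2)] by (metis not_infinity_eq)
  have "t k \<in> range ((*) x)" using ideal_power_subset[OF principal_ideal k] tm by blast
  then have "t k - (t k - t0) \<in> range ((*) x)" using t_range ideal_diff[OF principal_ideal] by blast
  then show False using t0(2) by simp
qed

end

section \<open>Annihilators under a pairing\<close>

context one_dim_local_domain
begin

text \<open>It suffices to let \<open>A / B\<close> be simple, generated by \<open>a\<close>. Then pairing with \<open>a\<close> embeds the
  quotient of annihilators into the socle of the target modulo \<open>N\<close>.\<close>

theorem pairing_length_le:
  fixes s1 :: "'a \<Rightarrow> 'b::ab_group_add \<Rightarrow> 'b" and s2 :: "'a \<Rightarrow> 'c::ab_group_add \<Rightarrow> 'c"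
    and s3 :: "'a \<Rightarrow> 'd::ab_group_add \<Rightarrow> 'd"
  assumes lin1: "\<And>u. module_hom s1 s3 (\<lambda>a. \<beta> a u)" and lin2: "\<And>a. module_hom s2 s3 (\<beta> a)"
    and N: "module.subspace s3 N"
    and socle: "quot_length s3 {v. \<forall>r\<in>m. s3 r v \<in> N} N \<le> 1"
    and A: "module.subspace s1 A" and B: "module.subspace s1 B" "B \<subseteq> A"
  shows "quot_length s2 {u. \<forall>b\<in>B. \<beta> b u \<in> N} {u. \<forall>a\<in>A. \<beta> a u \<in> N} \<le> quot_length s1 A B"
proof (cases "quot_length s1 A B")
  case (enat n)
  have mod1: "module s1" and mod3: "module s3" using lin1[of undefined] by (simp_all add: module_hom_def)
  have mod2: "module s2" using lin2[of undefined] by (simp add: module_hom_def)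
  let ?P = "\<lambda>X. {u. \<forall>b\<in>X. \<beta> b u \<in> N}"
  have sP: "module.subspace s2 (?P X)" for X
  proof -
    have "?P X = (\<Inter>b\<in>X. \<beta> b -` N)" by auto
    moreover have "module.subspace s2 (\<Inter>b\<in>X. \<beta> b -` N)"
      by (rule module.subspace_Int[OF mod2]) (rule module_hom.subspace_vimage[OF lin2 N])
    ultimately show ?thesis by simp
  qed
  have anti: "?P Y \<subseteq> ?P X" if "X \<subseteq> Y" for X Y using that by blast
  have "quot_length s2 (?P B) (?P A) \<le> enat n" using B enat
  proof (induction n arbitrary: B)
    case 0
    then have "A = B" using module.len_eq_0_iff[OF mod1 0(1) A] by (simp add: enat_0)
    then show ?case by (simp add: module.len_self[OF mod2])
  next
    case (Suc n)
    have "A \<noteq> B" using Suc.prems(3) module.len_self[OF mod1, of B] by (auto simp: enat_0_iff)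
    then have "B \<subset> A" using Suc.prems(2) by blast
    then obtain C where C: "module.subspace s1 C" "B \<subset> C" "C \<subseteq> A" "quot_length s1 C B = 1"
      "\<forall>r\<in>m. \<forall>v\<in>C. s1 r v \<in> B"
      using ex_m_socle[OF mod1 Suc.prems(1) A] Suc.prems(3) by auto
    then obtain a where a: "a \<in> C" "a \<notin> B" by blast
    have "quot_length s1 A B = quot_length s1 A C + quot_length s1 C B"
      by (rule module.len_additive[OF mod1 Suc.prems(1) C(1) A]) (use C in auto)
    then have "quot_length s1 A C = enat n" using Suc.prems(3) C(4)
      by (cases "quot_length s1 A C") (auto simp: one_enat_def)
    then have rest: "quot_length s2 (?P C) (?P A) \<le> enat n" by (rule Suc.IH[OF C(1,3)])
    let ?S = "{v. \<forall>r\<in>m. s3 r v \<in> N}"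
    have "quot_length s2 (?P B) (?P C) \<le> quot_length s3 ?S N"
    proof (rule module_hom.len_le_of_inj[OF lin2 N])
      have "?S = (\<Inter>r\<in>m. s3 r -` N)" by auto
      moreover have "module.subspace s3 (\<Inter>r\<in>m. s3 r -` N)"
      proof (rule module.subspace_Int[OF mod3])
        fix r
        have "module_hom s3 s3 (s3 r)"
          using mod3 module.scale_right_distrib[OF mod3] module.scale_left_commute[OF mod3]
          by (simp add: module_hom_iff)
        then show "module.subspace s3 (s3 r -` N)" by (rule module_hom.subspace_vimage[OF _ N])
      qed
      ultimately show "module.subspace s3 ?S" by simp
      show "N \<subseteq> ?S" using module.subspace_scale[OF mod3 N] by blast
      show "\<beta> a ` ?P B \<subseteq> ?S"
      proof
        fix z assume "z \<in> \<beta> a ` ?P B"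
        then obtain u where u: "z = \<beta> a u" "\<forall>b\<in>B. \<beta> b u \<in> N" by blast
        have "s3 r z \<in> N" if "r \<in> m" for r
        proof -
          have "s3 r z = \<beta> (s1 r a) u" unfolding u(1) by (rule module_hom.scale[OF lin1, symmetric])
          then show ?thesis using u(2) C(5) that a(1) by simp
        qed
        then show "z \<in> ?S" by blast
      qed
      fix u assume u: "u \<in> ?P B" "\<beta> a u \<in> N"
      have "C = {b + s1 r a | b r. b \<in> B}"
        by (rule module.len_1_generated[OF mod1 Suc.prems(1) C(1) _ C(4) a]) (use C(2) in blast)
      then have C_gen: "\<exists>b r. c = b + s1 r a \<and> b \<in> B" if "c \<in> C" for c
        using that by (simp only: mem_Collect_eq)
      have "\<beta> c u \<in> N" if cC: "c \<in> C" for c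
      proof -
        obtain b r where c: "c = b + s1 r a" "b \<in> B" using C_gen[OF cC] by blast
        have "\<beta> c u = \<beta> b u + s3 r (\<beta> a u)"
          unfolding c(1) by (simp only: module_hom.add[OF lin1] module_hom.scale[OF lin1])
        also have "\<dots> \<in> N"
          using u c(2) by (intro module.subspace_add[OF mod3 N] module.subspace_scale[OF mod3 N]) auto
        finally show ?thesis .
      qed
      then show "u \<in> ?P C" by blast
    qed
    then have first: "quot_length s2 (?P B) (?P C) \<le> 1" using socle by (rule order_trans)
    have "quot_length s2 (?P B) (?P A) = quot_length s2 (?P B) (?P C) + quot_length s2 (?P C) (?P A)"
      by (rule module.len_additive[OF mod2 sP sP sP anti anti]) (use C in auto)
    also have "\<dots> \<le> 1 + enat n" using first rest by (rule add_mono)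
    finally show ?case by (simp add: one_enat_def)
  qed
  then show ?thesis using enat by simp
qed simp

end

section \<open>Functionals on torsion-free modules\<close>

text \<open>A maximal independent subset \<open>T\<close> of a finite generating set spans a submodule that contains a
  multiple \<open>d v\<close> of every element \<open>v\<close>; the coordinates of \<open>d v\<close> with respect to \<open>T\<close> are functionals.\<close>

lemma ex_nonzero_functional:
  fixes s :: "'a::idom \<Rightarrow> 'b::ab_group_add \<Rightarrow> 'b"
  assumes mod: "module s" and fg: "fin_gen s UNIV"
    and tf: "\<And>r v. s r v = 0 \<Longrightarrow> r \<noteq> 0 \<Longrightarrow> v = 0" and "v \<noteq> 0"
  shows "\<exists>f. module_hom s (*) f \<and> f v \<noteq> 0"
proof -
  interpret module s by fact
  obtain S where S: "finite S" "span S = UNIV" using fg unfolding fin_gen_def by blast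
  let ?\<T> = "{T. T \<subseteq> S \<and> independent T}"
  have "finite ?\<T>" using S(1) by simp
  moreover have "{} \<in> ?\<T>" by (simp add: independent_empty)
  then have "?\<T> \<noteq> {}" by (metis empty_iff)
  ultimately have "\<exists>T\<in>?\<T>. \<forall>U\<in>?\<T>. T \<subseteq> U \<longrightarrow> T = U" by (rule finite_has_maximal)
  then obtain T where T: "T \<in> ?\<T>" "\<And>U. U \<in> ?\<T> \<Longrightarrow> T \<subseteq> U \<Longrightarrow> T = U" by (elim bexE) simp
  then have TS: "T \<subseteq> S" and ind: "independent T" and finT: "finite T"
    using S(1) finite_subset by auto
  have "\<exists>d. d \<noteq> 0 \<and> s d w \<in> span T" if w: "w \<in> S" for w
  proof (cases "w \<in> T")
    case True
    then show ?thesis by (intro exI[of _ 1]) (simp add: span_base)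
  next
    case False
    have "dependent (insert w T)" using T(2)[of "insert w T"] TS w False by auto
    then obtain U u where U: "finite U" "U \<subseteq> insert w T" "(\<Sum>v\<in>U. s (u v) v) = 0" "\<exists>v\<in>U. u v \<noteq> 0"
      unfolding dependent_explicit by blast
    have U': "U - {w} \<subseteq> T" using U(2) by blast
    have "w \<in> U \<and> u w \<noteq> 0"
    proof (rule ccontr)
      assume no: "\<not> (w \<in> U \<and> u w \<noteq> 0)"
      have "(\<Sum>v\<in>U - {w}. s (u v) v) = (\<Sum>v\<in>U. s (u v) v)"
        using no by (intro sum.mono_neutral_left) (auto simp: U(1))
      then have "(\<Sum>v\<in>U - {w}. s (u v) v) = 0" using U(3) by simp
      moreover have "\<exists>v\<in>U - {w}. u v \<noteq> 0" using U(4) no by blast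
      ultimately have "dependent T" unfolding dependent_explicit using U' U(1) by blast
      then show False using ind by blast
    qed
    moreover from this have "s (u w) w = - (\<Sum>v\<in>U - {w}. s (u v) v)"
      using U(1,3) by (simp add: sum.remove[of U w] eq_neg_iff_add_eq_0)
    moreover have "- (\<Sum>v\<in>U - {w}. s (u v) v) \<in> span T"
      using U' by (intro span_neg span_sum span_scale span_base) blast
    ultimately show ?thesis by auto
  qed
  then obtain \<delta> where \<delta>: "\<And>w. w \<in> S \<Longrightarrow> \<delta> w \<noteq> 0 \<and> s (\<delta> w) w \<in> span T" by metis
  define d where "d = prod \<delta> S"
  have "d \<noteq> 0" unfolding d_def using \<delta> S(1) by simp
  have "subspace {u. s d u \<in> span T}"
    by (rule subspaceI) (auto simp: span_zero scale_right_distrib span_add scale_left_commute[of d] span_scale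
        simp del: scale_scale)
  moreover have "S \<subseteq> {u. s d u \<in> span T}"
  proof
    fix w assume w: "w \<in> S"
    have "d = prod \<delta> (S - {w}) * \<delta> w" unfolding d_def using S(1) w by (simp add: prod.remove mult.commute)
    then have "s d w = s (prod \<delta> (S - {w})) (s (\<delta> w) w)" by simp
    also have "\<dots> \<in> span T" by (rule span_scale) (use \<delta>[OF w] in simp)
    finally show "w \<in> {u. s d u \<in> span T}" by simp
  qed
  ultimately have "span S \<subseteq> {u. s d u \<in> span T}" by (intro span_minimal)
  then have dT: "s d u \<in> span T" for u using S(2) by auto
  have "s d v \<noteq> 0" using tf \<open>d \<noteq> 0\<close> \<open>v \<noteq> 0\<close> by blast
  have "(\<Sum>b\<in>T. s (representation T (s d v) b) b) = s d v"
    by (rule sum_representation_eq[OF ind dT finT order.refl])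
  then obtain t where t: "representation T (s d v) t \<noteq> 0" using \<open>s d v \<noteq> 0\<close>
    by (metis (mono_tags, lifting) scale_zero_left sum.neutral)
  have "module_hom s (*) (\<lambda>u. representation T (s d u) t)"
    unfolding module_hom_iff
  proof (intro conjI allI mod module_times)
    fix b1 b2
    show "representation T (s d (b1 + b2)) t = representation T (s d b1) t + representation T (s d b2) t"
      unfolding scale_right_distrib representation_add[OF ind dT dT] ..
  next
    fix r b
    have "s d (s r b) = s r (s d b)" by (rule scale_left_commute)
    then show "representation T (s d (s r b)) t = r * representation T (s d b) t"
      by (simp only: representation_scale[OF ind dT])
  qed
  then show ?thesis using t by blast
qed

section \<open>Canonical modules\<close>

lemma module_hom_mat_map:
  fixes s :: "'a::comm_ring_1 \<Rightarrow> 'b::ab_group_add \<Rightarrow> 'b"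
  assumes "module s"
  shows "module_hom (vec_scale s) (vec_scale s) (mat_map s A p q)"
proof -
  interpret module s by fact
  show ?thesis
    unfolding module_hom_iff
  proof (intro conjI allI module_vec_scale assms)
    show "mat_map s A p q (x + y) = mat_map s A p q x + mat_map s A p q y" for x y
      by (rule ext) (simp add: mat_map_def scale_right_distrib sum.distrib)
    show "mat_map s A p q (vec_scale s c x) = vec_scale s c (mat_map s A p q x)" for c x
      by (rule ext) (simp add: mat_map_def vec_scale_def scale_sum_right mult.commute)
  qed
qed

lemma module_hom_times: "module_hom (*) (*) ((*) x)" for x :: "'a::comm_ring_1"
  by (simp add: module_hom_iff module_times algebra_simps)

lemma subspace_vecs:
  fixes s :: "'a::comm_ring_1 \<Rightarrow> 'b::ab_group_add \<Rightarrow> 'b"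
  assumes "module s"
  shows "module.subspace (vec_scale s) (vecs n)"
  by (rule module.subspaceI[OF module_vec_scale[OF assms]])
     (auto simp: vecs_def vec_scale_def module.scale_zero_right[OF assms])

lemma mat_map_vecs: "mat_map s A p q x \<in> vecs p"
  by (simp add: mat_map_def vecs_def)

lemma mat_map_unit:
  assumes "l < q"
  shows "mat_map (*) A p q (\<lambda>k. if k = l then 1 else 0) = (\<lambda>j. if j < p then A j l else (0::'a::comm_ring_1))"
  using assms by (intro ext) (simp add: mat_map_def if_distrib[of "\<lambda>u. _ * u"] cong: if_cong)

locale local_domain_with_canonical_module = one_dim_local_domain m
  for m :: "'a::idom set" +
  fixes s :: "'a \<Rightarrow> 'b::ab_group_add \<Rightarrow> 'b"
  assumes canonical: "canonical_module m s"
begin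

lemma module_s: "module s" and fin_gen_s: "fin_gen s UNIV"
  using canonical by (simp_all add: canonical_module_def)


text \<open>The definition of a canonical module enters through a resolution of the residue field. Evaluated
  on unit vectors, exactness says that the augmentation maps the columns of the first differential
  into \<open>m\<close> and that the product of the first two differentials is zero.\<close>

lemma resolution_entries:
  obtains r w d where
    "\<And>v. v \<in> vecs (r 0) \<Longrightarrow> (\<Sum>j<r 0. v j * w j) \<in> m \<Longrightarrow>
       \<exists>y\<in>vecs (r 1). v = mat_map (*) (d 0) (r 0) (r 1) y"
    "\<exists>v\<in>vecs (r 0). (\<Sum>j<r 0. v j * w j) = 1"
    "\<And>l. l < r 1 \<Longrightarrow> (\<Sum>j<r 0. d 0 j l * w j) \<in> m"
    "\<And>j p. j < r 0 \<Longrightarrow> p < r 2 \<Longrightarrow> (\<Sum>l<r 1. d 0 j l * d 1 l p) = 0"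
    "ext_length s r d 0 = 0" "ext_length s r d 1 = 1"
proof -
  obtain r w d where res: "free_resolution m r w d"
    and ext: "\<And>i. ext_length s r d i = (if enat i = krull_dim TYPE('a) then 1 else 0)"
    using canonical unfolding canonical_module_def by blast
  have res0: "\<And>v. v \<in> vecs (r 0) \<Longrightarrow> (\<Sum>j<r 0. v j * w j) \<in> m \<longleftrightarrow>
       v \<in> mat_map (*) (d 0) (r 0) (r 1) ` vecs (r 1)"
    and res1: "\<And>v. v \<in> vecs (r 1) \<Longrightarrow> mat_map (*) (d 0) (r 0) (r 1) v = 0 \<longleftrightarrow>
        v \<in> mat_map (*) (d 1) (r 1) (r 2) ` vecs (r 2)"
    and aug: "\<exists>v\<in>vecs (r 0). (\<Sum>j<r 0. v j * w j) - 1 \<in> m"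
    using res unfolding free_resolution_def by (simp_all add: numeral_2_eq_2)
  have unit: "(\<lambda>k. if k = l then 1 else (0::'a)) \<in> vecs n" if "l < n" for l n
    using that by (simp add: vecs_def)
  show thesis
  proof (rule that)
    show "\<exists>y\<in>vecs (r 1). v = mat_map (*) (d 0) (r 0) (r 1) y"
      if "v \<in> vecs (r 0)" "(\<Sum>j<r 0. v j * w j) \<in> m" for v
      using res0[OF that(1)] that(2) by blast
    obtain v where v: "v \<in> vecs (r 0)" "(\<Sum>j<r 0. v j * w j) - 1 \<in> m" using aug by blast
    let ?a = "\<Sum>j<r 0. v j * w j"
    have "?a \<notin> m"
    proof
      assume "?a \<in> m"
      then have "?a - (?a - 1) \<in> m" using v(2) ideal_diff[OF ideal_m] by blast
      then show False using one_notin_m by simp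
    qed
    then obtain b where b: "b * ?a = 1" using unit_if_notin_m by blast
    have "(\<lambda>j. b * v j) \<in> vecs (r 0)" using v(1) by (simp add: vecs_def)
    moreover have "(\<Sum>j<r 0. b * v j * w j) = 1" using b by (simp add: sum_distrib_left mult.assoc)
    ultimately show "\<exists>v\<in>vecs (r 0). (\<Sum>j<r 0. v j * w j) = 1" by (intro bexI[of _ "\<lambda>j. b * v j"])
  next
    fix l assume l: "l < r 1"
    let ?v = "mat_map (*) (d 0) (r 0) (r 1) (\<lambda>k. if k = l then 1 else 0)"
    have "?v \<in> mat_map (*) (d 0) (r 0) (r 1) ` vecs (r 1)" using unit[OF l] by (rule imageI)
    then have "(\<Sum>j<r 0. ?v j * w j) \<in> m" using res0[OF mat_map_vecs] by blast
    then show "(\<Sum>j<r 0. d 0 j l * w j) \<in> m" unfolding mat_map_unit[OF l] by simp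
  next
    fix j p assume j: "j < r 0" and p: "p < r 2"
    let ?v = "mat_map (*) (d 1) (r 1) (r 2) (\<lambda>k. if k = p then 1 else 0)"
    have "?v \<in> mat_map (*) (d 1) (r 1) (r 2) ` vecs (r 2)" using unit[OF p] by (rule imageI)
    then have "mat_map (*) (d 0) (r 0) (r 1) ?v = 0" using res1[OF mat_map_vecs] by blast
    then have "mat_map (*) (d 0) (r 0) (r 1) ?v j = 0" by simp
    moreover have "mat_map (*) (d 0) (r 0) (r 1) ?v j = (\<Sum>l<r 1. d 0 j l * ?v l)"
      using j by (simp only: mat_map_def[of _ "d 0"] if_True)
    moreover have "(\<Sum>l<r 1. d 0 j l * ?v l) = (\<Sum>l<r 1. d 0 j l * d 1 l p)"
      unfolding mat_map_unit[OF p] by (rule sum.cong) auto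
    ultimately show "(\<Sum>l<r 1. d 0 j l * d 1 l p) = 0" by (simp only:)
  next
    show "ext_length s r d 0 = 0" "ext_length s r d 1 = 1"
      using ext[of 0] ext[of 1] dim_1 by (simp_all add: one_enat_def)
  qed
qed

lemma hom_diff_apply:
  "hom_diff s r d i x = (\<lambda>l. if l < r (Suc i) then \<Sum>j<r i. s (d i j l) (x j) else 0)"
  by (simp add: hom_diff_def mat_map_def)

lemma subspace_cocycles: "module.subspace (vec_scale s) (cocycles s r d i)"
proof -
  have "cocycles s r d i = vecs (r i) \<inter> {x. hom_diff s r d i x = 0}" by (auto simp: cocycles_def)
  then show ?thesis
    using module.subspace_inter[OF module_vec_scale[OF module_s] subspace_vecs[OF module_s]
        module_hom.subspace_kernel[OF module_hom_mat_map[OF module_s]]]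
    by (simp add: hom_diff_def)
qed

lemma subspace_coboundaries: "module.subspace (vec_scale s) (coboundaries s r d i)"
proof (cases i)
  case 0
  then show ?thesis
    by (simp add: coboundaries_def module.subspace_single_0[OF module_vec_scale[OF module_s]])
next
  case (Suc k)
  then show ?thesis
    using module_hom.subspace_image[OF module_hom_mat_map[OF module_s] subspace_vecs[OF module_s]]
    by (simp add: coboundaries_def hom_diff_def)
qed

lemma nontrivial: "\<exists>v::'b. v \<noteq> 0"
proof (rule ccontr)
  assume "\<not> (\<exists>v::'b. v \<noteq> 0)"
  then have triv: "x = 0" for x :: "nat \<Rightarrow> 'b" by (simp add: fun_eq_iff)
  obtain r :: "nat \<Rightarrow> nat" and d :: "nat \<Rightarrow> nat \<Rightarrow> nat \<Rightarrow> 'a" where "ext_length s r d 1 = 1"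
    by (rule resolution_entries)
  moreover have "X = {0}" if "module.subspace (vec_scale s) X" for X :: "(nat \<Rightarrow> 'b) set"
    using module.subspace_0[OF module_vec_scale[OF module_s] that] triv by blast
  then have "cocycles s r d 1 = {0}" "coboundaries s r d 1 = {0}"
    using subspace_cocycles subspace_coboundaries by metis+
  ultimately show False
    by (simp add: ext_length_def module.len_self[OF module_vec_scale[OF module_s]])
qed

text \<open>An element killed by \<open>m\<close> is a homomorphism from the residue field, and \<open>Ext\<^sup>0\<close> vanishes.\<close>

lemma m_annihilated_eq_0:
  assumes u: "\<forall>c\<in>m. s c u = 0"
  shows "u = 0"
proof -
  interpret module s by (rule module_s)
  obtain r w d where one: "\<exists>v\<in>vecs (r 0). (\<Sum>j<r 0. v j * w j) = (1::'a)"
    and col: "\<And>l. l < r 1 \<Longrightarrow> (\<Sum>j<r 0. d 0 j l * w j) \<in> m"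
    and ext: "ext_length s r d 0 = 0"
    by (rule resolution_entries) blast
  define \<phi> where "\<phi> = (\<lambda>j. if j < r 0 then s (w j) u else 0)"
  have "hom_diff s r d 0 \<phi> = 0"
  proof
    fix l
    have "(\<Sum>j<r 0. s (d 0 j l) (\<phi> j)) = s (\<Sum>j<r 0. d 0 j l * w j) u"
      by (simp add: \<phi>_def scale_sum_left)
    then show "hom_diff s r d 0 \<phi> l = 0 l" using u col by (simp add: hom_diff_apply)
  qed
  then have "\<phi> \<in> cocycles s r d 0" by (simp add: cocycles_def vecs_def \<phi>_def)
  moreover have "cocycles s r d 0 = {0}"
  proof -
    have "{0} \<subseteq> cocycles s r d 0"
      using module.subspace_0[OF module_vec_scale[OF module_s] subspace_cocycles] by blast
    then show ?thesis
      using ext module.len_eq_0_iff[OF module_vec_scale[OF module_s] subspace_coboundaries[of r d 0] subspace_cocycles[of r d 0]]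
      by (simp add: ext_length_def coboundaries_def)
  qed
  ultimately have \<phi>0: "\<phi> j = 0" for j by simp
  obtain v where v: "(\<Sum>j<r 0. v j * w j) = 1" using one by blast
  have "u = s (\<Sum>j<r 0. v j * w j) u" using v by simp
  also have "\<dots> = (\<Sum>j<r 0. s (v j) (\<phi> j))" by (simp add: \<phi>_def scale_sum_left)
  also have "\<dots> = 0" by (simp add: \<phi>0)
  finally show ?thesis .
qed

text \<open>If \<open>a v = 0\<close>, then \<open>R v\<close> has finite length, and its socle is annihilated by \<open>m\<close>.\<close>

theorem torsion_free:
  assumes "s a v = 0" "a \<noteq> 0"
  shows "v = 0"
proof (rule ccontr)
  interpret module s by (rule module_s)
  assume "v \<noteq> 0"
  let ?A = "{c. s c v = 0}"
  have iA: "is_ideal ?A"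
    by (rule ideal_subspaceI) (auto simp: scale_left_distrib simp flip: scale_scale)
  have "?A \<noteq> {0}" using assms by blast
  then have "quot_length (*) UNIV ?A \<noteq> \<infinity>" using colength_finite[OF iA] by (simp add: colength_def)
  moreover have "1 \<notin> ?A" using \<open>v \<noteq> 0\<close> by simp
  then have "?A \<subset> UNIV" by blast
  ultimately obtain M where M: "?A \<subset> M" "\<forall>c\<in>m. \<forall>b\<in>M. c * b \<in> ?A"
    using ex_m_socle[OF module_times iA ideal_UNIV] by blast
  then obtain b where b: "b \<in> M" "b \<notin> ?A" by blast
  have "s c (s b v) = 0" if "c \<in> m" for c using M(2) b(1) that by simp
  then have "s b v = 0" using m_annihilated_eq_0 by blast
  then show False using b(2) by simp
qed

lemma ex_functional: "v \<noteq> 0 \<Longrightarrow> \<exists>f. module_hom s (*) f \<and> f v \<noteq> 0"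
  by (rule ex_nonzero_functional[OF module_s fin_gen_s]) (use torsion_free in blast)+

text \<open>Let \<open>M\<close> be the canonical module. For nonzero \<open>x\<close> in \<open>m\<close>, the socle of \<open>M / x M\<close> is an image of
  \<open>Ext\<^sup>1(k, M)\<close>. In a resolution \<open>F\<close> of \<open>k\<close>, let \<open>y\<close> be a lift to \<open>F\<^sub>1\<close> of
  \<open>x\<close> times an element of \<open>F\<^sub>0\<close> over \<open>1\<close>. A cocycle \<open>\<psi>\<close>, as a homomorphism on the image of \<open>F\<^sub>1\<close>, is
  sent to its value at the image of \<open>y\<close>. An element \<open>u\<close> with \<open>m u \<subseteq> x M\<close> comes from the cocycle whose
  value at the \<open>l\<close>-th basis vector is \<open>a u / x\<close>, where \<open>a\<close> is the image of that vector in \<open>m\<close>.\<close>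

theorem socle_mod_length_le_1:
  assumes x: "x \<in> m" "x \<noteq> 0"
  shows "quot_length s {u. \<forall>c\<in>m. s c u \<in> range (s x)} (range (s x)) \<le> 1"
proof -
  interpret module s by (rule module_s)
  obtain r w d where lift: "\<And>v. v \<in> vecs (r 0) \<Longrightarrow> (\<Sum>j<r 0. v j * w j) \<in> m \<Longrightarrow>
       \<exists>y\<in>vecs (r 1). v = mat_map (*) (d 0) (r 0) (r 1) y"
    and one: "\<exists>v\<in>vecs (r 0). (\<Sum>j<r 0. v j * w j) = (1::'a)"
    and col: "\<And>l. l < r 1 \<Longrightarrow> (\<Sum>j<r 0. d 0 j l * w j) \<in> m"
    and dd: "\<And>j p. j < r 0 \<Longrightarrow> p < r 2 \<Longrightarrow> (\<Sum>l<r 1. d 0 j l * d 1 l p) = 0"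
    and ext: "ext_length s r d 1 = 1"
    by (rule resolution_entries) blast
  obtain v where v: "v \<in> vecs (r 0)" "(\<Sum>j<r 0. v j * w j) = 1" using one by blast
  have "(\<lambda>j. x * v j) \<in> vecs (r 0)" using v(1) by (simp add: vecs_def)
  moreover have "(\<Sum>j<r 0. x * v j * w j) = x"
    using v(2) by (simp add: mult.assoc flip: sum_distrib_left)
  ultimately obtain y where y: "(\<lambda>j. x * v j) = mat_map (*) (d 0) (r 0) (r 1) y"
    using lift[of "\<lambda>j. x * v j"] x(1) by auto
  have y_eq: "(\<Sum>l<r 1. d 0 j l * y l) = x * v j" if "j < r 0" for j
    using fun_cong[OF y, of j] that by (simp add: mat_map_def)
  define \<Psi> where "\<Psi> = (\<lambda>\<psi>. \<Sum>l<r 1. s (y l) (\<psi> l))"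
  have hom: "module_hom (vec_scale s) s \<Psi>"
    unfolding module_hom_iff
  proof (intro conjI allI module_vec_scale module_s)
    show "\<Psi> (\<psi> + \<psi>') = \<Psi> \<psi> + \<Psi> \<psi>'" for \<psi> \<psi>'
      by (simp add: \<Psi>_def scale_right_distrib sum.distrib)
    show "\<Psi> (vec_scale s c \<psi>) = s c (\<Psi> \<psi>)" for c \<psi>
      by (simp add: \<Psi>_def vec_scale_def scale_sum_right mult.commute)
  qed
  let ?S = "{u. \<forall>c\<in>m. s c u \<in> range (s x)}"
  have "quot_length s ?S (range (s x)) \<le> quot_length (vec_scale s) (cocycles s r d 1) (coboundaries s r d 1)"
  proof (rule module_hom.len_le_of_surj[OF hom subspace_cocycles])
    show "coboundaries s r d 1 \<subseteq> cocycles s r d 1"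
    proof
      fix \<psi> assume "\<psi> \<in> coboundaries s r d 1"
      then obtain \<chi> where \<psi>: "\<psi> = hom_diff s r d 0 \<chi>" by (auto simp: coboundaries_def)
      have "hom_diff s r d 1 \<psi> = 0"
      proof
        fix p
        show "hom_diff s r d 1 \<psi> p = 0 p"
        proof (cases "p < r 2")
          case True
          have "(\<Sum>l<r 1. s (d 1 l p) (\<psi> l)) = (\<Sum>l<r 1. \<Sum>j<r 0. s (d 0 j l * d 1 l p) (\<chi> j))"
            by (simp add: \<psi> hom_diff_apply scale_sum_right mult.commute)
          also have "\<dots> = (\<Sum>j<r 0. \<Sum>l<r 1. s (d 0 j l * d 1 l p) (\<chi> j))" by (rule sum.swap)
          also have "\<dots> = (\<Sum>j<r 0. s (\<Sum>l<r 1. d 0 j l * d 1 l p) (\<chi> j))"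
            by (simp only: scale_sum_left)
          also have "\<dots> = 0" using dd True by simp
          finally show ?thesis by (simp add: hom_diff_apply)
        qed (simp add: hom_diff_apply numeral_2_eq_2)
      qed
      moreover have "\<psi> \<in> vecs (r 1)" by (simp add: \<psi> hom_diff_apply vecs_def)
      ultimately show "\<psi> \<in> cocycles s r d 1" by (simp add: cocycles_def)
    qed
    show "\<Psi> ` coboundaries s r d 1 \<subseteq> range (s x)"
    proof
      fix z assume "z \<in> \<Psi> ` coboundaries s r d 1"
      then obtain \<chi> where z: "z = \<Psi> (hom_diff s r d 0 \<chi>)" by (auto simp: coboundaries_def)
      have "z = (\<Sum>l<r 1. \<Sum>j<r 0. s (d 0 j l * y l) (\<chi> j))"
        by (simp add: z \<Psi>_def hom_diff_apply scale_sum_right mult.commute)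
      also have "\<dots> = (\<Sum>j<r 0. \<Sum>l<r 1. s (d 0 j l * y l) (\<chi> j))" by (rule sum.swap)
      also have "\<dots> = (\<Sum>j<r 0. s (\<Sum>l<r 1. d 0 j l * y l) (\<chi> j))" by (simp only: scale_sum_left)
      also have "\<dots> = s x (\<Sum>j<r 0. s (v j) (\<chi> j))" by (simp add: y_eq[unfolded One_nat_def] scale_sum_right)
      finally show "z \<in> range (s x)" by blast
    qed
    show "?S \<subseteq> \<Psi> ` cocycles s r d 1 + range (s x)"
    proof
      fix u assume "u \<in> ?S"
      then have u: "\<And>c. c \<in> m \<Longrightarrow> \<exists>b. s c u = s x b" by blast
      have "\<exists>\<psi>. \<forall>l. (l < r 1 \<longrightarrow> s x (\<psi> l) = s (\<Sum>j<r 0. d 0 j l * w j) u) \<and> (\<not> l < r 1 \<longrightarrow> \<psi> l = 0)"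
      proof (rule choice, rule allI)
        fix l
        show "\<exists>b. (l < r 1 \<longrightarrow> s x b = s (\<Sum>j<r 0. d 0 j l * w j) u) \<and> (\<not> l < r 1 \<longrightarrow> b = 0)"
        proof (cases "l < r 1")
          case True
          then obtain b where "s (\<Sum>j<r 0. d 0 j l * w j) u = s x b" using u[OF col] by blast
          then show ?thesis using True by (intro exI[of _ b]) simp
        qed simp
      qed
      then obtain \<psi> where \<psi>: "\<And>l. l < r 1 \<Longrightarrow> s x (\<psi> l) = s (\<Sum>j<r 0. d 0 j l * w j) u"
        and \<psi>0: "\<And>l. \<not> l < r 1 \<Longrightarrow> \<psi> l = 0" by blast
      have x_sum: "s x (\<Sum>l<r 1. s (a l) (\<psi> l)) = s (\<Sum>j<r 0. (\<Sum>l<r 1. d 0 j l * a l) * w j) u" for a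
      proof -
        have "s x (\<Sum>l<r 1. s (a l) (\<psi> l)) = (\<Sum>l<r 1. s (a l) (s x (\<psi> l)))"
          by (simp add: scale_sum_right mult.commute)
        also have "\<dots> = (\<Sum>l<r 1. s (a l) (s (\<Sum>j<r 0. d 0 j l * w j) u))" by (simp add: \<psi>)
        also have "\<dots> = s (\<Sum>l<r 1. a l * (\<Sum>j<r 0. d 0 j l * w j)) u" 
          by (simp only: scale_scale scale_sum_left[of "\<lambda>l. a l * (\<Sum>j<r 0. d 0 j l * w j)"])
        also have "(\<Sum>l<r 1. a l * (\<Sum>j<r 0. d 0 j l * w j)) = (\<Sum>l<r 1. \<Sum>j<r 0. d 0 j l * a l * w j)"
          by (simp add: sum_distrib_left ac_simps)
        also have "\<dots> = (\<Sum>j<r 0. \<Sum>l<r 1. d 0 j l * a l * w j)" by (rule sum.swap)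
        also have "\<dots> = (\<Sum>j<r 0. (\<Sum>l<r 1. d 0 j l * a l) * w j)" by (simp only: sum_distrib_right)
        finally show ?thesis .
      qed
      have cancel: "b = b'" if "s x b = s x b'" for b b'
      proof -
        have "s x (b - b') = 0" using that by (simp add: scale_right_diff_distrib)
        then have "b - b' = 0" by (rule torsion_free[OF _ x(2)])
        then show ?thesis by simp
      qed
      have "hom_diff s r d 1 \<psi> = 0"
      proof
        fix p
        show "hom_diff s r d 1 \<psi> p = 0 p"
        proof (cases "p < r 2")
          case True
          have "s x (\<Sum>l<r 1. s (d 1 l p) (\<psi> l)) = s (\<Sum>j<r 0. (\<Sum>l<r 1. d 0 j l * d 1 l p) * w j) u"
            by (rule x_sum)
          also have "\<dots> = s x 0" using dd True by simp
          finally have "(\<Sum>l<r 1. s (d 1 l p) (\<psi> l)) = 0" by (rule cancel)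
          then show ?thesis by (simp add: hom_diff_apply)
        qed (simp add: hom_diff_apply numeral_2_eq_2)
      qed
      moreover have "\<psi> \<in> vecs (r 1)" using \<psi>0 by (simp add: vecs_def)
      ultimately have coc: "\<psi> \<in> cocycles s r d 1" by (simp add: cocycles_def)
      have "s x (\<Psi> \<psi>) = s (\<Sum>j<r 0. (\<Sum>l<r 1. d 0 j l * y l) * w j) u" unfolding \<Psi>_def by (rule x_sum)
      also have "(\<Sum>j<r 0. (\<Sum>l<r 1. d 0 j l * y l) * w j) = x * (\<Sum>j<r 0. v j * w j)"
        by (simp add: y_eq[unfolded One_nat_def] sum_distrib_left mult.assoc)
      also have "s \<dots> u = s x u" using v(2) by simp
      finally have "\<Psi> \<psi> = u" by (rule cancel)
      moreover have "0 \<in> range (s x)" by (rule range_eqI[of _ _ 0]) simp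
      ultimately show "u \<in> \<Psi> ` cocycles s r d 1 + range (s x)"
        using coc set_plus_intro[of "\<Psi> \<psi>" "\<Psi> ` cocycles s r d 1" 0 "range (s x)"] by auto
    qed
  qed
  then show ?thesis using ext by (simp add: ext_length_def)
qed

text \<open>The pairing of \<open>R\<close> with \<open>M\<close> bounds the length of \<open>M / x M\<close> by that of \<open>R / x R\<close>. The image of
  \<open>M\<close> under a nonzero functional already accounts for all of it, so that the kernel lies in \<open>x M\<close>; being
  divisible by \<open>x\<close>, it lies in all \<open>x\<^sup>n M\<close>, and is then annihilated by every functional.\<close>

theorem nonzero_functional_inj:
  assumes f: "module_hom s (*) f" and "f v \<noteq> 0"
  shows "inj f"
proof -
  interpret f: module_hom s "(*)" f by fact
  obtain x e where x: "x \<in> m" "x \<noteq> 0" "principal_colength x = enat e" using ex_parameter by blast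
  let ?xM = "range (s x)" and ?I = "range f"
  have hom_s: "module_hom s s (s c)" for c
    by (simp add: module_hom_iff module_s f.m1.scale_right_distrib mult.commute)
  have hom_s1: "module_hom (*) s (\<lambda>c. s c u)" for u
    by (simp add: module_hom_iff module_s module_times f.m1.scale_left_distrib)
  have s_xM: "f.m1.subspace ?xM"
    by (rule module_hom.subspace_image[OF hom_s f.m1.subspace_UNIV])
  have "quot_length s {u. \<forall>b\<in>range ((*) x). s b u \<in> ?xM} {u. \<forall>b\<in>UNIV. s b u \<in> ?xM}
      \<le> quot_length (*) UNIV (range ((*) x))"
    by (rule pairing_length_le[OF hom_s1 hom_s s_xM socle_mod_length_le_1[OF x(1,2)]
          ideal_UNIV principal_ideal subset_UNIV])
  moreover have "s (x * b) u \<in> ?xM" for b u by (metis f.m1.scale_scale rangeI)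
  then have "{u. \<forall>b\<in>range ((*) x). s b u \<in> ?xM} = UNIV" by blast
  moreover have "{u. \<forall>b\<in>UNIV. s b u \<in> ?xM} = ?xM"
  proof (intro antisym subsetI)
    fix u assume "u \<in> {u. \<forall>b\<in>UNIV. s b u \<in> ?xM}"
    then have "s 1 u \<in> ?xM" by blast
    then show "u \<in> ?xM" by simp
  qed (use f.m1.subspace_scale[OF s_xM] in simp)
  ultimately have le_e: "quot_length s UNIV ?xM \<le> enat e" using x(3) by (simp add: colength_def)
  have iI: "is_ideal ?I" by (rule f.subspace_image[OF f.m1.subspace_UNIV])
  let ?xI = "(*) x ` ?I"
  have hom_x: "module_hom (*) (*) ((*) x)" by (rule module_hom_times)
  have ixI: "is_ideal ?xI" by (rule module_hom.subspace_image[OF hom_x iI])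
  have xII: "?xI \<subseteq> ?I" using ideal_scale[OF iI] by blast
  have len_I: "quot_length (*) ?I ?xI = enat e"
  proof -
    have "to_fract ` ?I \<noteq> {0}" using \<open>f v \<noteq> 0\<close> by (metis imageI rangeI singletonD to_fract_eq_0_iff)
    moreover have "fractional (to_fract ` ?I)" unfolding fractional_def by (rule exI[of _ 1]) auto
    ultimately have "fract_length (to_fract ` ?I) ((*) (to_fract x) ` to_fract ` ?I) = enat e"
      using fract_length_times_self[OF fract_submodule_image[OF iI]] x by simp
    moreover have "(*) (to_fract x) ` to_fract ` ?I = to_fract ` ?xI" by (simp add: image_image)
    ultimately show ?thesis using fract_length_to_fract[OF iI ixI xII] by simp
  qed
  let ?V = "f -` ?xI"
  have sV: "f.m1.subspace ?V" by (rule f.subspace_vimage[OF ixI])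
  have "enat e \<le> quot_length s UNIV ?V"
    unfolding len_I[symmetric]
  proof (rule f.len_le_of_surj)
    show "?I \<subseteq> range f + ?xI" by (rule f.m2.subset_set_plus1[OF ideal_0[OF ixI]])
  qed auto
  moreover have "f (s x b) \<in> ?xI" for b unfolding f.scale by (intro imageI rangeI)
  then have "?xM \<subseteq> ?V" by blast
  moreover have "quot_length s UNIV ?xM = quot_length s UNIV ?V + quot_length s ?V ?xM"
    by (rule f.m1.len_additive[OF s_xM sV f.m1.subspace_UNIV \<open>?xM \<subseteq> ?V\<close> subset_UNIV])
  ultimately have "enat e + quot_length s ?V ?xM \<le> enat e" using le_e
    by (metis add_right_mono order_trans)
  then have "quot_length s ?V ?xM = 0" by (cases "quot_length s ?V ?xM") (auto simp: enat_0_iff)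
  then have "?V = ?xM" using f.m1.len_eq_0_iff[OF s_xM sV \<open>?xM \<subseteq> ?V\<close>] by simp
  then have divisible: "\<exists>b. f b = 0 \<and> a = s x b" if "f a = 0" for a
  proof -
    have "f a \<in> ?xI" using that ideal_0[OF ixI] by simp
    then obtain b where b: "a = s x b" using \<open>?V = ?xM\<close> by blast
    then have "x * f b = 0" using that f.scale by metis
    then show ?thesis using b x(2) by auto
  qed
  have powers: "\<exists>b. f b = 0 \<and> a = s (x ^ n) b" if "f a = 0" for a n
  proof (induction n)
    case 0
    then show ?case using that by simp
  next
    case (Suc n)
    then obtain b where b: "f b = 0" "a = s (x ^ n) b" by blast
    obtain c where c: "f c = 0" "b = s x c" using divisible[OF b(1)] by blast
    have "a = s (x ^ Suc n) c" using b(2) c(2) by (simp add: mult.commute)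
    then show ?case using c(1) by blast
  qed
  have "a = 0" if a: "f a = 0" for a
  proof (rule ccontr)
    assume "a \<noteq> 0"
    then obtain g where g: "module_hom s (*) g" "g a \<noteq> 0"
      using ex_functional by blast
    have "g a \<in> range ((*) (x ^ n))" for n
    proof -
      obtain b where "a = s (x ^ n) b" using powers[OF a] by blast
      then have "g a = x ^ n * g b" using module_hom.scale[OF g(1)] by simp
      then show ?thesis by blast
    qed
    then have "g a = 0" by (rule Inter_principal_powers[OF x(1)])
    then show False using g(2) by simp
  qed
  then show ?thesis unfolding f.inj_iff_eq_0 by blast
qed

end

section \<open>Duality and multiplicity\<close>

lemma module_hom_fract_times_left: "module_hom fract_scale fract_scale (\<lambda>a. a * u)"
  by (simp add: module_hom_iff module_fract_scale fract_scale_def algebra_simps)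

lemma enat_le_add_eq:
  fixes a b c d :: enat
  assumes "a + b = c + d" "a \<le> c" "b \<le> d" "c + d \<noteq> \<infinity>"
  shows "a = c"
  using assms by (cases a; cases b; cases c; cases d) auto

context one_dim_local_domain
begin

definition colon :: "'a fract set \<Rightarrow> 'a fract set \<Rightarrow> 'a fract set" where
  "colon K A = {q. \<forall>a\<in>A. a * q \<in> K}"

lemma fract_submodule_colon:
  assumes "fract_submodule K"
  shows "fract_submodule (colon K A)"
proof -
  have "colon K A = (\<Inter>a\<in>A. (*) a -` K)" by (auto simp: colon_def)
  moreover have "fract_submodule (\<Inter>a\<in>A. (*) a -` K)"
    by (rule module.subspace_Int[OF module_fract_scale])
       (rule module_hom.subspace_vimage[OF module_hom_fract_times assms])
  ultimately show ?thesis by simp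
qed

lemma colon_antimono: "A \<subseteq> B \<Longrightarrow> colon K B \<subseteq> colon K A"
  by (auto simp: colon_def)

lemma colon_range:
  assumes "fract_submodule K"
  shows "colon K (range to_fract) = K"
proof (intro antisym subsetI)
  fix q assume "q \<in> colon K (range to_fract)"
  then have "to_fract 1 * q \<in> K" unfolding colon_def by blast
  then show "q \<in> K" by simp
qed (use fract_smult[OF assms] in \<open>auto simp: colon_def\<close>)

text \<open>The bound \<open>\<lambda>((K : B) / (K : A)) \<le> \<lambda>(A / B)\<close> is an equality for the pair \<open>d\<^sup>-\<^sup>1 R \<supseteq> R\<close>, by the
  invariance of the length of \<open>K / d K\<close>. Inserting \<open>A\<close> between the two gives two bounds whose sum is an
  equality.\<close>

theorem fract_length_colon:
  fixes K A :: "'a fract set"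
  assumes K: "fract_submodule K" "fractional K" "K \<noteq> {0}"
    and socle: "fract_length {q. \<forall>r\<in>m. fract_scale r q \<in> K} K \<le> 1"
    and A: "fract_submodule A" "fractional A" "range to_fract \<subseteq> A"
  shows "fract_length K (colon K A) = fract_length A (range to_fract)"
proof -
  let ?R = "range to_fract :: 'a fract set"
  have le: "fract_length (colon K Y) (colon K X) \<le> fract_length X Y"
    if "fract_submodule X" "fract_submodule Y" "Y \<subseteq> X" for X Y
    unfolding colon_def
    by (rule pairing_length_le[OF module_hom_fract_times_left module_hom_fract_times K(1) socle that])
  obtain d where d: "d \<noteq> 0" "\<forall>q\<in>A. to_fract d * q \<in> ?R" using A(2) unfolding fractional_def by blast
  let ?d = "to_fract d"
  have d0: "?d \<noteq> 0" using d(1) by simp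
  \<comment> \<open>The fractional ideal \<open>d\<^sup>-\<^sup>1 R\<close>.\<close>
  define P where "P = (*) (inverse ?d) ` ?R"
  have sP: "fract_submodule P" unfolding P_def by (rule fract_submodule_times[OF fract_submodule_range])
  have dP: "(*) ?d ` P = ?R" unfolding P_def times_times_image using d0 by simp
  have AP: "A \<subseteq> P"
  proof
    fix a assume "a \<in> A"
    then have "inverse ?d * (?d * a) \<in> P" unfolding P_def using d(2) by blast
    then show "a \<in> P" using d0 by (simp flip: mult.assoc)
  qed
  have colon_P: "colon K P = (*) ?d ` K"
  proof (intro antisym subsetI)
    fix q assume "q \<in> colon K P"
    moreover have "inverse ?d * to_fract 1 \<in> P" unfolding P_def by blast
    ultimately have "inverse ?d * q \<in> K" unfolding colon_def by simp
    then have "?d * (inverse ?d * q) \<in> (*) ?d ` K" by (rule imageI)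
    then show "q \<in> (*) ?d ` K" using d0 by (simp flip: mult.assoc)
  next
    fix q assume "q \<in> (*) ?d ` K"
    then obtain k where k: "q = ?d * k" "k \<in> K" by blast
    have "a * q \<in> K" if "a \<in> P" for a
    proof -
      obtain r where "a = inverse ?d * to_fract r" using \<open>a \<in> P\<close> unfolding P_def by blast
      then have "a * q = to_fract r * k" using d0 k(1) by simp
      then show ?thesis using fract_smult[OF K(1) k(2)] by simp
    qed
    then show "q \<in> colon K P" unfolding colon_def by blast
  qed
  have KK: "(*) ?d ` K \<subseteq> K" using fract_smult[OF K(1)] by blast
  have RP: "?R \<subseteq> P" using A(3) AP by (rule order_trans)
  have "fract_length P ?R = fract_length ?R ((*) ?d ` ?R)"
    using fract_length_times[OF sP fract_submodule_range RP d0] dP by simp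
  also have "\<dots> = fract_length K ((*) ?d ` K)"
    using fract_length_times_self[OF K d(1)] by (simp only: fract_length_principal)
  finally have total: "fract_length K ((*) ?d ` K) = fract_length P ?R" by simp
  have fin: "fract_length P ?R \<noteq> \<infinity>"
    unfolding total[symmetric] fract_length_times_self[OF K d(1)] by (rule principal_colength_finite[OF d(1)])
  have split_P: "fract_length P ?R = fract_length P A + fract_length A ?R"
    by (rule fract_len_additive[OF fract_submodule_range A(1) sP A(3) AP])
  have "colon K P \<subseteq> colon K A" using AP by (rule colon_antimono)
  moreover have AK: "colon K A \<subseteq> K" using colon_antimono[OF A(3)] colon_range[OF K(1)] by blast
  ultimately have split_K: "fract_length K ((*) ?d ` K)
      = fract_length K (colon K A) + fract_length (colon K A) ((*) ?d ` K)"
    using fract_submodule_colon[OF K(1)] colon_P fract_submodule_times[OF K(1)] K(1)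
    by (intro fract_len_additive) auto
  have 1: "fract_length K (colon K A) \<le> fract_length A ?R"
    using le[OF A(1) fract_submodule_range A(3)] colon_range[OF K(1)] by simp
  have 2: "fract_length (colon K A) ((*) ?d ` K) \<le> fract_length P A"
    using le[OF sP A(1) AP] colon_P by simp
  show ?thesis
  proof (rule enat_le_add_eq[OF _ 1 2])
    show "fract_length K (colon K A) + fract_length (colon K A) ((*) ?d ` K)
        = fract_length A ?R + fract_length P A"
      using split_P split_K total by (simp add: add.commute)
    show "fract_length A ?R + fract_length P A \<noteq> \<infinity>" using fin split_P by (simp add: add.commute)
  qed
qed

text \<open>Since \<open>K : (K : K) = K\<close>, duality applied to \<open>K : K\<close> gives \<open>K : K = R\<close>. Hence \<open>K : B\<close>, being a
  \<open>B\<close>-module contained in \<open>K : K\<close>, is the conductor, and the claim is duality applied to \<open>B\<close>.\<close>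

theorem integral_closure_length:
  fixes K :: "'a fract set"
  assumes fin: "fractional (integral_closure :: 'a fract set)"
    and K: "fract_submodule K" "1 \<in> K" "K \<subseteq> integral_closure"
    and socle: "fract_length {q. \<forall>r\<in>m. fract_scale r q \<in> K} K \<le> 1"
  shows "fract_length (integral_closure :: 'a fract set) (range to_fract)
    = fract_length K (range to_fract) + fract_length (range to_fract) (conductor :: 'a fract set)"
proof -
  let ?R = "range to_fract :: 'a fract set" and ?B = "integral_closure :: 'a fract set"
  have fK: "fractional K" using fin K(3) by (rule fractional_subset)
  have K0: "K \<noteq> {0}" using K(2) by (metis singletonD zero_neq_one)
  have RK: "?R \<subseteq> K"
  proof
    fix z assume "z \<in> ?R"
    then obtain r where "z = to_fract r * 1" by auto
    then show "z \<in> K" using fract_smult[OF K(1,2)] by simp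
  qed
  have RB: "?R \<subseteq> ?B" using to_fract_integral by blast
  note duality = fract_length_colon[OF K(1) fK K0 socle]
  have endo: "colon K K = ?R"
  proof -
    let ?E = "colon K K"
    have sE: "fract_submodule ?E" by (rule fract_submodule_colon[OF K(1)])
    have EK: "?E \<subseteq> K"
    proof
      fix q assume "q \<in> ?E"
      then have "1 * q \<in> K" using K(2) unfolding colon_def by blast
      then show "q \<in> K" by simp
    qed
    have RE: "?R \<subseteq> ?E" using fract_smult[OF K(1)] by (auto simp: colon_def mult.commute)
    have "colon K ?E = K"
    proof
      show "colon K ?E \<subseteq> K" using colon_antimono[OF RE, of K] colon_range[OF K(1)] by simp
      show "K \<subseteq> colon K ?E" by (auto simp: colon_def mult.commute)
    qed
    then have "fract_length ?E ?R = 0"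
      using duality[OF sE fractional_subset[OF fK EK] RE] by (simp add: fract_len_self)
    then show ?thesis using fract_len_eq_0_iff[OF fract_submodule_range sE RE] by simp
  qed
  have cond: "colon K ?B = conductor"
  proof (intro antisym subsetI)
    fix q assume q: "q \<in> colon K ?B"
    have "q * b \<in> ?R" if "b \<in> ?B" for b
    proof -
      have "k * (q * b) \<in> K" if "k \<in> K" for k
      proof -
        have "k * b \<in> ?B" using \<open>k \<in> K\<close> K(3) \<open>b \<in> ?B\<close> integral_closure_mult by blast
        then have "(k * b) * q \<in> K" using q unfolding colon_def by blast
        then show ?thesis by (simp add: ac_simps)
      qed
      then have "q * b \<in> colon K K" unfolding colon_def by blast
      then show ?thesis using endo by simp
    qed
    then show "q \<in> conductor" unfolding conductor_def by blast
  next
    fix q :: "'a fract" assume q: "q \<in> conductor"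
    have "b * q \<in> K" if "b \<in> ?B" for b
    proof -
      have "q * b \<in> ?R" using q \<open>b \<in> ?B\<close> unfolding conductor_def by blast
      then show ?thesis using RK by (metis mult.commute subsetD)
    qed
    then show "q \<in> colon K ?B" unfolding colon_def by blast
  qed
  have CR: "(conductor :: 'a fract set) \<subseteq> ?R"
  proof
    fix q :: "'a fract" assume "q \<in> conductor"
    then have "q * to_fract 1 \<in> ?R" using to_fract_integral unfolding conductor_def by blast
    then show "q \<in> ?R" by simp
  qed
  have "fract_length ?B ?R = fract_length K conductor"
    using duality[OF fract_submodule_integral_closure fin RB] cond by simp
  also have "\<dots> = fract_length K ?R + fract_length ?R conductor"
    using fract_submodule_colon[OF K(1), of ?B] cond
    by (intro fract_len_additive[OF _ fract_submodule_range K(1) CR RK]) simp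
  finally show ?thesis .
qed

text \<open>If \<open>J \<subseteq> x B\<close> with \<open>x\<close> in \<open>J\<close>, then \<open>x\<^sup>n R \<subseteq> J\<^sup>n \<subseteq> x\<^sup>n B\<close>, so that the colengths of \<open>J\<^sup>n\<close>
  and of \<open>x\<^sup>n R\<close> differ by at most the length of \<open>B / R\<close>.\<close>

lemma colength_ideal_power_bounds:
  fixes J :: "'a set"
  assumes x: "x \<in> J" "x \<noteq> 0" and e: "principal_colength x = enat e"
    and sub: "J \<subseteq> integral_part x"
    and l: "fract_length integral_closure (range to_fract :: 'a fract set) = enat l"
  shows "\<exists>k. colength (ideal_power J n) = enat k \<and> k \<le> n * e \<and> n * e \<le> k + l"
proof -
  let ?R = "range to_fract :: 'a fract set" and ?B = "integral_closure :: 'a fract set"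
  let ?J = "ideal_power J n"
  have xn: "x ^ n \<noteq> 0" using x(2) by simp
  have "?J \<subseteq> integral_part (x ^ n)"
  proof (induction n)
    case 0
    show ?case using principal_subset_integral_part[of 1] by simp
  next
    case (Suc n)
    have "{a * b |a b. a \<in> J \<and> b \<in> ideal_power J n} \<subseteq> integral_part (x ^ Suc n)"
    proof
      fix z assume "z \<in> {a * b |a b. a \<in> J \<and> b \<in> ideal_power J n}"
      then obtain a b where z: "z = a * b" "a \<in> integral_part x" "b \<in> integral_part (x ^ n)"
        using sub Suc by blast
      obtain u where u: "to_fract a = to_fract x * u" "u \<in> ?B" using z(2) by (rule integral_partE)
      obtain v where v: "to_fract b = to_fract (x ^ n) * v" "v \<in> ?B" using z(3) by (rule integral_partE)
      have "to_fract z = to_fract (x ^ Suc n) * (u * v)" using u(1) v(1) z(1) by (simp add: ac_simps)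
      then show "z \<in> integral_part (x ^ Suc n)" by (rule integral_partI[OF _ integral_closure_mult[OF u(2) v(2)]])
    qed
    then show ?case
      unfolding ideal_power.simps ideal_mult_def
      by (rule module.span_minimal[OF module_times _ is_ideal_integral_part])
  qed
  moreover have xJ: "range ((*) (x ^ n)) \<subseteq> ?J"
    by (rule principal_subset_ideal[OF is_ideal_power power_in_ideal_power[OF x(1)]])
  have "quot_length (*) ?J (range ((*) (x ^ n))) \<le> enat l"
  proof -
    have "quot_length (*) ?J (range ((*) (x ^ n))) = fract_length (to_fract ` ?J) (to_fract ` range ((*) (x ^ n)))"
      by (rule fract_length_to_fract[OF is_ideal_power principal_ideal xJ, symmetric])
    also have "\<dots> \<le> fract_length ((*) (to_fract (x ^ n)) ` ?B) ((*) (to_fract (x ^ n)) ` ?R)"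
      unfolding to_fract_times_image
      by (rule fract_len_mono) (use calculation(1) \<open>?J \<subseteq> integral_part (x ^ n)\<close> in \<open>auto simp: integral_part_def\<close>)
    also have "\<dots> = enat l"
      using fract_length_times[OF fract_submodule_integral_closure fract_submodule_range _, of "to_fract (x ^ n)"]
        to_fract_integral l xn by (metis image_subset_iff to_fract_eq_0_iff)
    finally show ?thesis .
  qed
  moreover have "enat (n * e) = colength ?J + quot_length (*) ?J (range ((*) (x ^ n)))"
    unfolding principal_colength_power[OF x(2) e, symmetric] unfolding colength_def
    by (rule module.len_additive[OF module_times principal_ideal is_ideal_power ideal_UNIV xJ subset_UNIV])
  ultimately show ?thesis
    by (cases "colength ?J"; cases "quot_length (*) ?J (range ((*) (x ^ n)))") auto
qed

theorem hs_mult_eq_principal_colength: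
  fixes J :: "'a set"
  assumes x: "x \<in> J" "x \<noteq> 0" and e: "principal_colength x = enat e"
    and sub: "J \<subseteq> integral_part x"
    and fin: "fract_length integral_closure (range to_fract :: 'a fract set) \<noteq> \<infinity>"
  shows "hs_mult J = real e"
proof -
  obtain l where l: "fract_length integral_closure (range to_fract :: 'a fract set) = enat l" using fin by auto
  let ?a = "\<lambda>n. real (the_enat (colength (ideal_power J n)))"
  have bounds: "?a n \<le> real n * real e" "real n * real e \<le> ?a n + real l" for n
  proof -
    obtain k where k: "colength (ideal_power J n) = enat k" "k \<le> n * e" "n * e \<le> k + l"
      using colength_ideal_power_bounds[OF x e sub l] by blast
    have "real k \<le> real (n * e)" "real (n * e) \<le> real (k + l)" using k(2,3) by (simp_all only: of_nat_le_iff)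
    then show "?a n \<le> real n * real e" "real n * real e \<le> ?a n + real l" using k(1) by simp_all
  qed
  have "(\<lambda>n. ?a n / real n) \<longlonglongrightarrow> real e"
  proof (rule tendsto_sandwich)
    have "(\<lambda>n. real e - real l * (1 / real n)) \<longlonglongrightarrow> real e - real l * 0"
      by (intro tendsto_intros lim_1_over_n)
    then show "(\<lambda>n. real e - real l / real n) \<longlonglongrightarrow> real e" by simp
    show "\<forall>\<^sub>F n in sequentially. real e - real l / real n \<le> ?a n / real n"
    proof (rule eventually_sequentiallyI[of 1])
      fix n :: nat assume "1 \<le> n"
      moreover have "real n * real e / real n \<le> (?a n + real l) / real n"
        by (rule divide_right_mono[OF bounds(2)]) simp
      ultimately show "real e - real l / real n \<le> ?a n / real n" by (simp add: add_divide_distrib)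
    qed
    show "\<forall>\<^sub>F n in sequentially. ?a n / real n \<le> real e"
    proof (rule eventually_sequentiallyI[of 1])
      fix n :: nat assume "1 \<le> n"
      then show "?a n / real n \<le> real e" using bounds(1)[of n] by (simp add: field_simps)
    qed
  qed simp
  then have "lim (\<lambda>n. ?a n / real n) = real e" by (rule limI)
  moreover have "the_enat (krull_dim TYPE('a)) = 1" using dim_1 by (simp add: one_enat_def)
  ultimately show ?thesis by (simp add: hs_mult_def)
qed

text \<open>The ideals \<open>x\<^sup>n R\<close> have unbounded colength.\<close>

lemma colength_0: "colength {0::'a} = \<infinity>"
proof (rule ccontr)
  assume "colength {0::'a} \<noteq> \<infinity>"
  then obtain k where k: "colength {0::'a} = enat k" by auto
  obtain x e where x: "x \<in> m" "x \<noteq> 0" "principal_colength x = enat e" using ex_parameter by blast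
  have "1 \<noteq> x * c" for c using ideal_scale_right[OF ideal_m x(1), of c] one_notin_m by auto
  then have "1 \<notin> range ((*) x)" by blast
  then have "range ((*) x) \<subset> UNIV" by blast
  then have "1 \<le> principal_colength x"
    unfolding colength_def by (rule module.len_proper[OF module_times principal_ideal ideal_UNIV])
  then have "1 \<le> e" using x(3) by (simp add: one_enat_def)
  have "enat (Suc k * e) \<le> colength {0::'a}"
    unfolding principal_colength_power[OF x(2,3), symmetric] unfolding colength_def
    by (rule module.len_mono[OF module_times]) (use ideal_0[OF principal_ideal] in auto)
  then have "Suc k * e \<le> k" using k by simp
  moreover have "Suc k * 1 \<le> Suc k * e" using \<open>1 \<le> e\<close> by (rule mult_le_mono2)
  ultimately show False by simp
qed

end

section \<open>Partial trace ideals of the canonical module\<close>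

context local_domain_with_canonical_module
begin

text \<open>Division by \<open>x y\<close> carries the elements \<open>u\<close> with \<open>m u \<subseteq> x M\<close> onto \<open>K : m\<close>.\<close>

lemma socle_fract_length_le_1:
  fixes f :: "'b \<Rightarrow> 'a" and y :: "'a fract"
  assumes f: "module_hom s (*) f" "inj f" and y: "y \<noteq> 0"
  defines "K \<equiv> (*) (inverse y) ` to_fract ` range f"
  shows "fract_length {q. \<forall>r\<in>m. fract_scale r q \<in> K} K \<le> 1"
proof -
  obtain x where x: "x \<in> m" "x \<noteq> 0" using ex_nonzero_in_m by blast
  have x0: "to_fract x \<noteq> 0" using x(2) by simp
  define \<phi> where "\<phi> = (\<lambda>u. to_fract (f u) * inverse (to_fract x * y))"
  have hom: "module_hom s fract_scale \<phi>"
    by (simp add: module_hom_iff module_s module_fract_scale \<phi>_def fract_scale_def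
        module_hom.add[OF f(1)] module_hom.scale[OF f(1)] distrib_right mult.assoc)
  have hom_s: "module_hom s s (s c)" for c
    by (simp add: module_hom_iff module_s module.scale_right_distrib[OF module_s]
        module.scale_left_commute[OF module_s])
  let ?S = "{u. \<forall>c\<in>m. s c u \<in> range (s x)}"
  have s_xM: "module.subspace s (range (s x))"
    by (rule module_hom.subspace_image[OF hom_s module.subspace_UNIV[OF module_s]])
  have "fract_length {q. \<forall>r\<in>m. fract_scale r q \<in> K} K \<le> quot_length s ?S (range (s x))"
  proof (rule module_hom.len_le_of_surj[OF hom])
    have "?S = (\<Inter>c\<in>m. s c -` range (s x))" by auto
    moreover have "module.subspace s (\<Inter>c\<in>m. s c -` range (s x))"
      by (rule module.subspace_Int[OF module_s]) (rule module_hom.subspace_vimage[OF hom_s s_xM])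
    ultimately show "module.subspace s ?S" by simp
    show "range (s x) \<subseteq> ?S" using module.subspace_scale[OF module_s s_xM] by blast
    show "\<phi> ` range (s x) \<subseteq> K"
    proof
      fix z assume "z \<in> \<phi> ` range (s x)"
      then obtain u where "z = \<phi> (s x u)" by blast
      then have "z = inverse y * to_fract (f u)"
        using x0 y by (simp add: \<phi>_def module_hom.scale[OF f(1)] field_simps)
      then show "z \<in> K" unfolding K_def by blast
    qed
    show "{q. \<forall>r\<in>m. fract_scale r q \<in> K} \<subseteq> \<phi> ` ?S + K"
    proof
      fix q assume "q \<in> {q. \<forall>r\<in>m. fract_scale r q \<in> K}"
      then have q: "\<exists>w. to_fract r * q = inverse y * to_fract (f w)" if "r \<in> m" for r
        using that unfolding K_def fract_scale_def by blast
      obtain u where u: "to_fract x * q = inverse y * to_fract (f u)" using q[OF x(1)] by blast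
      have q_eq: "q = \<phi> u" using u x0 y by (simp add: \<phi>_def field_simps)
      have "s r u \<in> range (s x)" if r: "r \<in> m" for r
      proof -
        obtain w where w: "to_fract r * q = inverse y * to_fract (f w)" using q[OF r] by blast
        have "to_fract (f (s r u)) = to_fract x * y * (to_fract r * q)"
          using x0 y by (simp add: q_eq \<phi>_def module_hom.scale[OF f(1)] field_simps)
        also have "\<dots> = to_fract (f (s x w))"
          unfolding w using y by (simp add: module_hom.scale[OF f(1)])
        finally have "s r u = s x w" using f(2) by (simp add: inj_eq)
        then show ?thesis by blast
      qed
      then have "q \<in> \<phi> ` ?S" using q_eq by blast
      moreover have "0 \<in> K"
        unfolding K_def using module_hom.zero[OF f(1)] by (metis imageI mult_zero_right rangeI to_fract_0)
      ultimately show "q \<in> \<phi> ` ?S + K" using set_plus_intro[of q "\<phi> ` ?S" 0 K] by simp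
    qed
  qed
  also have "\<dots> \<le> 1" by (rule socle_mod_length_le_1[OF x])
  finally show ?thesis .
qed

lemma h_inv_attained_finite: "\<exists>J. partial_trace_ideal s J" "h_inv s \<noteq> \<infinity>"
proof -
  let ?A = "{colength J | J. is_ideal J \<and> (\<exists>f. module_hom s (*) f \<and> range f = J)}"
  obtain v :: 'b where "v \<noteq> 0" using nontrivial by blast
  then obtain f where f: "module_hom s (*) f" "f v \<noteq> 0"
    using ex_functional by blast
  have iJ: "is_ideal (range f)" by (rule module_hom.subspace_image[OF f(1) module.subspace_UNIV[OF module_s]])
  have "range f \<noteq> {0}" using f(2) by (metis rangeI singletonD)
  then have fin: "colength (range f) \<noteq> \<infinity>" by (rule colength_finite[OF iJ])
  have mem: "colength (range f) \<in> ?A" using iJ f(1) by blast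
  then have "?A \<noteq> {}" by blast
  then have "Inf ?A \<in> ?A" by (metis (mono_tags, lifting) Inf_enat_def LeastI ex_in_conv)
  then show "\<exists>J. partial_trace_ideal s J" unfolding partial_trace_ideal_def h_inv_def by fastforce
  have "h_inv s \<le> colength (range f)" unfolding h_inv_def using mem by (rule Inf_lower)
  then show "h_inv s \<noteq> \<infinity>" using fin by (metis enat_ord_simps(5))
qed

lemma min_gens_ge_1: "1 \<le> min_gens s"
proof (rule ccontr)
  assume "\<not> 1 \<le> min_gens s"
  then have "min_gens s = 0" by simp
  moreover have "\<exists>n S. finite S \<and> card S = n \<and> module.span s S = UNIV"
    using fin_gen_s unfolding fin_gen_def by blast
  then have "\<exists>S. finite S \<and> card S = min_gens s \<and> module.span s S = UNIV"
    unfolding min_gens_def by (rule LeastI_ex)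
  ultimately have "module.span s {} = UNIV" by auto
  then have "(UNIV :: 'b set) = {0}" by (simp add: module.span_empty[OF module_s])
  then show False using nontrivial by blast
qed

text \<open>For each partial trace ideal \<open>J\<close>, with \<open>K = J / x\<close>, both conditions say that \<open>K / R\<close> has length
  \<open>\<mu>(\<omega>) - 1\<close>.\<close>

theorem almost_gorenstein_iff_partial_trace:
  assumes inf: "infinite (residue_ring m)" and unram: "analytically_unramified m"
    and J: "partial_trace_ideal s J"
  shows "almost_gorenstein s \<longleftrightarrow>
    ereal_of_enat (h_inv s) = ereal (hs_mult J - real (min_gens s) + 1)"
proof -
  let ?R = "range to_fract :: 'a fract set" and ?B = "integral_closure :: 'a fract set"
  obtain f where iJ: "is_ideal J" and f: "module_hom s (*) f" "range f = J" and hJ: "colength J = h_inv s"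
    using J unfolding partial_trace_ideal_def by blast
  have "J \<noteq> {0}" using hJ h_inv_attained_finite(2) colength_0 by auto
  then obtain v where "f v \<noteq> 0" using f(2) ideal_0[OF iJ] by (metis rangeE singletonD singletonI subsetI subset_antisym empty_subsetI insert_subset)
  then have "inj f" by (rule nonzero_functional_inj[OF f(1)])
  obtain x where x: "x \<in> J" "\<forall>y\<in>J. \<exists>w\<in>integral_closure. to_fract y = to_fract x * w"
    using ex_principal_reduction[OF inf iJ] by blast
  have xJ: "J \<subseteq> integral_part x" using x(2) integral_partI by blast
  have "x \<noteq> 0"
  proof
    assume "x = 0"
    then have "J \<subseteq> {0}" using x(2) by auto
    then show False using \<open>J \<noteq> {0}\<close> ideal_0[OF iJ] by blast
  qed
  let ?x = "to_fract x"
  have x0: "?x \<noteq> 0" using \<open>x \<noteq> 0\<close> by simp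
  define K where "K = (*) (inverse ?x) ` to_fract ` J"
  have sK: "fract_submodule K" unfolding K_def by (intro fract_submodule_times fract_submodule_image iJ)
  have xK: "(*) ?x ` K = to_fract ` J" unfolding K_def times_times_image using x0 by simp
  have "inverse ?x * ?x \<in> K" unfolding K_def using x(1) by blast
  then have K1: "1 \<in> K" using x0 by simp
  have KB: "K \<subseteq> ?B"
  proof
    fix z assume "z \<in> K"
    then obtain j where "z = inverse ?x * to_fract j" "j \<in> J" unfolding K_def by blast
    then obtain w where "w \<in> ?B" "z = inverse ?x * (?x * w)" using x(2) by metis
    then show "z \<in> ?B" using x0 by (simp flip: mult.assoc)
  qed
  have fin: "fractional ?B" by (rule fractional_integral_closure[OF unram])
  have socle: "fract_length {q. \<forall>r\<in>m. fract_scale r q \<in> K} K \<le> 1"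
    using socle_fract_length_le_1[OF f(1) \<open>inj f\<close> x0] unfolding f(2) K_def .
  have main: "fract_length ?B ?R = fract_length K ?R + fract_length ?R (conductor :: 'a fract set)"
    by (rule integral_closure_length[OF fin sK K1 KB socle])
  have "?R \<noteq> {0}" by (metis rangeI singletonD to_fract_1 zero_neq_one)
  then have finB: "fract_length ?B ?R \<noteq> \<infinity>"
    using fract_length_finite[OF fract_submodule_integral_closure fin fract_submodule_range] to_fract_integral by blast
  obtain a c where a: "fract_length K ?R = enat a" and c: "fract_length ?R (conductor :: 'a fract set) = enat c"
    using main finB by (metis not_infinity_eq plus_enat_simps(2,3))
  obtain e where e: "principal_colength x = enat e" using principal_colength_finite[OF \<open>x \<noteq> 0\<close>] by auto
  obtain h where h: "h_inv s = enat h" using h_inv_attained_finite(2) by auto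
  have RK: "?R \<subseteq> K"
  proof
    fix z assume "z \<in> ?R"
    then obtain r where "z = to_fract r * 1" by auto
    then show "z \<in> K" using fract_smult[OF sK K1] by simp
  qed
  have xRJ: "range ((*) x) \<subseteq> J" by (rule principal_subset_ideal[OF iJ x(1)])
  have "principal_colength x = colength J + quot_length (*) J (range ((*) x))"
    unfolding colength_def
    by (rule module.len_additive[OF module_times principal_ideal iJ ideal_UNIV xRJ subset_UNIV])
  also have "quot_length (*) J (range ((*) x)) = fract_length (to_fract ` J) (to_fract ` range ((*) x))"
    by (rule fract_length_to_fract[OF iJ principal_ideal xRJ, symmetric])
  also have "\<dots> = fract_length ((*) ?x ` K) ((*) ?x ` ?R)" unfolding xK to_fract_times_image ..
  also have "\<dots> = fract_length K ?R" by (rule fract_length_times[OF sK fract_submodule_range RK x0])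
  finally have eha: "e = h + a" using e hJ h a by simp
  have mult: "hs_mult J = real e" by (rule hs_mult_eq_principal_colength[OF x(1) \<open>x \<noteq> 0\<close> e xJ finB])
  obtain k where k: "min_gens s = Suc k" using min_gens_ge_1 by (cases "min_gens s") auto
  have "almost_gorenstein s \<longleftrightarrow> enat a + enat c = enat c + enat (Suc k) - 1"
    unfolding almost_gorenstein_def main a c k ..
  also have "\<dots> \<longleftrightarrow> a = k" by (auto simp: one_enat_def)
  also have "\<dots> \<longleftrightarrow> ereal_of_enat (h_inv s) = ereal (hs_mult J - real (min_gens s) + 1)"
    unfolding h mult eha k by auto
  finally show ?thesis .
qed

end

theorem corollary4p8:
  fixes m :: "'a::idom set"
    and s :: "'a \<Rightarrow> 'b::ab_group_add \<Rightarrow> 'b"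
  assumes "noetherian_ring TYPE('a)"
    and "local_ring m"
    and "krull_dim TYPE('a) = 1"
    and "analytically_unramified m"
    and "infinite (residue_ring m)"
    and "canonical_module m s"
    and "\<not> gorenstein m"
  shows "almost_gorenstein s \<longleftrightarrow>
    (\<forall>J. partial_trace_ideal s J \<longrightarrow>
      ereal_of_enat (h_inv s) = ereal (hs_mult J - real (min_gens s) + 1))"
proof -
  interpret local_domain_with_canonical_module m s
    by unfold_locales (fact assms)+
  show ?thesis
    using almost_gorenstein_iff_partial_trace[OF assms(5,4)] h_inv_attained_finite(1) by blast
qed

end
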